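(* Let $u$ be the solution to (SHE). Suppose that $$\mathrm{Lip}_\sigma<[\Upsilon(0)]^{-1/2},$$ and that there exists $\alpha\in(1,\infty)$ such that $$\mathrm{P}\{X_t=X'_t\}=O(t^{-\alpha})\qquad(t\to\infty),$$ where $X'$ denotes an independent copy of $X$. If, in addition, $u_0\in\ell^1(\mathbf{Z}^d)$ and the underlying probability space is complete, then $$\lim_{t\to\infty}\sup_{x\in\mathbf{Z}^d}|u_t(x)|=\lim_{t\to\infty}\sum_{x\in\mathbf{Z}^d}|u_t(x)|^2=0\qquad\text{almost surely}.$$
   Context: Fix an integer $d\ge 1$. Let $\{B(x)\}_{x\in\mathbf{Z}^d}$ be independent standard one-dimensional Brownian motions on a probability space $(\Omega,\mathcal{F},\mathrm{P})$; predictability refers to the (suitably augmented) filtration generated by them. The function $\sigma:\mathbf{R}\to\mathbf{R}$ is nonrandom, Lipschitz continuous, and $\sigma(0)=0$; $\mathrm{Lip}_\sigma:=\sup_{a\ne b}|\sigma(a)-\sigma(b)|/|a-b|$. Let $X_t=\sum_{j=1}^{N_t}Z_j$ be a continuous-time random walk on $\mathbf{Z}^d$, where $N$ is a rate-one Poisson process and $Z_1,Z_2,\dots$ are i.i.d. $\mathbf{Z}^d$-valued random variables independent of $N$. $\mathscr{L}$ is its generator, $(\mathscr{L}f)(x)=\mathrm{E}f(x+Z_1)-f(x)$, and $p_t(x):=\mathrm{P}\{X_t=x\}$. With $X'$ an independent copy of $X$, $\Upsilon(0):=\int_0^\infty\mathrm{P}\{X_t=X_t'\}\,\mathrm{d}t$.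 The initial profile $u_0:\mathbf{Z}^d\to\mathbf{R}$ is nonrandom with $u_0(x)\ge0$ for all $x$ and $0<\sup_{x}u_0(x)<\infty$. (SHE) is the system $\mathrm{d}u_t(x)=(\mathscr{L}u_t)(x)\,\mathrm{d}t+\sigma(u_t(x))\,\mathrm{d}B_t(x)$ ($t>0$, $x\in\mathbf{Z}^d$) with initial profile $u_0$, understood in the mild form $$u_t(x)=\sum_{y\in\mathbf{Z}^d}p_t(y-x)u_0(y)+\sum_{y\in\mathbf{Z}^d}\int_0^t p_{t-s}(y-x)\,\sigma(u_s(y))\,\mathrm{d}B_s(y).$$ "The solution" is the predictable, continuous-in-$t$ solution, unique among predictable random fields with $\sup_{t\in[0,T]}\sup_x\mathrm{E}(|u_t(x)|^2)<\infty$ for all $T>0$. *)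

theory Defs
  imports "HOL-Probability.Probability" "HOL-Library.Landau_Symbols"
begin

section \<open>Brownian motions\<close>

definition brownian_motion :: "'w measure \<Rightarrow> (real \<Rightarrow> 'w \<Rightarrow> real) \<Rightarrow> bool" where
  "brownian_motion M B \<longleftrightarrow>
     (\<forall>t\<ge>0. B t \<in> borel_measurable M) \<and>
     (AE \<omega> in M. B 0 \<omega> = 0) \<and>
     (\<forall>s t. 0 \<le> s \<and> s < t \<longrightarrow>
        distributed M lborel (\<lambda>\<omega>. B t \<omega> - B s \<omega>) (normal_density 0 (sqrt (t - s)))) \<and>
     (\<forall>n. \<forall>\<tau> :: nat \<Rightarrow> real. 0 \<le> \<tau> 0 \<and> mono \<tau> \<longrightarrow>
        prob_space.indep_vars M (\<lambda>_. borel) (\<lambda>i \<omega>. B (\<tau> (Suc i)) \<omega> - B (\<tau> i) \<omega>) {..<n}) \<and>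
     (AE \<omega> in M. continuous_on {0..} (\<lambda>t. B t \<omega>))"

definition indep_brownian_motions :: "'w measure \<Rightarrow> ('i \<Rightarrow> real \<Rightarrow> 'w \<Rightarrow> real) \<Rightarrow> bool" where
  "indep_brownian_motions M B \<longleftrightarrow>
     (\<forall>x. brownian_motion M (B x)) \<and>
     prob_space.indep_vars M (\<lambda>_. PiM {0..} (\<lambda>_. borel)) (\<lambda>x \<omega>. \<lambda>t\<in>{0..}. B x t \<omega>) UNIV"

text \<open>The usual augmentation (null sets added, then made right-continuous) of the filtration
  generated by the whole family of Brownian motions.\<close>

definition bm_raw_events :: "'w measure \<Rightarrow> ('i \<Rightarrow> real \<Rightarrow> 'w \<Rightarrow> real) \<Rightarrow> real \<Rightarrow> 'w set set" where
  "bm_raw_events M B t =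
     sigma_sets (space M)
       ({B x s -` A \<inter> space M | x s A. 0 \<le> s \<and> s \<le> t \<and> A \<in> sets borel} \<union> null_sets M)"

definition bm_filtration :: "'w measure \<Rightarrow> ('i \<Rightarrow> real \<Rightarrow> 'w \<Rightarrow> real) \<Rightarrow> real \<Rightarrow> 'w measure" where
  "bm_filtration M B t = sigma (space M) (\<Inter>s\<in>{t<..}. bm_raw_events M B s)"

lemma bm_raw_events_gen:
  "{B x s -` A \<inter> space M | x s A. 0 \<le> s \<and> s \<le> t \<and> A \<in> sets borel} \<union> null_sets M
     \<subseteq> Pow (space M)"
  using sets.sets_into_space by (fastforce simp: null_sets_def)

lemma bm_raw_events_sigma_algebra: "sigma_algebra (space M) (bm_raw_events M B t)"
  unfolding bm_raw_events_def by (rule sigma_algebra_sigma_sets[OF bm_raw_events_gen])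

lemma space_bm_filtration [simp]: "space (bm_filtration M B t) = space M"
  unfolding bm_filtration_def by (simp add: space_measure_of_conv)

lemma sets_bm_filtration:
  "sets (bm_filtration M B t) = (\<Inter>s\<in>{t<..}. bm_raw_events M B s)"
proof -
  have ne: "{t<..} \<noteq> {}" by (metis gt_ex empty_iff greaterThan_iff)
  have sa: "sigma_algebra (space M) (\<Inter>s\<in>{t<..}. bm_raw_events M B s)"
  proof -
    interpret S: sigma_algebra "space M" "bm_raw_events M B s" for s
      by (rule bm_raw_events_sigma_algebra)
    have "A \<subseteq> space M" if "A \<in> (\<Inter>s\<in>{t<..}. bm_raw_events M B s)" for A
      using that ne S.sets_into_space by (metis INT_E ex_in_conv)
    moreover have "(\<Union>i. A i) \<in> (\<Inter>s\<in>{t<..}. bm_raw_events M B s)"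
      if "range A \<subseteq> (\<Inter>s\<in>{t<..}. bm_raw_events M B s)" for A :: "nat \<Rightarrow> 'a set"
      using that by (intro INT_I S.countable_nat_UN) blast
    ultimately show ?thesis
      unfolding sigma_algebra_iff2 by blast
  qed
  show ?thesis
    unfolding bm_filtration_def by (rule sigma_algebra.sets_measure_of_eq[OF sa])
qed

lemma filtration_bm_filtration: "filtration (space M) (bm_filtration M B)"
  by standard (auto simp: sets_bm_filtration)


section \<open>Predictability and the Ito integral\<close>

definition predictable_sigma :: "'w set \<Rightarrow> (real \<Rightarrow> 'w measure) \<Rightarrow> (real \<times> 'w) measure" where
  "predictable_sigma \<Omega> F =
     sigma ({0..} \<times> \<Omega>)
       ({{0} \<times> A | A. A \<in> sets (F 0)} \<union>
        {{s<..t} \<times> A | s t A. 0 \<le> s \<and> s \<le> t \<and> A \<in> sets (F s)})"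

definition predictable :: "'w set \<Rightarrow> (real \<Rightarrow> 'w measure) \<Rightarrow> (real \<Rightarrow> 'w \<Rightarrow> real) \<Rightarrow> bool" where
  "predictable \<Omega> F f \<longleftrightarrow> (\<lambda>(s, \<omega>). f s \<omega>) \<in> borel_measurable (predictable_sigma \<Omega> F)"

definition simple_data ::
  "'w set \<Rightarrow> (real \<Rightarrow> 'w measure) \<Rightarrow> nat \<Rightarrow> (nat \<Rightarrow> real) \<Rightarrow> (nat \<Rightarrow> 'w \<Rightarrow> real) \<Rightarrow> bool" where
  "simple_data \<Omega> F n \<tau> \<xi> \<longleftrightarrow>
     0 \<le> \<tau> 0 \<and> mono \<tau> \<and>
     (\<forall>i<n. \<xi> i \<in> borel_measurable (F (\<tau> i)) \<and> (\<exists>C. \<forall>\<omega>\<in>\<Omega>. \<bar>\<xi> i \<omega>\<bar> \<le> C))"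

definition simple_process ::
  "nat \<Rightarrow> (nat \<Rightarrow> real) \<Rightarrow> (nat \<Rightarrow> 'w \<Rightarrow> real) \<Rightarrow> real \<Rightarrow> 'w \<Rightarrow> real" where
  "simple_process n \<tau> \<xi> s \<omega> = (\<Sum>i<n. \<xi> i \<omega> * indicator {\<tau> i<..\<tau> (Suc i)} s)"

definition simple_ito ::
  "(real \<Rightarrow> 'w \<Rightarrow> real) \<Rightarrow> real \<Rightarrow> nat \<Rightarrow> (nat \<Rightarrow> real) \<Rightarrow> (nat \<Rightarrow> 'w \<Rightarrow> real) \<Rightarrow> 'w \<Rightarrow> real" where
  "simple_ito B t n \<tau> \<xi> \<omega> =
     (\<Sum>i<n. \<xi> i \<omega> * (B (min t (\<tau> (Suc i))) \<omega> - B (min t (\<tau> i)) \<omega>))"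

text \<open>\<open>has_ito_integral M F B t f I\<close>: the random variable \<open>I\<close> is a version of the Ito integral of the
  predictable, square-integrable process \<open>f\<close> over \<open>(0,t]\<close>, that is, an \<open>L\<^sup>2\<close> limit of integrals of
  simple processes that approximate \<open>f\<close> in \<open>L\<^sup>2\<close>. Only the values of \<open>f\<close> on \<open>[0,t]\<close> matter.
  Square integrability is implied, since the approximating simple processes are bounded.\<close>

definition has_ito_integral ::
  "'w measure \<Rightarrow> (real \<Rightarrow> 'w measure) \<Rightarrow> (real \<Rightarrow> 'w \<Rightarrow> real) \<Rightarrow> real \<Rightarrow> (real \<Rightarrow> 'w \<Rightarrow> real) \<Rightarrow>
     ('w \<Rightarrow> real) \<Rightarrow> bool" where
  "has_ito_integral M F B t f I \<longleftrightarrow>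
     predictable (space M) F (\<lambda>s \<omega>. indicator {0..t} s * f s \<omega>) \<and>
     I \<in> borel_measurable M \<and>
     (\<exists>n \<tau> \<xi>.
        (\<forall>k. simple_data (space M) F (n k) (\<tau> k) (\<xi> k)) \<and>
        (\<lambda>k. \<integral>\<^sup>+\<omega>. (\<integral>\<^sup>+s\<in>{0..t}.
            ennreal ((simple_process (n k) (\<tau> k) (\<xi> k) s \<omega> - f s \<omega>)\<^sup>2) \<partial>lborel) \<partial>M)
          \<longlonglongrightarrow> 0 \<and>
        (\<lambda>k. \<integral>\<^sup>+\<omega>. ennreal ((simple_ito B t (n k) (\<tau> k) (\<xi> k) \<omega> - I \<omega>)\<^sup>2) \<partial>M)
          \<longlonglongrightarrow> 0)"

definition has_L2_sum :: "'w measure \<Rightarrow> ('i \<Rightarrow> 'w \<Rightarrow> real) \<Rightarrow> ('w \<Rightarrow> real) \<Rightarrow> bool" where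
  "has_L2_sum M I S \<longleftrightarrow>
     S \<in> borel_measurable M \<and>
     ((\<lambda>A. \<integral>\<^sup>+\<omega>. ennreal (((\<Sum>y\<in>A. I y \<omega>) - S \<omega>)\<^sup>2) \<partial>M) \<longlongrightarrow> 0) (finite_subsets_at_top UNIV)"


section \<open>The continuous-time random walk\<close>

text \<open>Paths are almost surely nondecreasing, so the truncated subtraction of \<open>nat\<close> gives the
  genuine increments.\<close>

definition rate_one_poisson_process :: "'v measure \<Rightarrow> (real \<Rightarrow> 'v \<Rightarrow> nat) \<Rightarrow> bool" where
  "rate_one_poisson_process W N \<longleftrightarrow>
     (\<forall>t\<ge>0. N t \<in> measurable W (count_space UNIV)) \<and>
     (AE \<omega> in W. N 0 \<omega> = 0) \<and>
     (AE \<omega> in W. mono_on {0..} (\<lambda>t. N t \<omega>)) \<and>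
     (AE \<omega> in W. \<forall>t\<ge>0. continuous (at_right t) (\<lambda>s. N s \<omega>)) \<and>
     (\<forall>s t. 0 \<le> s \<and> s < t \<longrightarrow>
        distr W (count_space UNIV) (\<lambda>\<omega>. N t \<omega> - N s \<omega>) = measure_pmf (poisson_pmf (t - s))) \<and>
     (\<forall>n. \<forall>\<tau> :: nat \<Rightarrow> real. 0 \<le> \<tau> 0 \<and> mono \<tau> \<longrightarrow>
        prob_space.indep_vars W (\<lambda>_. count_space UNIV)
          (\<lambda>i \<omega>. N (\<tau> (Suc i)) \<omega> - N (\<tau> i) \<omega>) {..<n})"

text \<open>The library's \<open>indep_var\<close> forces both random elements to have the same type.\<close>

definition indep_elements ::
  "'v measure \<Rightarrow> 'a measure \<Rightarrow> ('v \<Rightarrow> 'a) \<Rightarrow> 'b measure \<Rightarrow> ('v \<Rightarrow> 'b) \<Rightarrow> bool" where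
  "indep_elements W Ma X Mb Y \<longleftrightarrow>
     X \<in> measurable W Ma \<and> Y \<in> measurable W Mb \<and>
     prob_space.indep_set W {X -` A \<inter> space W | A. A \<in> sets Ma} {Y -` A \<inter> space W | A. A \<in> sets Mb}"

definition ct_random_walk ::
  "'v measure \<Rightarrow> (real \<Rightarrow> 'v \<Rightarrow> nat) \<Rightarrow> (nat \<Rightarrow> 'v \<Rightarrow> int ^ 'd::finite) \<Rightarrow>
     (real \<Rightarrow> 'v \<Rightarrow> int ^ 'd) \<Rightarrow> bool" where
  "ct_random_walk W N Z X \<longleftrightarrow>
     rate_one_poisson_process W N \<and>
     prob_space.indep_vars W (\<lambda>_. count_space UNIV) Z {1..} \<and>
     (\<forall>j\<ge>1. distr W (count_space UNIV) (Z j) = distr W (count_space UNIV) (Z 1)) \<and>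
     indep_elements W
       (PiM {0..} (\<lambda>_. count_space UNIV)) (\<lambda>\<omega>. \<lambda>t\<in>{0..}. N t \<omega>)
       (PiM {1..} (\<lambda>_. count_space UNIV)) (\<lambda>\<omega>. \<lambda>j\<in>{1..}. Z j \<omega>) \<and>
     (\<forall>t\<ge>0. \<forall>\<omega>\<in>space W. X t \<omega> = (\<Sum>j = 1..N t \<omega>. Z j \<omega>))"

definition independent_copy ::
  "'v measure \<Rightarrow> (real \<Rightarrow> 'v \<Rightarrow> 'a) \<Rightarrow> (real \<Rightarrow> 'v \<Rightarrow> 'a) \<Rightarrow> bool" where
  "independent_copy W X X' \<longleftrightarrow>
     (let P = PiM {0..} (\<lambda>_. count_space UNIV);
          path = (\<lambda>Y \<omega>. \<lambda>t\<in>{0..}. Y t \<omega>)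
      in indep_elements W P (path X) P (path X') \<and> distr W P (path X') = distr W P (path X))"

definition walk_prob :: "'v measure \<Rightarrow> (real \<Rightarrow> 'v \<Rightarrow> 'a) \<Rightarrow> real \<Rightarrow> 'a \<Rightarrow> real" where
  "walk_prob W X t x = measure W {\<omega> \<in> space W. X t \<omega> = x}"

definition collision_prob :: "'v measure \<Rightarrow> (real \<Rightarrow> 'v \<Rightarrow> 'a) \<Rightarrow> (real \<Rightarrow> 'v \<Rightarrow> 'a) \<Rightarrow> real \<Rightarrow> real" where
  "collision_prob W X X' t = measure W {\<omega> \<in> space W. X t \<omega> = X' t \<omega>}"

text \<open>Takes values in \<open>[0,\<infinity>]\<close>. When it is infinite, \<open>enn2real\<close> and \<open>powr\<close> turn its power \<open>-1/2\<close> into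
  \<open>0\<close>, in agreement with the convention \<open>\<infinity> powr (-1/2) = 0\<close>. It is never \<open>0\<close> for a random walk.\<close>

definition Upsilon0 :: "'v measure \<Rightarrow> (real \<Rightarrow> 'v \<Rightarrow> 'a) \<Rightarrow> (real \<Rightarrow> 'v \<Rightarrow> 'a) \<Rightarrow> ennreal" where
  "Upsilon0 W X X' = (\<integral>\<^sup>+t\<in>{0..}. ennreal (collision_prob W X X' t) \<partial>lborel)"


section \<open>The stochastic heat equation\<close>

text \<open>Only meaningful for Lipschitz \<open>\<sigma>\<close>; otherwise the set may be unbounded.\<close>

definition Lip_const :: "(real \<Rightarrow> real) \<Rightarrow> real" where
  "Lip_const \<sigma> = (SUP (a, b)\<in>{(a, b). a \<noteq> b}. \<bar>\<sigma> a - \<sigma> b\<bar> / \<bar>a - b\<bar>)"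

definition SHE_mild ::
  "'w measure \<Rightarrow> ('i::ab_group_add \<Rightarrow> real \<Rightarrow> 'w \<Rightarrow> real) \<Rightarrow> (real \<Rightarrow> 'i \<Rightarrow> real) \<Rightarrow> (real \<Rightarrow> real) \<Rightarrow>
     ('i \<Rightarrow> real) \<Rightarrow> (real \<Rightarrow> 'i \<Rightarrow> 'w \<Rightarrow> real) \<Rightarrow> bool" where
  "SHE_mild M B p \<sigma> u0 u \<longleftrightarrow>
     (\<forall>t\<ge>0. \<forall>x. \<exists>I S.
        (\<forall>y. has_ito_integral M (bm_filtration M B) (B y) t
               (\<lambda>s \<omega>. p (t - s) (y - x) * \<sigma> (u s y \<omega>)) (I y)) \<and>
        has_L2_sum M I S \<and>
        (AE \<omega> in M. u t x \<omega> = (\<Sum>\<^sub>\<infinity>y. p t (y - x) * u0 y) + S \<omega>))"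

definition SHE_solution ::
  "'w measure \<Rightarrow> ('i::ab_group_add \<Rightarrow> real \<Rightarrow> 'w \<Rightarrow> real) \<Rightarrow> (real \<Rightarrow> 'i \<Rightarrow> real) \<Rightarrow> (real \<Rightarrow> real) \<Rightarrow>
     ('i \<Rightarrow> real) \<Rightarrow> (real \<Rightarrow> 'i \<Rightarrow> 'w \<Rightarrow> real) \<Rightarrow> bool" where
  "SHE_solution M B p \<sigma> u0 u \<longleftrightarrow>
     (\<forall>x. predictable (space M) (bm_filtration M B) (\<lambda>t. u t x)) \<and>
     (\<forall>x. AE \<omega> in M. continuous_on {0..} (\<lambda>t. u t x \<omega>)) \<and>
     (\<forall>T>0. (SUP t\<in>{0..T}. SUP x. \<integral>\<^sup>+\<omega>. ennreal (\<bar>u t x \<omega>\<bar>\<^sup>2) \<partial>M) < \<infinity>) \<and>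
     SHE_mild M B p \<sigma> u0 u"

end

theory Submission
  imports Defs
begin

text \<open>Let \<open>U(t)\<close> be the sum over \<open>x\<close> of \<open>E |u\<^sub>t(x)|\<^sup>2\<close>. The Ito isometry and the mild formula give a renewal
  inequality \<open>U \<le> \<parallel>u\<^sub>0\<parallel>\<^sup>2 q + Lip\<^sup>2 (q * U)\<close> with the collision probability \<open>q\<close>, whose integral
  is \<open>\<Upsilon>(0)\<close>; hence \<open>Lip\<^sup>2 \<Upsilon>(0) < 1\<close> makes \<open>U\<close> integrable over \<open>[0, \<infinity>)\<close>. On the other hand
  the mild formula and the semigroup property of the walk give \<open>E(u\<^sub>t | F\<^sub>s) = P\<^sub>t\<^sub>-\<^sub>s u\<^sub>s\<close>, and for \<open>t - s \<le> 1/4\<close> the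
  walk stays put with probability at least \<open>3/4\<close>, so that \<open>P\<^sub>t\<^sub>-\<^sub>s\<close> is bounded below on \<open>\<ell>\<^sup>2\<close>. By
  Jensen's inequality the process \<open>\<parallel>u\<^sub>t\<parallel>\<^sup>2\<close> is therefore, up to a constant, a submartingale on short time intervals,
  and Doob's maximal inequality bounds the probability that \<open>\<parallel>u\<^sub>t\<parallel>\<^sup>2\<close> reaches \<open>\<epsilon>\<close> there by \<open>5 U(c) / \<epsilon>\<close> for
  any slightly later time \<open>c\<close>. Averaging over \<open>c\<close>, these probabilities are summable over consecutive
  intervals, and the Borel-Cantelli lemma applies.\<close>

section \<open>Square-integrable functions\<close>

text \<open>A priori only the supremum over \<open>x\<close> of the second moments is known to be
  finite, locally in time. So \<open>U\<close> could be infinite, and the term with \<open>U\<close>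
  cannot simply be absorbed. The renewal inequality is therefore solved pointwise in space-time,
  where \<open>n\<close> iterations leave an error \<open>C * \<rho> ^ n\<close> on every finite
  horizon; the sum over \<open>x\<close> is taken afterwards. No evolution equation for the squared
  norm is used: conditional expectations appear only through testing against events of
  \<open>F s\<close>, and all times of a short interval are compared with one common later time. The
  constants fit together as follows. The bound \<open>exp (- 1 / 4) \<ge> 3 / 4\<close> fixes the
  admissible time gap; splitting off the moving part of the walk costs a factor 32/7, rounded up to
  5; a block of length 1/8 followed by a window of length 1/8 keeps all gaps below 1/4. Finally,
  each \<open>u t x\<close> is continuous in \<open>t\<close>, but the infinite sum of squares is
  only known to be lower semicontinuous, so bounds at rational times reach all times through finite
  sums.\<close>

definition sq_integrable :: "'a measure \<Rightarrow> ('a \<Rightarrow> real) \<Rightarrow> bool" where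
  "sq_integrable N f \<longleftrightarrow> f \<in> borel_measurable N \<and> integrable N (\<lambda>x. (f x)\<^sup>2)"

definition L2_norm :: "'a measure \<Rightarrow> ('a \<Rightarrow> real) \<Rightarrow> real" where
  "L2_norm N f = sqrt (\<integral>x. (f x)\<^sup>2 \<partial>N)"

lemma sq_integrable_measurable: "sq_integrable N f \<Longrightarrow> f \<in> borel_measurable N"
  and sq_integrable_square: "sq_integrable N f \<Longrightarrow> integrable N (\<lambda>x. (f x)\<^sup>2)"
  by (auto simp: sq_integrable_def)

lemma L2_norm_nonneg [simp]: "0 \<le> L2_norm N f"
  by (simp add: L2_norm_def)

lemma L2_norm_sq: "(L2_norm N f)\<^sup>2 = (\<integral>x. (f x)\<^sup>2 \<partial>N)"
  by (simp add: L2_norm_def)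

lemma sq_integrable_bound:
  assumes "g \<in> borel_measurable N" "sq_integrable N f" "\<And>x. x \<in> space N \<Longrightarrow> \<bar>g x\<bar> \<le> \<bar>f x\<bar>"
  shows "sq_integrable N g"
  unfolding sq_integrable_def
proof
  show "integrable N (\<lambda>x. (g x)\<^sup>2)"
    by (rule Bochner_Integration.integrable_bound[OF sq_integrable_square[OF assms(2)]])
      (use assms in \<open>auto intro!: AE_I2 simp: abs_le_square_iff\<close>)
qed fact

lemma sq_integrable_mult:
  assumes "sq_integrable N f" "sq_integrable N g"
  shows "integrable N (\<lambda>x. f x * g x)"
proof (rule Bochner_Integration.integrable_bound)
  show "integrable N (\<lambda>x. (f x)\<^sup>2 + (g x)\<^sup>2)"
    using assms by (auto simp: sq_integrable_def)
  have "\<bar>a * b\<bar> \<le> a\<^sup>2 + b\<^sup>2" for a b :: real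
  proof -
    have "0 \<le> (\<bar>a\<bar> - \<bar>b\<bar>)\<^sup>2" by simp
    then show ?thesis
      using mult_nonneg_nonneg[OF abs_ge_zero[of a] abs_ge_zero[of b]]
      unfolding power2_diff abs_mult power2_abs by linarith
  qed
  then show "AE x in N. norm (f x * g x) \<le> norm ((f x)\<^sup>2 + (g x)\<^sup>2)"
    by auto
qed (use assms in \<open>auto simp: sq_integrable_def\<close>)

lemma sq_integrable_cmult:
  "sq_integrable N f \<Longrightarrow> sq_integrable N (\<lambda>x. c * f x)"
  by (auto simp: sq_integrable_def power_mult_distrib)

lemma sq_integrable_add:
  assumes "sq_integrable N f" "sq_integrable N g"
  shows "sq_integrable N (\<lambda>x. f x + g x)"
proof -
  have "integrable N (\<lambda>x. (f x)\<^sup>2 + (g x)\<^sup>2 + 2 * (f x * g x))"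
    using sq_integrable_mult[OF assms] assms by (auto simp: sq_integrable_def)
  then show ?thesis
    using assms by (auto simp: sq_integrable_def power2_sum mult.assoc)
qed

lemma sq_integrable_diff:
  assumes "sq_integrable N f" "sq_integrable N g"
  shows "sq_integrable N (\<lambda>x. f x - g x)"
  using sq_integrable_add[OF assms(1) sq_integrable_cmult[OF assms(2), of "-1"]] by simp

lemma sq_integrable_indicator:
  assumes "sq_integrable N f" "A \<in> sets N"
  shows "sq_integrable N (\<lambda>x. indicator A x * f x)"
  by (rule sq_integrable_bound[OF _ assms(1)])
    (use assms in \<open>auto simp: sq_integrable_def indicator_def\<close>)

lemma Cauchy_Schwarz_integral:
  assumes f: "sq_integrable N f" and g: "sq_integrable N g"
  shows "\<bar>\<integral>x. f x * g x \<partial>N\<bar> \<le> L2_norm N f * L2_norm N g"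
proof -
  let ?a = "\<integral>x. (f x)\<^sup>2 \<partial>N" and ?b = "\<integral>x. f x * g x \<partial>N" and ?c = "\<integral>x. (g x)\<^sup>2 \<partial>N"
  note int = sq_integrable_square[OF f] sq_integrable_square[OF g] sq_integrable_mult[OF f g]
  have quad: "0 \<le> ?a * s\<^sup>2 + 2 * s * t * ?b + t\<^sup>2 * ?c" for s t
  proof -
    have "0 \<le> (\<integral>x. (s * f x + t * g x)\<^sup>2 \<partial>N)" by simp
    also have "\<dots> = (\<integral>x. s\<^sup>2 * (f x)\<^sup>2 + 2 * s * t * (f x * g x) + t\<^sup>2 * (g x)\<^sup>2 \<partial>N)"
      by (rule Bochner_Integration.integral_cong) (auto simp: power2_sum power_mult_distrib)
    also have "\<dots> = ?a * s\<^sup>2 + 2 * s * t * ?b + t\<^sup>2 * ?c"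
      using int by simp
    finally show ?thesis .
  qed
  have "?b\<^sup>2 \<le> ?a * ?c"
  proof (cases "?a = 0")
    case True
    have "?b = 0"
    proof (rule ccontr)
      assume "?b \<noteq> 0"
      \<comment> \<open>With \<open>?a = 0\<close> this choice gives the quadratic form the value
        -1.\<close>
      with quad[of "- (?c + 1) / (2 * ?b)" 1] True show False by (simp add: field_simps)
    qed
    then show ?thesis using True by simp
  next
    case False
    then have "?a > 0" by (metis integral_nonneg_AE AE_I2 zero_le_power2 less_eq_real_def)
    \<comment> \<open>For second coordinate \<open>?a\<close>, the form is smallest at first
      coordinate \<open>- ?b\<close>.\<close>
    have "0 \<le> ?a * (?a * ?c - ?b\<^sup>2)"
      using quad[of "- ?b" ?a] by (simp add: power2_eq_square algebra_simps)
    then show ?thesis using \<open>?a > 0\<close> by (simp add: zero_le_mult_iff)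
  qed
  then have "sqrt (?b\<^sup>2) \<le> sqrt (?a * ?c)" by (rule real_sqrt_le_mono)
  then show ?thesis by (simp add: L2_norm_def real_sqrt_mult)
qed

lemma L2_norm_triangle:
  assumes f: "sq_integrable N f" and g: "sq_integrable N g"
  shows "L2_norm N (\<lambda>x. f x + g x) \<le> L2_norm N f + L2_norm N g"
proof (rule power2_le_imp_le)
  have "(L2_norm N (\<lambda>x. f x + g x))\<^sup>2 = (\<integral>x. (f x)\<^sup>2 + 2 * (f x * g x) + (g x)\<^sup>2 \<partial>N)"
    unfolding L2_norm_sq
    by (rule Bochner_Integration.integral_cong) (auto simp: power2_sum)
  also have "\<dots> = (L2_norm N f)\<^sup>2 + 2 * (\<integral>x. f x * g x \<partial>N) + (L2_norm N g)\<^sup>2"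
    using sq_integrable_square[OF f] sq_integrable_square[OF g] sq_integrable_mult[OF f g]
    by (simp add: L2_norm_sq)
  also have "\<dots> \<le> (L2_norm N f + L2_norm N g)\<^sup>2"
    using Cauchy_Schwarz_integral[OF f g] by (simp add: power2_sum)
  finally show "(L2_norm N (\<lambda>x. f x + g x))\<^sup>2 \<le> (L2_norm N f + L2_norm N g)\<^sup>2" .
qed simp

lemma L2_norm_cmult: "L2_norm N (\<lambda>x. c * f x) = \<bar>c\<bar> * L2_norm N f"
  by (simp add: L2_norm_def power_mult_distrib real_sqrt_mult)

lemma L2_norm_minus_commute: "L2_norm N (\<lambda>x. f x - g x) = L2_norm N (\<lambda>x. g x - f x)"
  by (simp add: L2_norm_def power2_commute)

lemma L2_norm_diff_triangle:
  assumes "sq_integrable N f" "sq_integrable N g" "sq_integrable N h"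
  shows "L2_norm N (\<lambda>x. f x - h x) \<le> L2_norm N (\<lambda>x. f x - g x) + L2_norm N (\<lambda>x. g x - h x)"
  using L2_norm_triangle[OF sq_integrable_diff[OF assms(1,2)] sq_integrable_diff[OF assms(2,3)]]
  by simp

lemma L2_norm_diff_bound:
  assumes f: "sq_integrable N f" and g: "sq_integrable N g"
  shows "\<bar>L2_norm N f - L2_norm N g\<bar> \<le> L2_norm N (\<lambda>x. f x - g x)"
proof -
  have "L2_norm N f \<le> L2_norm N g + L2_norm N (\<lambda>x. f x - g x)"
    using L2_norm_triangle[OF g sq_integrable_diff[OF f g]] by simp
  moreover have "L2_norm N g \<le> L2_norm N f + L2_norm N (\<lambda>x. g x - f x)"
    using L2_norm_triangle[OF f sq_integrable_diff[OF g f]] by simp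
  ultimately show ?thesis by (simp add: L2_norm_minus_commute[of N g])
qed

lemma L2_norm_mono:
  assumes "g \<in> borel_measurable N" "sq_integrable N f" "\<And>x. x \<in> space N \<Longrightarrow> \<bar>g x\<bar> \<le> \<bar>f x\<bar>"
  shows "L2_norm N g \<le> L2_norm N f"
  unfolding L2_norm_def
  using sq_integrable_bound[OF assms] assms
  by (intro real_sqrt_le_mono integral_mono) (auto simp: sq_integrable_def abs_le_square_iff)

lemma sq_integrable_iff_nn_integral:
  assumes "f \<in> borel_measurable N"
  shows "sq_integrable N f \<longleftrightarrow> (\<integral>\<^sup>+x. ennreal ((f x)\<^sup>2) \<partial>N) < \<infinity>"
  using assms by (simp add: sq_integrable_def integrable_iff_bounded)

lemma L2_norm_nn_integral:
  assumes "sq_integrable N f"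
  shows "ennreal ((L2_norm N f)\<^sup>2) = (\<integral>\<^sup>+x. ennreal ((f x)\<^sup>2) \<partial>N)"
  unfolding L2_norm_sq using assms
  by (subst nn_integral_eq_integral) (auto simp: sq_integrable_def)

text \<open>The Bochner integral of a non-integrable function is 0, so smallness of
  \<open>L2_norm\<close> alone would prove nothing. The second conclusion records that the functions
  do lie in L2 from some index on.\<close>

lemma L2_norm_tendsto_0I:
  assumes "(\<lambda>n. \<integral>\<^sup>+x. ennreal ((f n x)\<^sup>2) \<partial>N) \<longlonglongrightarrow> 0"
    and "\<And>n. f n \<in> borel_measurable N"
  shows "(\<lambda>n. L2_norm N (f n)) \<longlonglongrightarrow> 0" "\<forall>\<^sub>F n in sequentially. sq_integrable N (f n)"
proof -
  have ev: "\<forall>\<^sub>F n in sequentially. (\<integral>\<^sup>+x. ennreal ((f n x)\<^sup>2) \<partial>N) < 1"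
    using assms(1) by (rule order_tendstoD) simp
  then show si: "\<forall>\<^sub>F n in sequentially. sq_integrable N (f n)"
    by eventually_elim
      (use assms(2) in \<open>auto simp: sq_integrable_iff_nn_integral intro: less_trans\<close>)
  have "(\<lambda>n. sqrt (enn2real (\<integral>\<^sup>+x. ennreal ((f n x)\<^sup>2) \<partial>N))) \<longlonglongrightarrow> sqrt 0"
    by (intro tendsto_real_sqrt tendsto_enn2real) (use assms(1) in auto)
  moreover have "\<forall>\<^sub>F n in sequentially.
      sqrt (enn2real (\<integral>\<^sup>+x. ennreal ((f n x)\<^sup>2) \<partial>N)) = L2_norm N (f n)"
    using si by eventually_elim (simp add: L2_norm_nn_integral[symmetric])
  ultimately show "(\<lambda>n. L2_norm N (f n)) \<longlonglongrightarrow> 0"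
    unfolding real_sqrt_zero by (rule Lim_transform_eventually)
qed

section \<open>Brownian increments are independent of the past\<close>

lemma sigma_algebra_Int:
  assumes "sigma_algebra \<Omega> \<A>" "a \<in> \<A>" "b \<in> \<A>"
  shows "a \<inter> b \<in> \<A>"
proof -
  interpret sigma_algebra \<Omega> \<A> by fact
  show ?thesis using assms(2,3) by (rule Int)
qed

lemma Int_stable_vimage: "Int_stable {X -` A \<inter> \<Omega> | A. A \<in> sets N}"
proof (rule Int_stableI)
  fix E1 E2 assume "E1 \<in> {X -` A \<inter> \<Omega> | A. A \<in> sets N}" "E2 \<in> {X -` A \<inter> \<Omega> | A. A \<in> sets N}"
  then obtain A1 A2 where "A1 \<in> sets N" "A2 \<in> sets N" "E1 = X -` A1 \<inter> \<Omega>" "E2 = X -` A2 \<inter> \<Omega>" by auto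
  then show "E1 \<inter> E2 \<in> {X -` A \<inter> \<Omega> | A. A \<in> sets N}" by (intro CollectI exI[of _ "A1 \<inter> A2"]) auto
qed

text \<open>The definition supplies independence only for finitely many consecutive increments.
  Events that constrain \<open>b\<close> at finitely many times up to \<open>r\<close> form a
  pi-system generating the past, and after refinement of the times each of them depends, up to a
  null set, on increments before \<open>r\<close> only.\<close>

lemma (in prob_space) brownian_increment_indep_past:
  fixes b :: "real \<Rightarrow> 'a \<Rightarrow> real"
  assumes bm: "brownian_motion M b" and rt: "0 \<le> r" "r \<le> t"
  shows "indep_set
    (sigma_sets (space M) {b s -` A \<inter> space M | s A. 0 \<le> s \<and> s \<le> r \<and> A \<in> sets borel})
    {(\<lambda>\<omega>. b t \<omega> - b r \<omega>) -` A \<inter> space M | A. A \<in> sets borel}"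
proof -
  have [measurable]: "b s \<in> borel_measurable M" if "0 \<le> s" for s
    using bm that by (auto simp: brownian_motion_def)
  have b0: "AE \<omega> in M. b 0 \<omega> = 0" using bm by (auto simp: brownian_motion_def)
  have [measurable]: "b t \<in> borel_measurable M" "b r \<in> borel_measurable M" using rt by auto
  let ?P = "{{\<omega>\<in>space M. \<forall>s\<in>T. b s \<omega> \<in> A s} | T A. finite T \<and> T \<subseteq> {0..r} \<and> (\<forall>s. A s \<in> sets (borel::real measure))}"
  let ?D = "{(\<lambda>\<omega>. b t \<omega> - b r \<omega>) -` A \<inter> space M | A. A \<in> sets borel}"
  have Pev: "{\<omega>\<in>space M. \<forall>s\<in>T. b s \<omega> \<in> A s} \<in> events"
    if "finite T" "T \<subseteq> {0..r}" "\<forall>s. A s \<in> sets (borel::real measure)" for T A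
  proof -
    have "{\<omega>\<in>space M. b s \<omega> \<in> A s} \<in> events" if "s \<in> T" for s
    proof -
      have "b s -` A s \<inter> space M \<in> events"
        using that \<open>T \<subseteq> {0..r}\<close> \<open>\<forall>s. A s \<in> sets borel\<close>
        by (intro measurable_sets[of "b s" M borel]) auto
      then show ?thesis by (simp add: vimage_def Int_def conj_commute)
    qed
    then show ?thesis using that(1) by (rule sets.sets_Collect_finite_All)
  qed
  have "indep_set ?P ?D"
  proof (rule indep_setI)
    show "?P \<subseteq> events" using Pev by auto
    show "?D \<subseteq> events" by auto
    fix E D assume "E \<in> ?P" "D \<in> ?D"
    then obtain T A C where T: "finite T" "T \<subseteq> {0..r}" and A: "\<forall>s. A s \<in> sets (borel::real measure)"
      and E: "E = {\<omega>\<in>space M. \<forall>s\<in>T. b s \<omega> \<in> A s}"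
      and C: "C \<in> sets borel" and D: "D = (\<lambda>\<omega>. b t \<omega> - b r \<omega>) -` C \<inter> space M"
      by blast
    \<comment> \<open>Adding 0 makes every \<open>b s\<close> a sum of increments; adding
      \<open>r\<close> makes the last increment start exactly at \<open>r\<close>.\<close>
    define T' where "T' = insert 0 (insert r T)"
    have T': "finite T'" "T' \<subseteq> {0..r}" "0 \<in> T'" "r \<in> T'" using T rt by (auto simp: T'_def)
    define xs where "xs = sorted_list_of_set T'"
    define n where "n = length xs"
    have xs: "sorted xs" "set xs = T'" using T' by (auto simp: xs_def)
    have n: "n > 0" using xs T' by (auto simp: n_def)
    \<comment> \<open>Beyond the listed times the sequence is constantly \<open>t\<close>, so it is
      monotone on all of \<open>nat\<close> and increment number \<open>n - 1\<close> is
      \<open>b t - b r\<close>.\<close>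
    define \<tau> where "\<tau> i = (if i < n then xs ! i else t)" for i
    have in01: "xs ! i \<in> {0..r}" if "i < n" for i
      using that xs T' by (metis n_def nth_mem subsetD)
    have mono: "mono \<tau>"
      unfolding \<tau>_def mono_def
      using sorted_nth_mono[OF xs(1)] in01 rt by (fastforce simp: n_def)
    have \<tau>0: "\<tau> 0 = 0"
    proof -
      obtain j where j: "j < n" "xs ! j = 0" using T' xs by (metis in_set_conv_nth n_def)
      then have "xs ! 0 \<le> 0" using sorted_nth_mono[OF xs(1), of 0 j] by (simp add: n_def)
      then show ?thesis using in01[OF n] n by (auto simp: \<tau>_def)
    qed
    have \<tau>n: "\<tau> (n - 1) = r"
    proof -
      obtain j where j: "j < n" "xs ! j = r" using T' xs by (metis in_set_conv_nth n_def)
      then have "r \<le> xs ! (n - 1)"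
        using sorted_nth_mono[OF xs(1), of j "n - 1"] by (simp add: n_def)
      then show ?thesis using in01[of "n - 1"] n by (auto simp: \<tau>_def)
    qed
    have \<tau>nn: "0 \<le> \<tau> i" for i using mono \<tau>0 by (metis monoD zero_le)
    define \<Delta> where "\<Delta> i \<omega> = b (\<tau> (Suc i)) \<omega> - b (\<tau> i) \<omega>" for i \<omega>
    have [measurable]: "\<Delta> i \<in> borel_measurable M" for i
      unfolding \<Delta>_def using \<tau>nn by measurable
    have last: "\<Delta> (n - 1) \<omega> = b t \<omega> - b r \<omega>" for \<omega>
      using n \<tau>n by (simp add: \<Delta>_def) (simp add: \<tau>_def)
    have "indep_vars (\<lambda>_. borel) \<Delta> {..<n}"
      unfolding \<Delta>_def using bm mono \<tau>0 by (auto simp: brownian_motion_def)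
    then have ind: "indep_var (PiM {..<n-1} (\<lambda>_. borel)) (\<lambda>\<omega>. restrict (\<lambda>i. \<Delta> i \<omega>) {..<n-1})
        (PiM {n-1} (\<lambda>_. borel)) (\<lambda>\<omega>. restrict (\<lambda>i. \<Delta> i \<omega>) {n-1})"
      by (rule indep_var_restrict) (use n in auto)
    have tel: "b (\<tau> j) \<omega> = b 0 \<omega> + (\<Sum>i<j. \<Delta> i \<omega>)" for j \<omega>
      by (induction j) (auto simp: \<Delta>_def \<tau>0)
    have "\<forall>s\<in>T. \<exists>j<n. \<tau> j = s"
      using xs by (auto simp: \<tau>_def n_def T'_def) (metis in_set_conv_nth insertCI)
    then obtain J where J: "\<And>s. s \<in> T \<Longrightarrow> J s < n \<and> \<tau> (J s) = s" by metis
    let ?S = "{f \<in> space (PiM {..<n-1} (\<lambda>_. borel)). \<forall>s\<in>T. (\<Sum>i<J s. f i) \<in> A s}"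
    have S: "?S \<in> sets (PiM {..<n-1} (\<lambda>_. borel :: real measure))"
    proof (rule sets.sets_Collect_finite_All[OF _ T(1)])
      fix s assume "s \<in> T"
      have "(\<lambda>f. \<Sum>i<J s. f i) \<in> borel_measurable (PiM {..<n-1} (\<lambda>_. borel :: real measure))"
        using J[OF \<open>s \<in> T\<close>] by (intro borel_measurable_sum measurable_component_singleton) auto
      from measurable_sets[OF this, of "A s"] A
      show "{f \<in> space (PiM {..<n-1} (\<lambda>_. borel)). (\<Sum>i<J s. f i) \<in> A s} \<in> sets (PiM {..<n-1} (\<lambda>_. borel :: real measure))"
        by (simp add: vimage_def Int_def conj_commute)
    qed
    let ?S2 = "{f \<in> space (PiM {n-1} (\<lambda>_. borel :: real measure)). f (n-1) \<in> C}"
    have S2: "?S2 \<in> sets (PiM {n-1} (\<lambda>_. borel))"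
      using measurable_sets[OF measurable_component_singleton[of "n-1" "{n-1}" "\<lambda>_. borel"], of C] C
      by (simp add: vimage_def Int_def conj_commute)
    \<comment> \<open>\<open>E\<close> rewritten through increments. The two events differ by a null
      set, since \<open>b 0 = 0\<close> holds only almost surely.\<close>
    define E' where "E' = {\<omega>\<in>space M. \<forall>s\<in>T. (\<Sum>i<J s. \<Delta> i \<omega>) \<in> A s}"
    have restr: "(\<Sum>i<J s. restrict (\<lambda>i. \<Delta> i \<omega>) {..<n-1} i) = (\<Sum>i<J s. \<Delta> i \<omega>)" if "s \<in> T" for s \<omega>
      using J[OF that] by (intro sum.cong) auto
    have E'eq: "(\<lambda>\<omega>. restrict (\<lambda>i. \<Delta> i \<omega>) {..<n-1}) -` ?S \<inter> space M = E'"
      by (auto simp: E'_def restr space_PiM simp del: restrict_apply restrict_apply' One_nat_def)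
    have Deq: "(\<lambda>\<omega>. restrict (\<lambda>i. \<Delta> i \<omega>) {n-1}) -` ?S2 \<inter> space M = D"
      by (auto simp: D space_PiM last simp del: One_nat_def)
    have "(\<lambda>\<omega>. (restrict (\<lambda>i. \<Delta> i \<omega>) {..<n-1}, restrict (\<lambda>i. \<Delta> i \<omega>) {n-1})) -` (?S \<times> ?S2) \<inter> space M = E' \<inter> D"
      unfolding E'eq[symmetric] Deq[symmetric] by blast
    then have E'D: "prob (E' \<inter> D) = prob E' * prob D"
      using indep_varD[OF ind S S2] unfolding E'eq Deq by simp
    have E'ev: "E' \<in> events"
      unfolding E'eq[symmetric] by (rule measurable_sets[OF indep_var_rv1[OF ind] S])
    have Dev: "D \<in> events" unfolding D using C by measurable
    have Eev: "E \<in> events" unfolding E using Pev[OF T A] .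
    have ae: "AE \<omega> in M. \<omega> \<in> E \<longleftrightarrow> \<omega> \<in> E'"
      using b0
    proof (rule AE_mp, intro AE_I2 impI)
      fix \<omega> assume "b 0 \<omega> = 0" "\<omega> \<in> space M"
      then show "\<omega> \<in> E \<longleftrightarrow> \<omega> \<in> E'"
      proof -
        have "b s \<omega> = (\<Sum>i<J s. \<Delta> i \<omega>)" if "s \<in> T" for s
          using tel[of "J s" \<omega>] J[OF that] \<open>b 0 \<omega> = 0\<close> by simp
        then show ?thesis unfolding E E'_def by auto
      qed
    qed
    have "prob (E \<inter> D) = prob (E' \<inter> D)"
      using ae Eev E'ev Dev by (intro finite_measure_eq_AE) auto
    moreover have "prob E = prob E'"
      using ae Eev E'ev by (intro finite_measure_eq_AE) auto
    ultimately show "prob (E \<inter> D) = prob E * prob D"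
      using E'D by simp
  qed
  moreover have "Int_stable ?P"
  proof (rule Int_stableI)
    fix E1 E2 assume "E1 \<in> ?P" "E2 \<in> ?P"
    then obtain T1 A1 T2 A2 where T: "finite T1" "T1 \<subseteq> {0..r}" "finite T2" "T2 \<subseteq> {0..r}"
      and A: "\<forall>s. A1 s \<in> sets (borel::real measure)" "\<forall>s. A2 s \<in> sets (borel::real measure)"
      and E: "E1 = {\<omega>\<in>space M. \<forall>s\<in>T1. b s \<omega> \<in> A1 s}" "E2 = {\<omega>\<in>space M. \<forall>s\<in>T2. b s \<omega> \<in> A2 s}"
      by blast
    let ?A = "\<lambda>s. (if s \<in> T1 then A1 s else UNIV) \<inter> (if s \<in> T2 then A2 s else UNIV)"
    have "E1 \<inter> E2 = {\<omega>\<in>space M. \<forall>s\<in>T1 \<union> T2. b s \<omega> \<in> ?A s}"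
      unfolding E by auto
    moreover have "\<forall>s. ?A s \<in> sets borel" using A by auto
    ultimately show "E1 \<inter> E2 \<in> ?P" using T
      by (intro CollectI exI[of _ "T1 \<union> T2"] exI[of _ ?A]) auto
  qed
  moreover have "Int_stable ?D" by (rule Int_stable_vimage)
  ultimately have ind: "indep_set (sigma_sets (space M) ?P) (sigma_sets (space M) ?D)"
    by (rule indep_set_sigma_sets)
  have sub: "sigma_sets (space M) {b s -` A \<inter> space M | s A. 0 \<le> s \<and> s \<le> r \<and> A \<in> sets borel}
      \<subseteq> sigma_sets (space M) ?P"
  proof (rule sigma_sets_mono, safe)
    fix s A assume "0 \<le> s" "s \<le> r" "A \<in> sets (borel :: real measure)"
    then have "b s -` A \<inter> space M \<in> ?P"
      by (intro CollectI exI[of _ "{s}"] exI[of _ "\<lambda>_. A"]) auto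
    then show "b s -` A \<inter> space M \<in> sigma_sets (space M) ?P" by (rule sigma_sets.Basic)
  qed
  have D: "?D \<subseteq> sigma_sets (space M) ?D" by (auto intro: sigma_sets.Basic)
  show ?thesis
    using ind sub D unfolding indep_sets2_eq by (meson subset_iff)
qed

section \<open>The augmented past of a family of independent Brownian motions\<close>

locale bm_family = prob_space M for M :: "'w measure" +
  fixes B :: "'i \<Rightarrow> real \<Rightarrow> 'w \<Rightarrow> real"
  assumes indep_bm: "indep_brownian_motions M B"
begin

lemma bm: "brownian_motion M (B x)"
  using indep_bm by (simp add: indep_brownian_motions_def)

lemma B_measurable: "0 \<le> s \<Longrightarrow> B x s \<in> borel_measurable M"
  using bm[of x] by (simp add: brownian_motion_def)

text \<open>This is larger than the augmented past of the whole family: it also makes the increments of \<open>B x\<close>,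
  \<open>x \<noteq> y\<close>, measurable, so that one orthogonality lemma serves for one and for two Brownian motions.\<close>

definition past_except :: "'i \<Rightarrow> real \<Rightarrow> 'w measure" where
  "past_except y r = sigma (space M)
     ({B x s -` A \<inter> space M | x s A. 0 \<le> s \<and> (x \<noteq> y \<or> s \<le> r) \<and> A \<in> sets borel} \<union> null_sets M)"

lemma past_except_gen:
  "{B x s -` A \<inter> space M | x s A. 0 \<le> s \<and> (x \<noteq> y \<or> s \<le> r) \<and> A \<in> sets borel} \<union> null_sets M
     \<subseteq> Pow (space M)"
  using sets.sets_into_space by (fastforce simp: null_sets_def)

lemma space_past_except [simp]: "space (past_except y r) = space M"
  unfolding past_except_def using past_except_gen by (rule space_measure_of)

lemma sets_past_except:
  "sets (past_except y r) = sigma_sets (space M)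
     ({B x s -` A \<inter> space M | x s A. 0 \<le> s \<and> (x \<noteq> y \<or> s \<le> r) \<and> A \<in> sets borel} \<union> null_sets M)"
  unfolding past_except_def using past_except_gen by (rule sets_measure_of)

text \<open>Two independences are combined: the path of \<open>B y\<close> is independent of the
  other paths, and within that path the increment is independent of its own past. Intersections of
  an event of the other paths with an event of the past of \<open>B y\<close>, together with the
  null sets, form a generating pi-system.\<close>

lemma past_except_indep_increment:
  assumes rt: "0 \<le> r" "r \<le> t"
  shows "indep_set (sets (past_except y r))
    (sigma_sets (space M) {(\<lambda>\<omega>. B y t \<omega> - B y r \<omega>) -` A \<inter> space M | A. A \<in> sets borel})"
proof -
  let ?N = "\<lambda>_::'i. PiM {0..} (\<lambda>_. borel :: real measure)"
  let ?path = "\<lambda>x \<omega>. \<lambda>t\<in>{0..}. B x t \<omega>"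
  let ?X1 = "\<lambda>\<omega>. restrict (\<lambda>x. ?path x \<omega>) (- {y})" and ?X2 = "\<lambda>\<omega>. restrict (\<lambda>x. ?path x \<omega>) {y}"
  let ?D = "{(\<lambda>\<omega>. B y t \<omega> - B y r \<omega>) -` A \<inter> space M | A. A \<in> sets borel}"
  let ?P2 = "sigma_sets (space M) {B y s -` A \<inter> space M | s A. 0 \<le> s \<and> s \<le> r \<and> A \<in> sets borel}"
  have "indep_vars ?N ?path UNIV"
    using indep_bm by (simp add: indep_brownian_motions_def)
  then have ind: "indep_var (PiM (- {y}) ?N) ?X1 (PiM {y} ?N) ?X2"
    by (rule indep_var_restrict) auto
  note X1 = indep_var_rv1[OF ind] and X2 = indep_var_rv2[OF ind]
  let ?P1 = "{?X1 -` S \<inter> space M | S. S \<in> sets (PiM (- {y}) ?N)}"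
  \<comment> \<open>Events of the whole path of \<open>B y\<close>, its future included: a past
    event intersected with an event of the increment must still be independent of
    \<open>?P1\<close>.\<close>
  let ?Q2 = "{?X2 -` S \<inter> space M | S. S \<in> sets (PiM {y} ?N)}"
  have i12: "prob (E1 \<inter> E2) = prob E1 * prob E2" if E: "E1 \<in> ?P1" "E2 \<in> ?Q2" for E1 E2
  proof -
    from E obtain S1 S2 where S: "S1 \<in> sets (PiM (- {y}) ?N)" "S2 \<in> sets (PiM {y} ?N)"
      and eq: "E1 = ?X1 -` S1 \<inter> space M" "E2 = ?X2 -` S2 \<inter> space M" by blast
    have "(\<lambda>\<omega>. (?X1 \<omega>, ?X2 \<omega>)) -` (S1 \<times> S2) \<inter> space M = E1 \<inter> E2" unfolding eq by auto
    then show ?thesis using indep_varD[OF ind S] unfolding eq by simp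
  qed
  have Q2sig: "sigma_algebra (space M) ?Q2"
    using sets.sigma_algebra_axioms[of "vimage_algebra (space M) ?X2 (PiM {y} ?N)"] measurable_space[OF X2]
    by (subst (asm) sets_vimage_algebra2) auto
  have P1sig: "sigma_algebra (space M) ?P1"
    using sets.sigma_algebra_axioms[of "vimage_algebra (space M) ?X1 (PiM (- {y}) ?N)"] measurable_space[OF X1]
    by (subst (asm) sets_vimage_algebra2) auto
  have comp2: "(\<lambda>f. f y s) \<in> borel_measurable (PiM {y} ?N)" if "0 \<le> s" for s
    by (rule measurable_compose[OF measurable_component_singleton[of y "{y}" ?N]
          measurable_component_singleton]) (use that in auto)
  have Bs_in: "B y s -` A \<inter> space M \<in> ?Q2" if "0 \<le> s" "A \<in> sets borel" for s A
  proof -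
    have "B y s -` A \<inter> space M = ?X2 -` ((\<lambda>f. f y s) -` A \<inter> space (PiM {y} ?N)) \<inter> space M"
      using measurable_space[OF X2] that(1) by auto
    then show ?thesis using measurable_sets[OF comp2[OF that(1)] that(2)] by blast
  qed
  have P2_Q2: "?P2 \<subseteq> ?Q2"
    by (rule sigma_algebra.sigma_sets_subset[OF Q2sig]) (use Bs_in in auto)
  have D_Q2: "?D \<subseteq> ?Q2"
  proof safe
    fix A assume A: "A \<in> sets (borel :: real measure)"
    have m: "(\<lambda>f. f y t - f y r) \<in> borel_measurable (PiM {y} ?N)"
      by (intro borel_measurable_diff comp2) (use rt in linarith)+
    have "(\<lambda>\<omega>. B y t \<omega> - B y r \<omega>) -` A \<inter> space M =
        ?X2 -` ((\<lambda>f. f y t - f y r) -` A \<inter> space (PiM {y} ?N)) \<inter> space M"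
      using measurable_space[OF X2] rt by auto
    then show "\<exists>S. (\<lambda>\<omega>. B y t \<omega> - B y r \<omega>) -` A \<inter> space M = ?X2 -` S \<inter> space M \<and> S \<in> sets (PiM {y} ?N)"
      using measurable_sets[OF m A] by blast
  qed
  have P1ev: "?P1 \<subseteq> events" using measurable_sets[OF X1] by auto
  have Q2ev: "?Q2 \<subseteq> events" using measurable_sets[OF X2] by auto
  have i2: "prob (E2 \<inter> D) = prob E2 * prob D" if "E2 \<in> ?P2" "D \<in> ?D" for E2 D
    using that by (rule indep_setD[OF brownian_increment_indep_past[OF bm[of y] rt]])
  \<comment> \<open>Null sets are adjoined to the pi-system itself. Intersections with them are
    null, so stability and the product rule survive.\<close>
  let ?Q = "{E1 \<inter> E2 | E1 E2. E1 \<in> ?P1 \<and> E2 \<in> ?P2} \<union> null_sets M"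
  have Qev: "?Q \<subseteq> events"
  proof (rule subsetI)
    fix E assume "E \<in> ?Q"
    then consider E1 E2 where "E = E1 \<inter> E2" "E1 \<in> ?P1" "E2 \<in> ?P2" | "E \<in> null_sets M" by blast
    then show "E \<in> events"
    proof cases
      case 1
      have "E1 \<in> events" using 1(2) P1ev by (rule rev_subsetD)
      moreover have "E2 \<in> events" by (rule subsetD[OF Q2ev subsetD[OF P2_Q2 1(3)]])
      ultimately show ?thesis unfolding 1(1) by (rule sets.Int)
    qed (rule null_setsD2)
  qed
  have "indep_set ?Q ?D"
  proof (rule indep_setI)
    show "?Q \<subseteq> events" by (rule Qev)
    show "?D \<subseteq> events" using D_Q2 Q2ev by (rule subset_trans)
    fix E D assume "E \<in> ?Q" and D: "D \<in> ?D"
    then consider E1 E2 where "E = E1 \<inter> E2" "E1 \<in> ?P1" "E2 \<in> ?P2" | "E \<in> null_sets M" by blast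
    then show "prob (E \<inter> D) = prob E * prob D"
    proof cases
      case 1
      have ED: "E2 \<inter> D \<in> ?Q2"
        by (rule sigma_algebra_Int[OF Q2sig subsetD[OF P2_Q2 1(3)] subsetD[OF D_Q2 D]])
      have "prob (E \<inter> D) = prob (E1 \<inter> (E2 \<inter> D))" using 1 by (simp add: Int_assoc)
      also have "\<dots> = prob E1 * (prob E2 * prob D)" using i12[OF 1(2) ED] i2[OF 1(3) D] by simp
      also have "\<dots> = prob E * prob D" using i12[OF 1(2) subsetD[OF P2_Q2 1(3)]] 1 by simp
      finally show ?thesis .
    next
      case 2
      have "D \<in> events" by (rule subsetD[OF Q2ev subsetD[OF D_Q2 D]])
      then have "E \<inter> D \<in> null_sets M" by (rule null_set_Int2[OF 2])
      then show ?thesis using 2 by (simp add: null_sets_def measure_def)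
    qed
  qed
  moreover have "Int_stable ?Q"
  proof (rule Int_stableI)
    fix E F assume EF: "E \<in> ?Q" "F \<in> ?Q"
    then have ev: "E \<in> events" "F \<in> events" using Qev by blast+
    show "E \<inter> F \<in> ?Q"
    proof (cases "E \<in> null_sets M \<or> F \<in> null_sets M")
      case True
      then show ?thesis using ev by (auto intro: null_set_Int1 null_set_Int2)
    next
      case False
      then obtain E1 E2 F1 F2 where e: "E = E1 \<inter> E2" "E1 \<in> ?P1" "E2 \<in> ?P2"
        and f: "F = F1 \<inter> F2" "F1 \<in> ?P1" "F2 \<in> ?P2" using EF by blast
      have "E1 \<inter> F1 \<in> ?P1" using e f by (intro sigma_algebra_Int[OF P1sig])
      moreover have "E2 \<inter> F2 \<in> ?P2"
        using e(3) f(3) by (intro sigma_algebra_Int[OF sigma_algebra_sigma_sets]) blast+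
      moreover have "E \<inter> F = (E1 \<inter> F1) \<inter> (E2 \<inter> F2)" using e f by auto
      ultimately show ?thesis by blast
    qed
  qed
  moreover have "Int_stable ?D" by (rule Int_stable_vimage)
  ultimately have ind: "indep_set (sigma_sets (space M) ?Q) (sigma_sets (space M) ?D)"
    by (rule indep_set_sigma_sets)
  have top1: "space M \<in> ?P1" by (rule algebra.top[OF sigma_algebra.axioms(1)[OF P1sig]])
  have top2: "space M \<in> ?P2" by (rule sigma_sets_top)
  have sub: "sets (past_except y r) \<subseteq> sigma_sets (space M) ?Q"
    unfolding sets_past_except
  proof (rule sigma_sets_mono, rule subsetI)
    fix E assume "E \<in> {B x s -` A \<inter> space M | x s A. 0 \<le> s \<and> (x \<noteq> y \<or> s \<le> r) \<and> A \<in> sets borel} \<union> null_sets M"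
    then consider "E \<in> null_sets M" | x s A where "E = B x s -` A \<inter> space M" "0 \<le> s" "x \<noteq> y" "A \<in> sets borel"
      | s A where "E = B y s -` A \<inter> space M" "0 \<le> s" "s \<le> r" "A \<in> sets borel" by blast
    then have "E \<in> ?Q"
    proof cases
      case 1 then show ?thesis by blast
    next
      case (2 x s A)
      have m: "(\<lambda>f. f x s) \<in> borel_measurable (PiM (- {y}) ?N)"
        by (rule measurable_compose[OF measurable_component_singleton[of x "- {y}" ?N]
              measurable_component_singleton]) (use 2 in auto)
      have "E = ?X1 -` ((\<lambda>f. f x s) -` A \<inter> space (PiM (- {y}) ?N)) \<inter> space M"
        using measurable_space[OF X1] 2 by auto
      then have "E \<in> ?P1" using measurable_sets[OF m 2(4)] by blast
      moreover have "E = E \<inter> space M" using 2 by auto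
      ultimately show ?thesis using top2 by blast
    next
      case (3 s A)
      then have "E \<in> ?P2" by (auto intro!: sigma_sets.Basic)
      moreover have "E = space M \<inter> E" using 3 by auto
      ultimately show ?thesis using top1 by blast
    qed
    then show "E \<in> sigma_sets (space M) ?Q" by (rule sigma_sets.Basic)
  qed
  show ?thesis
    using ind sub unfolding indep_sets2_eq by (meson subset_iff)
qed

lemma sets_past_except_subset: "sets (past_except y r) \<subseteq> sets M"
  unfolding sets_past_except
proof (rule sets.sigma_sets_subset, rule subsetI)
  fix E assume "E \<in> {B x s -` A \<inter> space M | x s A. 0 \<le> s \<and> (x \<noteq> y \<or> s \<le> r) \<and> A \<in> sets borel} \<union> null_sets M"
  then consider "E \<in> null_sets M" | x s A where "E = B x s -` A \<inter> space M" "0 \<le> s" "A \<in> sets borel"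
    by blast
  then show "E \<in> sets M"
    by cases (auto intro: measurable_sets[OF B_measurable])
qed

lemma measurable_past_exceptD: "f \<in> measurable (past_except y r) N \<Longrightarrow> f \<in> measurable M N"
  using sets_past_except_subset[of y r] by (auto simp: measurable_def)

lemma B_measurable_past_except:
  assumes "0 \<le> s" "x \<noteq> y \<or> s \<le> r"
  shows "B x s \<in> borel_measurable (past_except y r)"
proof (rule measurableI)
  fix A assume "A \<in> sets (borel :: real measure)"
  then show "B x s -` A \<inter> space (past_except y r) \<in> sets (past_except y r)"
    unfolding sets_past_except using assms by (auto intro!: sigma_sets.Basic)
qed simp

lemma sets_bm_filtration_subset_past_except:
  assumes "s < r"
  shows "sets (bm_filtration M B s) \<subseteq> sets (past_except y r)"
proof -
  have "bm_raw_events M B r \<subseteq> sets (past_except y r)"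
    unfolding bm_raw_events_def sets_past_except by (rule sigma_sets_mono) (auto intro: sigma_sets.Basic)
  then show ?thesis using assms by (auto simp: sets_bm_filtration)
qed

lemma bm_filtration_measurable_past_except:
  "f \<in> measurable (bm_filtration M B s) N \<Longrightarrow> s < r \<Longrightarrow> f \<in> measurable (past_except y r) N"
  using sets_bm_filtration_subset_past_except[of s r y] by (auto simp: measurable_def)

lemma bm_filtration_measurableD: "f \<in> measurable (bm_filtration M B s) N \<Longrightarrow> f \<in> measurable M N"
  by (rule measurable_past_exceptD[OF bm_filtration_measurable_past_except[of f s N "s + 1"]]) auto

lemma bm_filtration_mono:
  "f \<in> measurable (bm_filtration M B s) N \<Longrightarrow> s \<le> t \<Longrightarrow> f \<in> measurable (bm_filtration M B t) N"
  using filtration.sets_F_mono[OF filtration_bm_filtration, of s t M B] by (auto simp: measurable_def)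

lemma indep_past_except_increment:
  fixes Z :: "'w \<Rightarrow> real"
  assumes rt: "0 \<le> r" "r \<le> t" and Z: "Z \<in> borel_measurable (past_except y r)"
  shows "indep_var borel Z borel (\<lambda>\<omega>. B y t \<omega> - B y r \<omega>)"
proof -
  have "sigma_sets (space M) {Z -` A \<inter> space M | A. A \<in> sets borel} \<subseteq> sets (past_except y r)"
    using measurable_sets[OF Z] sets.sigma_sets_subset[of "{Z -` A \<inter> space M | A. A \<in> sets borel}" "past_except y r"]
    by auto
  moreover have "(\<lambda>\<omega>. B y t \<omega> - B y r \<omega>) \<in> borel_measurable M"
    using rt by (intro borel_measurable_diff B_measurable) auto
  ultimately show ?thesis
    unfolding indep_var_eq using past_except_indep_increment[OF rt, of y] measurable_past_exceptD[OF Z]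
    unfolding indep_sets2_eq by (meson subset_iff)
qed

lemma increment_moments:
  assumes "0 \<le> s" "s \<le> t"
  shows sq_integrable_increment: "sq_integrable M (\<lambda>\<omega>. B x t \<omega> - B x s \<omega>)"
    and expectation_increment: "expectation (\<lambda>\<omega>. B x t \<omega> - B x s \<omega>) = 0"
    and expectation_increment_sq: "expectation (\<lambda>\<omega>. (B x t \<omega> - B x s \<omega>)\<^sup>2) = t - s"
proof -
  have m: "(\<lambda>\<omega>. B x t \<omega> - B x s \<omega>) \<in> borel_measurable M"
    using assms by (intro borel_measurable_diff B_measurable) auto
  have "sq_integrable M (\<lambda>\<omega>. B x t \<omega> - B x s \<omega>) \<and> expectation (\<lambda>\<omega>. B x t \<omega> - B x s \<omega>) = 0
    \<and> expectation (\<lambda>\<omega>. (B x t \<omega> - B x s \<omega>)\<^sup>2) = t - s"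
  proof (cases "s = t")
    case True
    then show ?thesis by (simp add: sq_integrable_def)
  next
    case False
    then have st: "s < t" using assms by simp
    then have D: "distributed M lborel (\<lambda>\<omega>. B x t \<omega> - B x s \<omega>) (normal_density 0 (sqrt (t - s)))"
      using bm[of x] assms by (simp add: brownian_motion_def)
    have pos: "0 < sqrt (t - s)" using st by simp
    have E: "expectation (\<lambda>\<omega>. B x t \<omega> - B x s \<omega>) = 0"
      by (rule normal_distributed_expectation[OF pos D])
    have V: "expectation (\<lambda>\<omega>. (B x t \<omega> - B x s \<omega>)\<^sup>2) = t - s"
      using normal_distributed_variance[OF pos D] E st by simp
    have "integrable M (\<lambda>\<omega>. (B x t \<omega> - B x s \<omega>)\<^sup>2)"
      using distributed_integrable[OF D, of "\<lambda>x. x\<^sup>2"] integrable_normal_moment[OF pos, of 0 2] by simp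
    then show ?thesis using E V m by (simp add: sq_integrable_def)
  qed
  then show "sq_integrable M (\<lambda>\<omega>. B x t \<omega> - B x s \<omega>)"
    "expectation (\<lambda>\<omega>. B x t \<omega> - B x s \<omega>) = 0"
    "expectation (\<lambda>\<omega>. (B x t \<omega> - B x s \<omega>)\<^sup>2) = t - s" by auto
qed

lemma L2_norm_increment:
  "0 \<le> s \<Longrightarrow> s \<le> t \<Longrightarrow> L2_norm M (\<lambda>\<omega>. B x t \<omega> - B x s \<omega>) = sqrt (t - s)"
  by (simp add: L2_norm_def expectation_increment_sq)

lemma sq_integrable_integrable: "sq_integrable M Z \<Longrightarrow> integrable M Z"
  using sq_integrable_mult[of M Z "\<lambda>_. 1"] by (simp add: sq_integrable_def)

text \<open>Since the augmented filtration is right-continuous, its \<open>\<sigma>\<close>-algebra at time \<open>s\<close> lies only in the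
  past up to every \<open>r > s\<close>; the increment over \<open>[s, r]\<close> is small in \<open>L\<^sup>2\<close> and \<open>r\<close> tends to \<open>s\<close>.\<close>

lemma increment_orthogonal:
  assumes st: "0 \<le> s" "s \<le> t" and Z: "sq_integrable M Z"
    and past: "\<And>r. s < r \<Longrightarrow> Z \<in> borel_measurable (past_except y r)"
  shows "expectation (\<lambda>\<omega>. Z \<omega> * (B y t \<omega> - B y s \<omega>)) = 0"
proof (cases "s = t")
  case False
  then have st': "s < t" using st by simp
  let ?c = "expectation (\<lambda>\<omega>. Z \<omega> * (B y t \<omega> - B y s \<omega>))"
  have le: "\<bar>?c\<bar> \<le> L2_norm M Z * sqrt e" if e: "0 < e" "e < t - s" for e
  proof -
    have r: "0 \<le> s + e" "s + e \<le> t" "s \<le> s + e" using e st by auto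
    note ind = indep_past_except_increment[OF r(1,2) past[of "s + e"]]
    have 0: "expectation (\<lambda>\<omega>. Z \<omega> * (B y t \<omega> - B y (s + e) \<omega>)) = 0"
      using indep_var_lebesgue_integral[OF ind] Z e
      by (simp add: sq_integrable_integrable sq_integrable_increment[OF r(1,2)] expectation_increment[OF r(1,2)])
    have "?c = expectation (\<lambda>\<omega>. Z \<omega> * (B y t \<omega> - B y (s + e) \<omega>) + Z \<omega> * (B y (s + e) \<omega> - B y s \<omega>))"
      by (simp add: algebra_simps)
    also have "\<dots> = expectation (\<lambda>\<omega>. Z \<omega> * (B y (s + e) \<omega> - B y s \<omega>))"
      using sq_integrable_mult[OF Z sq_integrable_increment[OF r(1,2)]]
        sq_integrable_mult[OF Z sq_integrable_increment[OF st(1) r(3)]] 0 by simp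
    finally show ?thesis
      using Cauchy_Schwarz_integral[OF Z sq_integrable_increment[OF st(1) r(3), of y]]
      by (simp add: L2_norm_increment[OF st(1) r(3)])
  qed
  have "((\<lambda>e. L2_norm M Z * sqrt e) \<longlongrightarrow> L2_norm M Z * sqrt 0) (at_right 0)"
    by (intro tendsto_intros)
  moreover have "\<forall>\<^sub>F e in at_right 0. \<bar>?c\<bar> \<le> L2_norm M Z * sqrt e"
    unfolding eventually_at_right_field using st' le by (intro exI[of _ "t - s"]) auto
  ultimately have "\<bar>?c\<bar> \<le> L2_norm M Z * sqrt 0"
    by (rule tendsto_lowerbound) simp
  then show ?thesis by simp
qed simp

lemma sq_integrable_bounded_mult:
  assumes "V \<in> borel_measurable M" "\<And>\<omega>. \<omega> \<in> space M \<Longrightarrow> \<bar>V \<omega>\<bar> \<le> C" "sq_integrable M Z"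
  shows "sq_integrable M (\<lambda>\<omega>. V \<omega> * Z \<omega>)"
proof (rule sq_integrable_bound[OF _ sq_integrable_cmult[OF assms(3), of C]])
  fix \<omega> assume "\<omega> \<in> space M"
  then show "\<bar>V \<omega> * Z \<omega>\<bar> \<le> \<bar>C * Z \<omega>\<bar>"
    using assms(2)[of \<omega>] by (auto simp: abs_mult intro!: mult_right_mono)
qed (use assms in \<open>auto simp: sq_integrable_def\<close>)

text \<open>Here too \<open>V\<close> belongs to the past only after \<open>s\<close>. Splitting the
  increment at \<open>r = s + e\<close> isolates a part independent of \<open>V\<close>; the mixed
  term vanishes and the remainder is of order \<open>e\<close>.\<close>

lemma increment_square:
  assumes st: "0 \<le> s" "s \<le> t" and V: "V \<in> borel_measurable (bm_filtration M B s)"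
    and C: "\<And>\<omega>. \<omega> \<in> space M \<Longrightarrow> \<bar>V \<omega>\<bar> \<le> C"
  shows "expectation (\<lambda>\<omega>. V \<omega> * (B y t \<omega> - B y s \<omega>)\<^sup>2) = (t - s) * expectation V"
proof (cases "s = t")
  case False
  then have st': "s < t" using st by simp
  have Vm: "V \<in> borel_measurable M" using V by (rule bm_filtration_measurableD)
  have Vi: "integrable M V" using C by (intro integrable_const_bound[OF _ Vm, of C]) auto
  have bi: "integrable M (\<lambda>\<omega>. V \<omega> * (X \<omega> * Y \<omega>))" if "sq_integrable M X" "sq_integrable M Y" for X Y
    using sq_integrable_mult[OF sq_integrable_bounded_mult[OF Vm C that(1)] that(2)]
    by (simp add: mult.assoc)
  let ?c = "expectation (\<lambda>\<omega>. V \<omega> * (B y t \<omega> - B y s \<omega>)\<^sup>2)"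
  \<comment> \<open>One \<open>C * e\<close> bounds the square of the early increment, the other the
    change from \<open>t - r\<close> to \<open>t - s\<close>.\<close>
  have le: "\<bar>?c - (t - s) * expectation V\<bar> \<le> 2 * C * e" if e: "0 < e" "e < t - s" for e
  proof -
    define r where "r = s + e"
    have r: "0 \<le> r" "r \<le> t" "s \<le> r" "s < r" using e st by (auto simp: r_def)
    let ?X = "\<lambda>\<omega>. B y t \<omega> - B y r \<omega>" and ?Y = "\<lambda>\<omega>. B y r \<omega> - B y s \<omega>"
    have X: "sq_integrable M ?X" and Y: "sq_integrable M ?Y"
      using r st by (auto intro: sq_integrable_increment)
    have Vr: "V \<in> borel_measurable (past_except y r')" if "r \<le> r'" for r'
      by (rule bm_filtration_measurable_past_except[OF V]) (use r that in auto)
    have "indep_var borel (id \<circ> V) borel ((\<lambda>x. x\<^sup>2) \<circ> ?X)"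
      by (rule indep_var_compose[OF indep_past_except_increment[OF r(1,2) Vr]]) auto
    then have iv: "indep_var borel V borel (\<lambda>\<omega>. (?X \<omega>)\<^sup>2)" by (simp add: comp_def)
    have 1: "expectation (\<lambda>\<omega>. V \<omega> * (?X \<omega>)\<^sup>2) = (t - r) * expectation V"
      using indep_var_lebesgue_integral[OF iv Vi sq_integrable_square[OF X]]
      by (simp add: expectation_increment_sq[OF r(1,2)])
    have 2: "expectation (\<lambda>\<omega>. (V \<omega> * ?Y \<omega>) * ?X \<omega>) = 0"
    proof (rule increment_orthogonal[OF r(1,2) sq_integrable_bounded_mult[OF Vm C Y]])
      fix r' assume "r < r'"
      then show "(\<lambda>\<omega>. V \<omega> * ?Y \<omega>) \<in> borel_measurable (past_except y r')"
        using r st by (intro borel_measurable_times borel_measurable_diff B_measurable_past_except Vr) auto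
    qed
    have 3: "\<bar>expectation (\<lambda>\<omega>. V \<omega> * (?Y \<omega>)\<^sup>2)\<bar> \<le> C * e"
    proof -
      have "\<bar>expectation (\<lambda>\<omega>. V \<omega> * (?Y \<omega>)\<^sup>2)\<bar> \<le> expectation (\<lambda>\<omega>. \<bar>V \<omega> * (?Y \<omega>)\<^sup>2\<bar>)"
        by (rule integral_abs_bound)
      also have "\<dots> \<le> expectation (\<lambda>\<omega>. C * (?Y \<omega>)\<^sup>2)"
      proof (rule integral_mono)
        show "integrable M (\<lambda>\<omega>. \<bar>V \<omega> * (?Y \<omega>)\<^sup>2\<bar>)"
          using integrable_abs[OF bi[OF Y Y]] by (simp only: power2_eq_square)
      qed (use sq_integrable_square[OF Y] C in \<open>auto simp: abs_mult intro!: mult_right_mono\<close>)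
      also have "\<dots> = C * e" using expectation_increment_sq[OF st(1) r(3), of y] by (simp add: r_def)
      finally show ?thesis .
    qed
    have "?c = expectation (\<lambda>\<omega>. V \<omega> * (?X \<omega> * ?X \<omega>) + 2 * (V \<omega> * (?Y \<omega> * ?X \<omega>)) + V \<omega> * (?Y \<omega> * ?Y \<omega>))"
      by (rule Bochner_Integration.integral_cong) (auto simp: power2_eq_square algebra_simps)
    also have "\<dots> = expectation (\<lambda>\<omega>. V \<omega> * (?X \<omega> * ?X \<omega>)) + 2 * expectation (\<lambda>\<omega>. V \<omega> * (?Y \<omega> * ?X \<omega>))
        + expectation (\<lambda>\<omega>. V \<omega> * (?Y \<omega> * ?Y \<omega>))"
      using bi[OF X X] bi[OF Y X] bi[OF Y Y] by simp
    finally have "?c = (t - r) * expectation V + expectation (\<lambda>\<omega>. V \<omega> * (?Y \<omega>)\<^sup>2)"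
      using 1 2 by (simp add: power2_eq_square mult.assoc)
    moreover have "\<bar>expectation V\<bar> \<le> C"
    proof -
      have "\<bar>expectation V\<bar> \<le> expectation (\<lambda>\<omega>. \<bar>V \<omega>\<bar>)" by (rule integral_abs_bound)
      also have "\<dots> \<le> expectation (\<lambda>\<omega>. C)" using Vi C by (intro integral_mono) auto
      finally show ?thesis by (simp add: prob_space)
    qed
    then have "\<bar>e * expectation V\<bar> \<le> C * e" using e by (simp add: abs_mult)
    moreover have "(t - s) * expectation V = (t - r) * expectation V + e * expectation V"
      by (simp add: r_def algebra_simps)
    ultimately show ?thesis using 3 by linarith
  qed
  have "((\<lambda>e. 2 * C * e) \<longlongrightarrow> 2 * C * 0) (at_right 0)"
    by (intro tendsto_intros)
  moreover have "\<forall>\<^sub>F e in at_right 0. \<bar>?c - (t - s) * expectation V\<bar> \<le> 2 * C * e"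
    unfolding eventually_at_right_field using st' le by (intro exI[of _ "t - s"]) auto
  ultimately have "\<bar>?c - (t - s) * expectation V\<bar> \<le> 2 * C * 0"
    by (rule tendsto_lowerbound) simp
  then show ?thesis by simp
qed simp

end

section \<open>Integration against a countable family of Brownian motions\<close>

lemma integrable_product_functions:
  fixes f :: "'a \<Rightarrow> real" and g :: "'b \<Rightarrow> real"
  assumes sf: "sigma_finite_measure N1" "sigma_finite_measure N2"
    and f: "integrable N1 f" and g: "integrable N2 g"
  shows "integrable (N1 \<Otimes>\<^sub>M N2) (\<lambda>p. f (fst p) * g (snd p))"
    and "(\<integral>p. f (fst p) * g (snd p) \<partial>(N1 \<Otimes>\<^sub>M N2)) = (\<integral>x. f x \<partial>N1) * (\<integral>y. g y \<partial>N2)"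
proof -
  interpret N1: sigma_finite_measure N1 by fact
  interpret N2: sigma_finite_measure N2 by fact
  interpret pair_sigma_finite N1 N2 ..
  have [measurable]: "f \<in> borel_measurable N1" "g \<in> borel_measurable N2" using f g by auto
  have m: "(\<lambda>p. f (fst p) * g (snd p)) \<in> borel_measurable (N1 \<Otimes>\<^sub>M N2)" by measurable
  show *: "integrable (N1 \<Otimes>\<^sub>M N2) (\<lambda>p. f (fst p) * g (snd p))"
  proof (rule Fubini_integrable[OF m])
    show "integrable N1 (\<lambda>x. \<integral>y. norm (f (fst (x, y)) * g (snd (x, y))) \<partial>N2)"
      using f by (simp add: abs_mult)
    show "AE x in N1. integrable N2 (\<lambda>y. f (fst (x, y)) * g (snd (x, y)))"
      using g by simp
  qed
  show "(\<integral>p. f (fst p) * g (snd p) \<partial>(N1 \<Otimes>\<^sub>M N2)) = (\<integral>x. f x \<partial>N1) * (\<integral>y. g y \<partial>N2)"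
    using integral_fst'[OF *] by simp
qed

lemma finite_to_nat_lessThan: "finite {x::'i::countable. to_nat x < n}"
  using finite_imageD[of to_nat "{x::'i. to_nat x < n}"]
  by (auto intro: finite_subset[of _ "{..<n}"] inj_onI)

text \<open>Initial segments of the enumeration are cofinal among the finite sets, so an
  unconditional sum is also a limit of a sequence, to which dominated and monotone convergence
  apply.\<close>

lemma filterlim_to_nat_lessThan:
  "filterlim (\<lambda>n. {x::'i::countable. to_nat x < n}) (finite_subsets_at_top UNIV) sequentially"
proof (rule filterlim_finite_subsets_at_top[THEN iffD2], intro allI impI, safe)
  fix X :: "'i set" assume "finite X"
  have "\<forall>x\<in>X. \<forall>\<^sub>F n in sequentially. to_nat x < n" by (simp add: eventually_gt_at_top)
  then have "\<forall>\<^sub>F n in sequentially. \<forall>x\<in>X. to_nat x < n"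
    using \<open>finite X\<close> by (simp add: eventually_ball_finite)
  then show "\<forall>\<^sub>F n in sequentially. finite {x::'i. to_nat x < n} \<and> X \<subseteq> {x. to_nat x < n} \<and> {x. to_nat x < n} \<subseteq> UNIV"
    by eventually_elim (auto simp: finite_to_nat_lessThan)
qed

section \<open>The space of integrands and its elementary members\<close>

locale bm_system = bm_family M B
  for M :: "'w measure" and B :: "'i::countable \<Rightarrow> real \<Rightarrow> 'w \<Rightarrow> real"
begin

abbreviation "F \<equiv> bm_filtration M B"

text \<open>The squared \<open>L2_norm\<close> over \<open>K\<close> is the sum over sites of the
  expected time integral of the square. Counting measure in the first coordinate reflects that
  different motions contribute orthogonally.\<close>

definition K :: "('i \<times> real \<times> 'w) measure" where
  "K = count_space UNIV \<Otimes>\<^sub>M (lborel \<Otimes>\<^sub>M M)"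

lemma sets_K [measurable_cong]: "sets K = sets (count_space UNIV \<Otimes>\<^sub>M (lborel \<Otimes>\<^sub>M M))"
  by (simp add: K_def)

lemma sigma_finite_lborel_M: "sigma_finite_measure (lborel \<Otimes>\<^sub>M M)"
  by (intro sigma_finite_pair_measure lborel.sigma_finite_measure_axioms sigma_finite_measure_axioms)

lemma sigma_finite_count: "sigma_finite_measure (count_space (UNIV :: 'i set))"
  by (rule sigma_finite_measure_count_space_countable) simp

lemma nn_integral_K:
  assumes [measurable]: "f \<in> borel_measurable K"
  shows "(\<integral>\<^sup>+p. f p \<partial>K) = (\<integral>\<^sup>+y. \<integral>\<^sup>+r. \<integral>\<^sup>+\<omega>. f (y, r, \<omega>) \<partial>M \<partial>lborel \<partial>count_space UNIV)"
proof -
  interpret LM: sigma_finite_measure "lborel \<Otimes>\<^sub>M M :: (real \<times> 'w) measure" by (rule sigma_finite_lborel_M)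
  have "(\<integral>\<^sup>+p. f p \<partial>K) = (\<integral>\<^sup>+y. \<integral>\<^sup>+q. f (y, q) \<partial>(lborel \<Otimes>\<^sub>M M) \<partial>count_space UNIV)"
    unfolding K_def using assms by (intro LM.nn_integral_fst[symmetric]) (simp add: K_def)
  also have "\<dots> = (\<integral>\<^sup>+y. \<integral>\<^sup>+r. \<integral>\<^sup>+\<omega>. f (y, r, \<omega>) \<partial>M \<partial>lborel \<partial>count_space UNIV)"
  proof (rule nn_integral_cong)
    fix y :: 'i
    have "(\<lambda>q. f (y, q)) \<in> borel_measurable (lborel \<Otimes>\<^sub>M M)"
      by (rule measurable_compose[OF _ assms]) measurable
    then show "(\<integral>\<^sup>+q. f (y, q) \<partial>(lborel \<Otimes>\<^sub>M M)) = (\<integral>\<^sup>+r. \<integral>\<^sup>+\<omega>. f (y, r, \<omega>) \<partial>M \<partial>lborel)"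
      by (rule nn_integral_fst[symmetric])
  qed
  finally show ?thesis .
qed

lemma measurable_K:
  assumes "\<And>y. (\<lambda>(r, \<omega>). f (y, r, \<omega>)) \<in> measurable (lborel \<Otimes>\<^sub>M M) N"
  shows "f \<in> measurable K N"
proof -
  have "(\<lambda>q. f (y, q)) \<in> measurable (lborel \<Otimes>\<^sub>M M) N" for y
    using assms[of y] by (simp add: case_prod_beta')
  then have "(\<lambda>p. f (fst p, snd p)) \<in> measurable K N"
    unfolding K_def by (intro measurable_pair_measure_countable1) auto
  then show ?thesis by simp
qed

text \<open>The quadruple \<open>(x, a, b, \<xi>)\<close> stands for the integrand \<open>\<xi>\<close> on \<open>(a, b]\<close> against \<open>B x\<close>. The time intervals
  of the quadruples in a list may overlap, so that addition is concatenation and partitions need no common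
  refinement.\<close>

definition elem_valid :: "('i \<times> real \<times> real \<times> ('w \<Rightarrow> real)) \<Rightarrow> bool" where
  "elem_valid = (\<lambda>(x, a, b, \<xi>). 0 \<le> a \<and> a \<le> b \<and> \<xi> \<in> borel_measurable (F a) \<and>
     (\<exists>C. \<forall>\<omega>\<in>space M. \<bar>\<xi> \<omega>\<bar> \<le> C))"

definition elem_fun :: "('i \<times> real \<times> real \<times> ('w \<Rightarrow> real)) \<Rightarrow> 'i \<times> real \<times> 'w \<Rightarrow> real" where
  "elem_fun = (\<lambda>(x, a, b, \<xi>) (y, r, \<omega>). indicator {x} y * (indicator {a<..b} r * \<xi> \<omega>))"

definition elem_int :: "('i \<times> real \<times> real \<times> ('w \<Rightarrow> real)) \<Rightarrow> 'w \<Rightarrow> real" where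
  "elem_int = (\<lambda>(x, a, b, \<xi>) \<omega>. \<xi> \<omega> * (B x b \<omega> - B x a \<omega>))"

definition step_fun where "step_fun L p = (\<Sum>e\<leftarrow>L. elem_fun e p)"
definition step_int where "step_int L \<omega> = (\<Sum>e\<leftarrow>L. elem_int e \<omega>)"

section \<open>The isometry for elementary integrands\<close>

text \<open>The first integral is cut at the later left endpoint \<open>c\<close>. What it collects
  before \<open>c\<close> belongs to the past of the second increment and is orthogonal to it; after
  \<open>c\<close> only the overlap of two increments of the same motion survives. The factor with
  \<open>max\<close> and \<open>min\<close> is the length of that overlap.\<close>

lemma elem_inner_ordered:
  assumes xi: "elem_valid (x, a, b, \<xi>)" and eta: "elem_valid (y, c, d, \<eta>)" and "a \<le> c"
  shows "expectation (\<lambda>\<omega>. (\<xi> \<omega> * (B x b \<omega> - B x a \<omega>)) * (\<eta> \<omega> * (B y d \<omega> - B y c \<omega>))) =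
    (if x = y then max 0 (min b d - max a c) * expectation (\<lambda>\<omega>. \<xi> \<omega> * \<eta> \<omega>) else 0)"
proof -
  have o: "0 \<le> a" "a \<le> b" "0 \<le> c" "c \<le> d" and f: "\<xi> \<in> borel_measurable (F a)" "\<eta> \<in> borel_measurable (F c)"
    using xi eta by (auto simp: elem_valid_def)
  from xi eta obtain C D where C: "\<And>\<omega>. \<omega> \<in> space M \<Longrightarrow> \<bar>\<xi> \<omega>\<bar> \<le> C" and D: "\<And>\<omega>. \<omega> \<in> space M \<Longrightarrow> \<bar>\<eta> \<omega>\<bar> \<le> D"
    by (auto simp: elem_valid_def)
  have m: "\<xi> \<in> borel_measurable M" "\<eta> \<in> borel_measurable M" using f by (auto intro: bm_filtration_measurableD)
  have fc: "\<xi> \<in> borel_measurable (F c)" using bm_filtration_mono[OF f(1) \<open>a \<le> c\<close>] .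
  have fpast: "\<xi> \<in> borel_measurable (past_except z r)" "\<eta> \<in> borel_measurable (past_except z r)" if "c < r" for r z
    using bm_filtration_measurable_past_except fc f(2) that by blast+
  let ?V = "\<lambda>\<omega>. \<xi> \<omega> * \<eta> \<omega>"
  have Vb: "\<bar>?V \<omega>\<bar> \<le> C * D" if "\<omega> \<in> space M" for \<omega>
    using C[OF that] D[OF that] by (auto simp: abs_mult intro!: mult_mono order_trans[OF abs_ge_zero C[OF that]])
  have Vm: "?V \<in> borel_measurable M" using m by auto
  have VF: "?V \<in> borel_measurable (F c)" using fc f(2) by auto
  have sq: "sq_integrable M (\<lambda>\<omega>. ?V \<omega> * (B z s \<omega> - B z r \<omega>))" if "0 \<le> r" "r \<le> s" for z r s
    by (rule sq_integrable_bounded_mult[OF Vm Vb sq_integrable_increment[OF that]])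
  \<comment> \<open>A first increment that ends before the second begins; used with
    \<open>b' = b\<close> for disjoint intervals and with \<open>b' = c\<close> for the piece cut
    off.\<close>
  have early: "expectation (\<lambda>\<omega>. (?V \<omega> * (B x b' \<omega> - B x a \<omega>)) * (B y d \<omega> - B y c \<omega>)) = 0"
    if "a \<le> b'" "b' \<le> c" for b'
  proof (rule increment_orthogonal[OF o(3,4) sq[OF o(1) that(1)]])
    fix r assume "c < r"
    then show "(\<lambda>\<omega>. ?V \<omega> * (B x b' \<omega> - B x a \<omega>)) \<in> borel_measurable (past_except y r)"
      using that o by (intro borel_measurable_times borel_measurable_diff B_measurable_past_except fpast) auto
  qed
  have rearr: "(\<lambda>\<omega>. (\<xi> \<omega> * (B x b \<omega> - B x a \<omega>)) * (\<eta> \<omega> * (B y d \<omega> - B y c \<omega>))) =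
      (\<lambda>\<omega>. (?V \<omega> * (B x b \<omega> - B x a \<omega>)) * (B y d \<omega> - B y c \<omega>))"
    by (auto simp: algebra_simps)
  show ?thesis
  proof (cases "b \<le> c")
    case True
    then show ?thesis unfolding rearr using early[OF o(2)] by (simp add: max_def min_def)
  next
    case False
    then have cb: "c \<le> b" by simp
    have "expectation (\<lambda>\<omega>. (?V \<omega> * (B x b \<omega> - B x a \<omega>)) * (B y d \<omega> - B y c \<omega>)) =
        expectation (\<lambda>\<omega>. (?V \<omega> * (B x c \<omega> - B x a \<omega>)) * (B y d \<omega> - B y c \<omega>)
          + (?V \<omega> * (B x b \<omega> - B x c \<omega>)) * (B y d \<omega> - B y c \<omega>))"
      by (simp add: algebra_simps)
    also have "\<dots> = expectation (\<lambda>\<omega>. (?V \<omega> * (B x c \<omega> - B x a \<omega>)) * (B y d \<omega> - B y c \<omega>))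
          + expectation (\<lambda>\<omega>. (?V \<omega> * (B x b \<omega> - B x c \<omega>)) * (B y d \<omega> - B y c \<omega>))"
      using sq_integrable_mult[OF sq[OF o(1) \<open>a \<le> c\<close>, of x] sq_integrable_increment[OF o(3,4), of y]]
        sq_integrable_mult[OF sq[OF o(3) cb, of x] sq_integrable_increment[OF o(3,4), of y]]
      by (rule Bochner_Integration.integral_add)
    finally have eq: "expectation (\<lambda>\<omega>. (?V \<omega> * (B x b \<omega> - B x a \<omega>)) * (B y d \<omega> - B y c \<omega>)) =
        expectation (\<lambda>\<omega>. (?V \<omega> * (B x b \<omega> - B x c \<omega>)) * (B y d \<omega> - B y c \<omega>))"
      using early[OF \<open>a \<le> c\<close> order_refl] by simp
    show ?thesis
    proof (cases "x = y")
      case False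
      have "expectation (\<lambda>\<omega>. (?V \<omega> * (B x b \<omega> - B x c \<omega>)) * (B y d \<omega> - B y c \<omega>)) = 0"
      proof (rule increment_orthogonal[OF o(3,4) sq[OF o(3) cb]])
        fix r assume "c < r"
        then show "(\<lambda>\<omega>. ?V \<omega> * (B x b \<omega> - B x c \<omega>)) \<in> borel_measurable (past_except y r)"
          using cb o False by (intro borel_measurable_times borel_measurable_diff B_measurable_past_except fpast) auto
      qed
      then show ?thesis unfolding rearr using eq False by simp
    next
      case True
      let ?l = "min b d" and ?u = "max b d"
      have l: "c \<le> ?l" "0 \<le> ?l" "?l \<le> ?u" using cb o by auto
      \<comment> \<open>\<open>?X\<close> is the increment over the overlap, \<open>?Y\<close> the
        excess of the longer interval, which comes later and is orthogonal to
        \<open>?V * ?X\<close>.\<close>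
      let ?X = "\<lambda>\<omega>. B y ?l \<omega> - B y c \<omega>" and ?Y = "\<lambda>\<omega>. B y ?u \<omega> - B y ?l \<omega>"
      have "(\<lambda>\<omega>. (?V \<omega> * (B y b \<omega> - B y c \<omega>)) * (B y d \<omega> - B y c \<omega>)) =
         (\<lambda>\<omega>. ?V \<omega> * (?X \<omega>)\<^sup>2 + (?V \<omega> * ?X \<omega>) * ?Y \<omega>)"
        by (cases "b \<le> d") (auto simp: min_def max_def power2_eq_square algebra_simps)
      moreover have "expectation (\<lambda>\<omega>. (?V \<omega> * ?X \<omega>) * ?Y \<omega>) = 0"
      proof (rule increment_orthogonal[OF l(2,3) sq[OF o(3) l(1)]])
        fix r assume "?l < r"
        then show "(\<lambda>\<omega>. ?V \<omega> * ?X \<omega>) \<in> borel_measurable (past_except y r)"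
          using l o by (intro borel_measurable_times borel_measurable_diff B_measurable_past_except fpast) auto
      qed
      moreover have "expectation (\<lambda>\<omega>. ?V \<omega> * (?X \<omega>)\<^sup>2) = (?l - c) * expectation ?V"
        by (rule increment_square[OF o(3) l(1) VF Vb])
      moreover have "integrable M (\<lambda>\<omega>. ?V \<omega> * (?X \<omega>)\<^sup>2)"
        using sq_integrable_mult[OF sq[OF o(3) l(1)] sq_integrable_increment[OF o(3) l(1)], of y y]
        by (simp add: power2_eq_square mult.assoc)
      moreover note sq_integrable_mult[OF sq[OF o(3) l(1)] sq_integrable_increment[OF l(2,3)], of y y]
      ultimately have "expectation (\<lambda>\<omega>. (?V \<omega> * (B y b \<omega> - B y c \<omega>)) * (B y d \<omega> - B y c \<omega>)) = (?l - c) * expectation ?V"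
        by simp
      then show ?thesis unfolding rearr using eq True l \<open>a \<le> c\<close> by (simp add: max_absorb2)
    qed
  qed
qed

lemma elem_inner_int:
  assumes "elem_valid (x, a, b, \<xi>)" "elem_valid (y, c, d, \<eta>)"
  shows "expectation (\<lambda>\<omega>. elem_int (x, a, b, \<xi>) \<omega> * elem_int (y, c, d, \<eta>) \<omega>) =
    (if x = y then max 0 (min b d - max a c) * expectation (\<lambda>\<omega>. \<xi> \<omega> * \<eta> \<omega>) else 0)"
proof (cases "a \<le> c")
  case True
  then show ?thesis using elem_inner_ordered[OF assms] by (simp add: elem_int_def)
next
  case False
  then have "c \<le> a" by simp
  from elem_inner_ordered[OF assms(2,1) this] show ?thesis
    by (cases "x = y") (simp_all add: elem_int_def mult.commute min.commute max.commute)
qed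

text \<open>An elementary integrand is a product of functions of the site, the time and the sample
  point, so Fubini produces the same value as the computation for the integrals.\<close>

lemma elem_inner_fun:
  assumes "elem_valid (x, a, b, \<xi>)" "elem_valid (y, c, d, \<eta>)"
  shows "integrable K (\<lambda>p. elem_fun (x, a, b, \<xi>) p * elem_fun (y, c, d, \<eta>) p)"
    and "(\<integral>p. elem_fun (x, a, b, \<xi>) p * elem_fun (y, c, d, \<eta>) p \<partial>K) =
    (if x = y then max 0 (min b d - max a c) * expectation (\<lambda>\<omega>. \<xi> \<omega> * \<eta> \<omega>) else 0)"
proof -
  from assms obtain C D where C: "\<And>\<omega>. \<omega> \<in> space M \<Longrightarrow> \<bar>\<xi> \<omega>\<bar> \<le> C" and D: "\<And>\<omega>. \<omega> \<in> space M \<Longrightarrow> \<bar>\<eta> \<omega>\<bar> \<le> D"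
    by (auto simp: elem_valid_def)
  have m: "\<xi> \<in> borel_measurable M" "\<eta> \<in> borel_measurable M"
    using assms by (auto simp: elem_valid_def intro: bm_filtration_measurableD)
  have i3: "integrable M (\<lambda>\<omega>. \<xi> \<omega> * \<eta> \<omega>)"
    using C D m by (intro integrable_const_bound[of _ "C * D"])
      (auto simp: abs_mult intro!: AE_I2 mult_mono order_trans[OF abs_ge_zero C])
  let ?h2 = "\<lambda>r. indicator {a<..b} r * indicator {c<..d} r :: real"
  have h2: "?h2 = indicator {max a c<..min b d}" by (auto simp: indicator_def fun_eq_iff)
  have i2: "integrable lborel ?h2" unfolding h2 by (cases "max a c \<le> min b d") auto
  have e2: "(\<integral>r. ?h2 r \<partial>lborel) = max 0 (min b d - max a c)"
    unfolding h2 by (cases "max a c \<le> min b d") (auto simp: measure_def)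
  let ?h1 = "\<lambda>z. indicator {x} z * indicator {y} z :: real"
  have h1: "?h1 = indicator ({x} \<inter> {y})" by (auto simp: indicator_def fun_eq_iff)
  have i1: "integrable (count_space UNIV) ?h1" unfolding h1 by (subst integrable_indicator_iff) (auto simp: of_nat_less_top)
  have e1: "(\<integral>z. ?h1 z \<partial>count_space UNIV) = (if x = y then 1 else 0)"
    unfolding h1 by (auto simp: measure_def)
  have eq: "(\<lambda>p. elem_fun (x, a, b, \<xi>) p * elem_fun (y, c, d, \<eta>) p) =
     (\<lambda>p. ?h1 (fst p) * (\<lambda>q. ?h2 (fst q) * (\<xi> (snd q) * \<eta> (snd q))) (snd p))"
    by (auto simp: elem_fun_def fun_eq_iff)
  note p2 = integrable_product_functions[OF lborel.sigma_finite_measure_axioms sigma_finite_measure_axioms i2 i3]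
  note p1 = integrable_product_functions[OF sigma_finite_count sigma_finite_lborel_M i1 p2(1)]
  show "integrable K (\<lambda>p. elem_fun (x, a, b, \<xi>) p * elem_fun (y, c, d, \<eta>) p)"
    unfolding eq K_def by (rule p1(1))
  show "(\<integral>p. elem_fun (x, a, b, \<xi>) p * elem_fun (y, c, d, \<eta>) p \<partial>K) =
    (if x = y then max 0 (min b d - max a c) * expectation (\<lambda>\<omega>. \<xi> \<omega> * \<eta> \<omega>) else 0)"
    unfolding eq K_def p1(2) p2(2) e1 e2 by simp
qed

lemma elem_inner:
  assumes "elem_valid e" "elem_valid e'"
  shows "expectation (\<lambda>\<omega>. elem_int e \<omega> * elem_int e' \<omega>) = (\<integral>p. elem_fun e p * elem_fun e' p \<partial>K)"
proof -
  obtain x a b \<xi> y c d \<eta> where "e = (x, a, b, \<xi>)" "e' = (y, c, d, \<eta>)" by (metis prod_cases4)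
  then show ?thesis using elem_inner_int elem_inner_fun(2) assms by simp
qed

lemma sq_integrable_elem_fun:
  assumes "elem_valid e"
  shows "sq_integrable K (elem_fun e)"
proof -
  obtain x a b \<xi> where e: "e = (x, a, b, \<xi>)" by (metis prod_cases4)
  have [measurable]: "\<xi> \<in> borel_measurable M"
    using assms e by (auto simp: elem_valid_def intro: bm_filtration_measurableD)
  have "elem_fun e \<in> borel_measurable K"
    unfolding e elem_fun_def by (rule measurable_K) simp
  then show ?thesis
    using elem_inner_fun(1)[OF assms[unfolded e] assms[unfolded e]]
    by (simp add: sq_integrable_def e power2_eq_square)
qed

lemma sq_integrable_elem_int:
  assumes "elem_valid e"
  shows "sq_integrable M (elem_int e)"
proof -
  obtain x a b \<xi> where e: "e = (x, a, b, \<xi>)" by (metis prod_cases4)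
  from assms obtain C where C: "\<And>\<omega>. \<omega> \<in> space M \<Longrightarrow> \<bar>\<xi> \<omega>\<bar> \<le> C" and ab: "0 \<le> a" "a \<le> b"
    by (auto simp: elem_valid_def e)
  have m: "\<xi> \<in> borel_measurable M"
    using assms e by (auto simp: elem_valid_def intro: bm_filtration_measurableD)
  show ?thesis unfolding e elem_int_def
    using sq_integrable_bounded_mult[OF m C sq_integrable_increment[OF ab]] by simp
qed

lemma step_fun_Nil [simp]: "step_fun [] = (\<lambda>p. 0)"
  and step_int_Nil [simp]: "step_int [] = (\<lambda>\<omega>. 0)"
  and step_fun_Cons: "step_fun (e # L) = (\<lambda>p. elem_fun e p + step_fun L p)"
  and step_int_Cons: "step_int (e # L) = (\<lambda>\<omega>. elem_int e \<omega> + step_int L \<omega>)"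
  and step_fun_append: "step_fun (L @ L') = (\<lambda>p. step_fun L p + step_fun L' p)"
  and step_int_append: "step_int (L @ L') = (\<lambda>\<omega>. step_int L \<omega> + step_int L' \<omega>)"
  by (auto simp: step_fun_def step_int_def fun_eq_iff)

lemma sq_integrable_step_fun: "list_all elem_valid L \<Longrightarrow> sq_integrable K (step_fun L)"
  by (induction L)
    (auto simp: step_fun_Cons sq_integrable_def[of _ "\<lambda>p. 0"] intro!: sq_integrable_add sq_integrable_elem_fun)

lemma sq_integrable_step_int: "list_all elem_valid L \<Longrightarrow> sq_integrable M (step_int L)"
  by (induction L)
    (auto simp: step_int_Cons sq_integrable_def[of _ "\<lambda>p. 0"] intro!: sq_integrable_add sq_integrable_elem_int)

lemma elem_step_inner:
  assumes "elem_valid e" "list_all elem_valid L"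
  shows "expectation (\<lambda>\<omega>. elem_int e \<omega> * step_int L \<omega>) = (\<integral>p. elem_fun e p * step_fun L p \<partial>K)"
  using assms(2)
proof (induction L)
  case (Cons e' L)
  then have v: "elem_valid e'" "list_all elem_valid L" by auto
  note [simp] = sq_integrable_mult[OF sq_integrable_elem_fun[OF assms(1)] sq_integrable_elem_fun[OF v(1)]]
    sq_integrable_mult[OF sq_integrable_elem_fun[OF assms(1)] sq_integrable_step_fun[OF v(2)]]
    sq_integrable_mult[OF sq_integrable_elem_int[OF assms(1)] sq_integrable_elem_int[OF v(1)]]
    sq_integrable_mult[OF sq_integrable_elem_int[OF assms(1)] sq_integrable_step_int[OF v(2)]]
  show ?case using Cons.IH[OF v(2)] elem_inner[OF assms(1) v(1)]
    by (simp add: step_fun_Cons step_int_Cons distrib_left)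
qed simp

lemma step_inner:
  assumes "list_all elem_valid L" "list_all elem_valid L'"
  shows "expectation (\<lambda>\<omega>. step_int L \<omega> * step_int L' \<omega>) = (\<integral>p. step_fun L p * step_fun L' p \<partial>K)"
  using assms(1)
proof (induction L)
  case (Cons e L)
  then have v: "elem_valid e" "list_all elem_valid L" by auto
  note [simp] = sq_integrable_mult[OF sq_integrable_elem_fun[OF v(1)] sq_integrable_step_fun[OF assms(2)]]
    sq_integrable_mult[OF sq_integrable_step_fun[OF v(2)] sq_integrable_step_fun[OF assms(2)]]
    sq_integrable_mult[OF sq_integrable_elem_int[OF v(1)] sq_integrable_step_int[OF assms(2)]]
    sq_integrable_mult[OF sq_integrable_step_int[OF v(2)] sq_integrable_step_int[OF assms(2)]]
  show ?case using Cons.IH[OF v(2)] elem_step_inner[OF v(1) assms(2)]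
    by (simp add: step_fun_Cons step_int_Cons distrib_right)
qed simp

lemma step_isometry:
  assumes "list_all elem_valid L"
  shows "L2_norm M (step_int L) = L2_norm K (step_fun L)"
  using step_inner[OF assms assms] by (simp add: L2_norm_def power2_eq_square)

section \<open>The stochastic integral as an L2 closure\<close>

text \<open>The closure, in the product of the two L2 spaces, of the graph of the elementary
  integral. It is a relation because \<open>I\<close> is determined only up to null sets.\<close>

definition ito :: "('i \<times> real \<times> 'w \<Rightarrow> real) \<Rightarrow> ('w \<Rightarrow> real) \<Rightarrow> bool" where
  "ito f I \<longleftrightarrow> sq_integrable K f \<and> sq_integrable M I \<and>
     (\<forall>\<epsilon>>0. \<exists>L. list_all elem_valid L \<and> L2_norm K (\<lambda>p. step_fun L p - f p) < \<epsilon> \<and>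
        L2_norm M (\<lambda>\<omega>. step_int L \<omega> - I \<omega>) < \<epsilon>)"

lemma ito_sq_integrable: "ito f I \<Longrightarrow> sq_integrable K f" "ito f I \<Longrightarrow> sq_integrable M I"
  by (auto simp: ito_def)

lemma itoE:
  assumes "ito f I" "0 < \<epsilon>"
  obtains L where "list_all elem_valid L" "L2_norm K (\<lambda>p. step_fun L p - f p) < \<epsilon>"
    "L2_norm M (\<lambda>\<omega>. step_int L \<omega> - I \<omega>) < \<epsilon>"
  using assms by (auto simp: ito_def)

lemma ito_isometry:
  assumes "ito f I"
  shows "L2_norm M I = L2_norm K f"
proof -
  have "\<bar>L2_norm M I - L2_norm K f\<bar> \<le> \<epsilon>" if "0 < \<epsilon>" for \<epsilon>
  proof -
    from that have "0 < \<epsilon> / 2" by simp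
    with assms obtain L where L: "list_all elem_valid L" "L2_norm K (\<lambda>p. step_fun L p - f p) < \<epsilon> / 2"
      "L2_norm M (\<lambda>\<omega>. step_int L \<omega> - I \<omega>) < \<epsilon> / 2" by (rule itoE)
    have "\<bar>L2_norm M (step_int L) - L2_norm M I\<bar> < \<epsilon> / 2"
      using L2_norm_diff_bound[OF sq_integrable_step_int[OF L(1)] ito_sq_integrable(2)[OF assms]] L(3) by simp
    moreover have "\<bar>L2_norm K (step_fun L) - L2_norm K f\<bar> < \<epsilon> / 2"
      using L2_norm_diff_bound[OF sq_integrable_step_fun[OF L(1)] ito_sq_integrable(1)[OF assms]] L(2) by simp
    ultimately show ?thesis using step_isometry[OF L(1)] by linarith
  qed
  then have "\<bar>L2_norm M I - L2_norm K f\<bar> \<le> 0" by (rule field_le_epsilon) simp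
  then show ?thesis by simp
qed

text \<open>The graph is closed. Later constructions approximate by integrals that are no longer
  elementary, and this absorbs the additional limit.\<close>

lemma ito_limit:
  assumes f: "sq_integrable K f" and I: "sq_integrable M I"
    and appr: "\<And>\<epsilon>. 0 < \<epsilon> \<Longrightarrow> \<exists>g J. ito g J \<and> L2_norm K (\<lambda>p. g p - f p) < \<epsilon> \<and> L2_norm M (\<lambda>\<omega>. J \<omega> - I \<omega>) < \<epsilon>"
  shows "ito f I"
  unfolding ito_def
proof (intro conjI f I allI impI)
  fix \<epsilon> :: real assume "0 < \<epsilon>"
  then have e: "0 < \<epsilon> / 2" by simp
  from appr[OF e] obtain g J where gJ: "ito g J" "L2_norm K (\<lambda>p. g p - f p) < \<epsilon> / 2" "L2_norm M (\<lambda>\<omega>. J \<omega> - I \<omega>) < \<epsilon> / 2"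
    by auto
  from itoE[OF gJ(1) e] obtain L where L: "list_all elem_valid L" "L2_norm K (\<lambda>p. step_fun L p - g p) < \<epsilon> / 2"
      "L2_norm M (\<lambda>\<omega>. step_int L \<omega> - J \<omega>) < \<epsilon> / 2" .
  have "L2_norm K (\<lambda>p. step_fun L p - f p) < \<epsilon>"
    using L2_norm_diff_triangle[OF sq_integrable_step_fun[OF L(1)] ito_sq_integrable(1)[OF gJ(1)] f] gJ(2) L(2)
    by simp
  moreover have "L2_norm M (\<lambda>\<omega>. step_int L \<omega> - I \<omega>) < \<epsilon>"
    using L2_norm_diff_triangle[OF sq_integrable_step_int[OF L(1)] ito_sq_integrable(2)[OF gJ(1)] I] gJ(3) L(3)
    by simp
  ultimately show "\<exists>L. list_all elem_valid L \<and> L2_norm K (\<lambda>p. step_fun L p - f p) < \<epsilon> \<and>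
        L2_norm M (\<lambda>\<omega>. step_int L \<omega> - I \<omega>) < \<epsilon>" using L(1) by blast
qed

lemma ito_step: "list_all elem_valid L \<Longrightarrow> ito (step_fun L) (step_int L)"
  unfolding ito_def
  by (intro conjI allI impI exI[of _ L] sq_integrable_step_fun sq_integrable_step_int) (auto simp: L2_norm_def)

lemma ito_zero: "ito (\<lambda>p. 0) (\<lambda>\<omega>. 0)"
  using ito_step[of "[]"] by simp

lemma ito_add:
  assumes fI: "ito f I" and gJ: "ito g J"
  shows "ito (\<lambda>p. f p + g p) (\<lambda>\<omega>. I \<omega> + J \<omega>)"
proof (rule ito_limit)
  fix \<epsilon> :: real assume "0 < \<epsilon>"
  then have e: "0 < \<epsilon> / 2" by simp
  from itoE[OF fI e] obtain L where L: "list_all elem_valid L" "L2_norm K (\<lambda>p. step_fun L p - f p) < \<epsilon> / 2"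
      "L2_norm M (\<lambda>\<omega>. step_int L \<omega> - I \<omega>) < \<epsilon> / 2" .
  from itoE[OF gJ e] obtain L' where L': "list_all elem_valid L'" "L2_norm K (\<lambda>p. step_fun L' p - g p) < \<epsilon> / 2"
      "L2_norm M (\<lambda>\<omega>. step_int L' \<omega> - J \<omega>) < \<epsilon> / 2" .
  have v: "list_all elem_valid (L @ L')" using L L' by simp
  have "L2_norm K (\<lambda>p. step_fun (L @ L') p - (f p + g p)) < \<epsilon>"
    using L2_norm_triangle[OF sq_integrable_diff[OF sq_integrable_step_fun[OF L(1)] ito_sq_integrable(1)[OF fI]]
        sq_integrable_diff[OF sq_integrable_step_fun[OF L'(1)] ito_sq_integrable(1)[OF gJ]]] L(2) L'(2)
    by (simp add: step_fun_append algebra_simps)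
  moreover have "L2_norm M (\<lambda>\<omega>. step_int (L @ L') \<omega> - (I \<omega> + J \<omega>)) < \<epsilon>"
    using L2_norm_triangle[OF sq_integrable_diff[OF sq_integrable_step_int[OF L(1)] ito_sq_integrable(2)[OF fI]]
        sq_integrable_diff[OF sq_integrable_step_int[OF L'(1)] ito_sq_integrable(2)[OF gJ]]] L(3) L'(3)
    by (simp add: step_int_append algebra_simps)
  ultimately show "\<exists>h H. ito h H \<and> L2_norm K (\<lambda>p. h p - (f p + g p)) < \<epsilon> \<and> L2_norm M (\<lambda>\<omega>. H \<omega> - (I \<omega> + J \<omega>)) < \<epsilon>"
    using ito_step[OF v] by blast
qed (use fI gJ in \<open>auto simp: ito_def intro: sq_integrable_add\<close>)

lemma ito_cmult:
  assumes fI: "ito f I"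
  shows "ito (\<lambda>p. c * f p) (\<lambda>\<omega>. c * I \<omega>)"
proof (rule ito_limit)
  define scale where "scale = map (\<lambda>(x, a, b, \<xi>). (x :: 'i, a :: real, b :: real, \<lambda>\<omega> :: 'w. c * \<xi> \<omega> :: real))"
  have sf: "step_fun (scale L) = (\<lambda>p. c * step_fun L p)" for L
    unfolding scale_def by (induction L) (auto simp: step_fun_Cons elem_fun_def fun_eq_iff distrib_left)
  have si: "step_int (scale L) = (\<lambda>p. c * step_int L p)" for L
    unfolding scale_def by (induction L) (auto simp: step_int_Cons elem_int_def fun_eq_iff distrib_left mult.assoc)
  have sv: "list_all elem_valid (scale L)" if "list_all elem_valid L" for L
    using that unfolding scale_def
  proof (induction L)
    case (Cons e L)
    obtain x a b \<xi> where e: "e = (x, a, b, \<xi>)" by (metis prod_cases4)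
    with Cons.prems obtain C where C: "\<forall>\<omega>\<in>space M. \<bar>\<xi> \<omega>\<bar> \<le> C" by (auto simp: elem_valid_def)
    then have "\<forall>\<omega>\<in>space M. \<bar>c * \<xi> \<omega>\<bar> \<le> \<bar>c\<bar> * C" by (auto simp: abs_mult intro: mult_left_mono)
    then have "\<exists>C. \<forall>\<omega>\<in>space M. \<bar>c * \<xi> \<omega>\<bar> \<le> C" ..
    then show ?case using Cons by (auto simp: e elem_valid_def)
  qed simp
  fix \<epsilon> :: real assume "0 < \<epsilon>"
  \<comment> \<open>The summand 1 keeps the denominator positive when \<open>c = 0\<close>.\<close>
  then have e: "0 < \<epsilon> / (\<bar>c\<bar> + 1)" by simp
  from itoE[OF fI e] obtain L where L: "list_all elem_valid L" "L2_norm K (\<lambda>p. step_fun L p - f p) < \<epsilon> / (\<bar>c\<bar> + 1)"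
      "L2_norm M (\<lambda>\<omega>. step_int L \<omega> - I \<omega>) < \<epsilon> / (\<bar>c\<bar> + 1)" .
  have small: "\<bar>c\<bar> * z < \<epsilon>" if "0 \<le> z" "z < \<epsilon> / (\<bar>c\<bar> + 1)" for z
  proof -
    have "\<bar>c\<bar> * z \<le> (\<bar>c\<bar> + 1) * z" using that by (simp add: algebra_simps)
    also have "\<dots> < \<epsilon>" using that by (simp add: field_simps)
    finally show ?thesis .
  qed
  show "\<exists>g J. ito g J \<and> L2_norm K (\<lambda>p. g p - c * f p) < \<epsilon> \<and> L2_norm M (\<lambda>\<omega>. J \<omega> - c * I \<omega>) < \<epsilon>"
    using ito_step[OF sv[OF L(1)]] small[OF _ L(2)] small[OF _ L(3)]
    by (intro exI[of _ "step_fun (scale L)"] exI[of _ "step_int (scale L)"])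
      (simp add: sf si right_diff_distrib[symmetric] L2_norm_cmult)
qed (use fI in \<open>auto simp: ito_def intro: sq_integrable_cmult\<close>)

lemma ito_sum:
  assumes "\<And>i. i \<in> A \<Longrightarrow> ito (f i) (I i)"
  shows "ito (\<lambda>p. \<Sum>i\<in>A. f i p) (\<lambda>\<omega>. \<Sum>i\<in>A. I i \<omega>)"
  using assms by (induction A rule: infinite_finite_induct) (auto intro: ito_zero ito_add)

lemma ito_diff:
  assumes "ito f I" "ito g J"
  shows "ito (\<lambda>p. f p - g p) (\<lambda>\<omega>. I \<omega> - J \<omega>)"
  using ito_add[OF assms(1) ito_cmult[OF assms(2), of "-1"]] by simp

section \<open>Integrals seen from the past up to a fixed time\<close>

definition trunc :: "real \<Rightarrow> ('i \<times> real \<times> 'w \<Rightarrow> real) \<Rightarrow> 'i \<times> real \<times> 'w \<Rightarrow> real" where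
  "trunc s f p = indicator {..s} (fst (snd p)) * f p"

lemma sq_integrable_trunc: "sq_integrable K f \<Longrightarrow> sq_integrable K (trunc s f)"
proof -
  assume f: "sq_integrable K f"
  have "(\<lambda>p. indicator {..s} (fst (snd p)) :: real) \<in> borel_measurable K" by measurable
  then show ?thesis using f unfolding trunc_def
    by (intro sq_integrable_bound[OF _ f]) (auto simp: sq_integrable_def indicator_def)
qed

lemma L2_norm_trunc_le: "sq_integrable K f \<Longrightarrow> L2_norm K (trunc s f) \<le> L2_norm K f"
  by (rule L2_norm_mono[OF sq_integrable_measurable[OF sq_integrable_trunc]]) (auto simp: trunc_def indicator_def)

text \<open>Every quadruple is cut at time \<open>s\<close>. For the early part the integrand is
  recorded; for the late part only that nothing starts before \<open>s\<close>, which is all that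
  orthogonality needs.\<close>

lemma increments_split:
  assumes v: "list_all elem_valid L" and s: "0 \<le> s"
  shows "\<exists>L1 L2. list_all elem_valid L1 \<and> list_all elem_valid L2 \<and> (\<forall>(x, a, b, \<xi>)\<in>set L2. s \<le> a) \<and>
    step_int L = (\<lambda>\<omega>. step_int L1 \<omega> + step_int L2 \<omega>) \<and> step_fun L1 = trunc s (step_fun L)"
  using v
proof (induction L)
  case Nil
  show ?case by (rule exI[of _ "[]"], rule exI[of _ "[]"]) (auto simp: trunc_def)
next
  case (Cons e L)
  then have "list_all elem_valid L" by simp
  from Cons.IH[OF this] obtain L1 L2 where L: "list_all elem_valid L1" "list_all elem_valid L2" "\<forall>(x, a, b, \<xi>)\<in>set L2. s \<le> a"
    "step_int L = (\<lambda>\<omega>. step_int L1 \<omega> + step_int L2 \<omega>)" "step_fun L1 = trunc s (step_fun L)" by blast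
  obtain x a b \<xi> where e: "e = (x, a, b, \<xi>)" by (metis prod_cases4)
  have ve: "0 \<le> a" "a \<le> b" "\<xi> \<in> borel_measurable (F a)" "\<exists>C. \<forall>\<omega>\<in>space M. \<bar>\<xi> \<omega>\<bar> \<le> C"
    using Cons.prems by (auto simp: e elem_valid_def)
  show ?case
  proof (cases "a < s")
    case True
    \<comment> \<open>\<open>min\<close> and \<open>max\<close> cover an interval that ends before
      \<open>s\<close>: its second piece is then the empty interval from \<open>s\<close> to
      \<open>s\<close>.\<close>
    have "elem_valid (x, a, min b s, \<xi>)" "elem_valid (x, s, max b s, \<xi>)"
      using ve True s bm_filtration_mono[OF ve(3), of s] by (auto simp: elem_valid_def)
    moreover have "step_int (e # L) = (\<lambda>\<omega>. step_int ((x, a, min b s, \<xi>) # L1) \<omega> + step_int ((x, s, max b s, \<xi>) # L2) \<omega>)"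
      using True by (cases "b \<le> s") (auto simp: step_int_Cons e elem_int_def L(4) fun_eq_iff algebra_simps)
    moreover have "step_fun ((x, a, min b s, \<xi>) # L1) = trunc s (step_fun (e # L))"
      by (auto simp: step_fun_Cons e elem_fun_def L(5) fun_eq_iff trunc_def indicator_def)
    ultimately show ?thesis using L(1-3)
      by (intro exI[of _ "(x, a, min b s, \<xi>) # L1"] exI[of _ "(x, s, max b s, \<xi>) # L2"]) auto
  next
    case False
    have "step_int (e # L) = (\<lambda>\<omega>. step_int L1 \<omega> + step_int (e # L2) \<omega>)"
      by (auto simp: step_int_Cons L(4) fun_eq_iff)
    moreover have "step_fun L1 = trunc s (step_fun (e # L))"
      using False by (auto simp: step_fun_Cons e elem_fun_def L(5) fun_eq_iff trunc_def indicator_def)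
    ultimately show ?thesis using L(1-3) Cons.prems False
      by (intro exI[of _ L1] exI[of _ "e # L2"]) (auto simp: e)
  qed
qed

text \<open>The coefficient \<open>\<xi>\<close> is merged with \<open>V\<close>: the product is
  still known when the increment starts, and boundedness of \<open>\<xi>\<close> keeps it square
  integrable.\<close>

lemma future_step_orthogonal:
  assumes V: "V \<in> borel_measurable (F s)" "sq_integrable M V"
    and "list_all elem_valid L" "\<forall>(x, a, b, \<xi>)\<in>set L. s \<le> a"
  shows "expectation (\<lambda>\<omega>. V \<omega> * step_int L \<omega>) = 0"
  using assms(3,4)
proof (induction L)
  case (Cons e L)
  then have v: "list_all elem_valid L" and IH: "expectation (\<lambda>\<omega>. V \<omega> * step_int L \<omega>) = 0" by auto
  obtain x a b \<xi> where e: "e = (x, a, b, \<xi>)" by (metis prod_cases4)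
  have ve: "elem_valid e" "0 \<le> a" "a \<le> b" "\<xi> \<in> borel_measurable (F a)" "s \<le> a"
    using Cons.prems by (auto simp: e elem_valid_def)
  obtain C where C: "\<And>\<omega>. \<omega> \<in> space M \<Longrightarrow> \<bar>\<xi> \<omega>\<bar> \<le> C"
    using ve(1) by (auto simp: e elem_valid_def)
  have "expectation (\<lambda>\<omega>. (\<xi> \<omega> * V \<omega>) * (B x b \<omega> - B x a \<omega>)) = 0"
  proof (rule increment_orthogonal[OF ve(2,3)])
    show "sq_integrable M (\<lambda>\<omega>. \<xi> \<omega> * V \<omega>)"
      using bm_filtration_measurableD[OF ve(4)] C V(2) by (rule sq_integrable_bounded_mult)
    fix r assume "a < r"
    then show "(\<lambda>\<omega>. \<xi> \<omega> * V \<omega>) \<in> borel_measurable (past_except x r)"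
      using bm_filtration_measurable_past_except[OF ve(4), of r x]
        bm_filtration_measurable_past_except[OF V(1), of r x] ve(5) by auto
  qed
  moreover have "(\<lambda>\<omega>. (\<xi> \<omega> * V \<omega>) * (B x b \<omega> - B x a \<omega>)) = (\<lambda>\<omega>. V \<omega> * elem_int e \<omega>)"
    by (auto simp: elem_int_def e algebra_simps)
  ultimately show ?case using IH
      sq_integrable_mult[OF V(2) sq_integrable_elem_int[OF ve(1)]]
      sq_integrable_mult[OF V(2) sq_integrable_step_int[OF v]]
    by (simp add: step_int_Cons distrib_left)
qed simp

text \<open>The conditional expectation of a stochastic integral given the past up to time \<open>s\<close> depends only on
  the integrand up to time \<open>s\<close>; the inequality expresses this without conditional expectations.\<close>

lemma ito_past_bound:
  assumes V: "V \<in> borel_measurable (F s)" "sq_integrable M V" and s: "0 \<le> s" and fI: "ito f I"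
  shows "\<bar>expectation (\<lambda>\<omega>. V \<omega> * I \<omega>)\<bar> \<le> L2_norm M V * L2_norm K (trunc s f)"
proof (rule field_le_epsilon)
  fix \<epsilon> :: real assume "0 < \<epsilon>"
  \<comment> \<open>The norm of \<open>V\<close> times \<open>\<delta>\<close> is lost twice, once
    for replacing \<open>I\<close> and once for replacing \<open>f\<close>. The summand 1 admits a
    vanishing norm.\<close>
  define \<delta> where "\<delta> = \<epsilon> / (2 * (L2_norm M V + 1))"
  have \<delta>: "0 < \<delta>" "2 * (L2_norm M V * \<delta>) \<le> \<epsilon>"
  proof -
    have v: "0 < L2_norm M V + 1" using L2_norm_nonneg[of M V] by linarith
    then show "0 < \<delta>" using \<open>0 < \<epsilon>\<close> by (simp add: \<delta>_def)
    have "2 * (w * (\<epsilon> / (2 * w))) = \<epsilon>" if "0 < w" for w :: real using that by simp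
    from this[OF v] have "2 * ((L2_norm M V + 1) * \<delta>) = \<epsilon>" unfolding \<delta>_def .
    then show "2 * (L2_norm M V * \<delta>) \<le> \<epsilon>" using \<open>0 < \<delta>\<close> by (simp add: algebra_simps)
  qed
  from itoE[OF fI \<delta>(1)] obtain L where L: "list_all elem_valid L" "L2_norm K (\<lambda>p. step_fun L p - f p) < \<delta>"
      "L2_norm M (\<lambda>\<omega>. step_int L \<omega> - I \<omega>) < \<delta>" .
  from increments_split[OF L(1) s] obtain L1 L2 where L12: "list_all elem_valid L1" "list_all elem_valid L2"
    "\<forall>(x, a, b, \<xi>)\<in>set L2. s \<le> a" "step_int L = (\<lambda>\<omega>. step_int L1 \<omega> + step_int L2 \<omega>)"
    "step_fun L1 = trunc s (step_fun L)" by blast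
  note si = sq_integrable_step_int[OF L12(1)] sq_integrable_step_int[OF L12(2)]
  have d: "sq_integrable M (\<lambda>\<omega>. I \<omega> - step_int L \<omega>)"
    by (rule sq_integrable_diff[OF ito_sq_integrable(2)[OF fI] sq_integrable_step_int[OF L(1)]])
  have "expectation (\<lambda>\<omega>. V \<omega> * I \<omega>) =
    expectation (\<lambda>\<omega>. V \<omega> * (I \<omega> - step_int L \<omega>) + V \<omega> * step_int L1 \<omega> + V \<omega> * step_int L2 \<omega>)"
    by (simp add: L12(4) algebra_simps)
  also have "\<dots> = expectation (\<lambda>\<omega>. V \<omega> * (I \<omega> - step_int L \<omega>)) + expectation (\<lambda>\<omega>. V \<omega> * step_int L1 \<omega>)"
    using sq_integrable_mult[OF V(2) d] sq_integrable_mult[OF V(2) si(1)] sq_integrable_mult[OF V(2) si(2)]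
      future_step_orthogonal[OF V L12(2,3)] by simp
  finally have "\<bar>expectation (\<lambda>\<omega>. V \<omega> * I \<omega>)\<bar> \<le>
      L2_norm M V * L2_norm M (\<lambda>\<omega>. I \<omega> - step_int L \<omega>) + L2_norm M V * L2_norm M (step_int L1)"
    using Cauchy_Schwarz_integral[OF V(2) d] Cauchy_Schwarz_integral[OF V(2) si(1)] by linarith
  moreover have "L2_norm M (\<lambda>\<omega>. I \<omega> - step_int L \<omega>) \<le> \<delta>"
    using L(3) by (simp add: L2_norm_minus_commute)
  moreover have "L2_norm M (step_int L1) \<le> \<delta> + L2_norm K (trunc s f)"
  proof -
    have sd: "sq_integrable K (\<lambda>p. step_fun L p - f p)"
      by (rule sq_integrable_diff[OF sq_integrable_step_fun[OF L(1)] ito_sq_integrable(1)[OF fI]])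
    have "step_fun L1 = (\<lambda>p. trunc s (\<lambda>p. step_fun L p - f p) p + trunc s f p)"
      unfolding L12(5) by (auto simp: trunc_def algebra_simps)
    then have "L2_norm K (step_fun L1) \<le> L2_norm K (trunc s (\<lambda>p. step_fun L p - f p)) + L2_norm K (trunc s f)"
      using L2_norm_triangle[OF sq_integrable_trunc[OF sd] sq_integrable_trunc[OF ito_sq_integrable(1)[OF fI]]]
      by simp
    then show ?thesis
      using L2_norm_trunc_le[OF sd, of s] L(2) step_isometry[OF L12(1)] by linarith
  qed
  ultimately have "\<bar>expectation (\<lambda>\<omega>. V \<omega> * I \<omega>)\<bar> \<le> L2_norm M V * \<delta> + L2_norm M V * (\<delta> + L2_norm K (trunc s f))"
    by (meson L2_norm_nonneg add_mono mult_left_mono order_trans)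
  then show "\<bar>expectation (\<lambda>\<omega>. V \<omega> * I \<omega>)\<bar> \<le> L2_norm M V * L2_norm K (trunc s f) + \<epsilon>"
    using \<delta>(2) by (simp add: algebra_simps)
qed

section \<open>From predictable integrands to the closure\<close>

lemma sets_predictable_sigma:
  "sets (predictable_sigma (space M) F) \<subseteq> sets (restrict_space (lborel \<Otimes>\<^sub>M M) ({0..} \<times> space M))"
  "space (predictable_sigma (space M) F) = {0..} \<times> space M"
proof -
  let ?G = "{{0} \<times> A | A. A \<in> sets (F 0)} \<union> {{s<..t} \<times> A | s t A. 0 \<le> s \<and> s \<le> t \<and> A \<in> sets (F s)}"
  let ?R = "restrict_space (lborel \<Otimes>\<^sub>M M) ({0..} \<times> space M) :: (real \<times> 'w) measure"
  have FM: "sets (F s) \<subseteq> sets M" for s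
    using sets_bm_filtration_subset_past_except[of s "s + 1"] sets_past_except_subset by force
  have G: "?G \<subseteq> Pow ({0..} \<times> space M)"
    using sets.sets_into_space FM by fastforce
  show sp: "space (predictable_sigma (space M) F) = {0..} \<times> space M"
    unfolding predictable_sigma_def by (rule space_measure_of[OF G])
  have GR: "?G \<subseteq> sets ?R"
  proof (rule subsetI)
    fix E assume E: "E \<in> ?G"
    then have "E \<in> sets (lborel \<Otimes>\<^sub>M M)" by (auto intro!: pair_measureI subsetD[OF FM])
    moreover have "E \<subseteq> {0..} \<times> space M" using G E by blast
    ultimately show "E \<in> sets ?R" by (subst sets_restrict_space_iff) auto
  qed
  have "sets (predictable_sigma (space M) F) = sigma_sets ({0..} \<times> space M) ?G"
    unfolding predictable_sigma_def by (rule sets_measure_of[OF G])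
  also have "{0..} \<times> space M = space ?R" by (auto simp: space_restrict_space space_pair_measure)
  also have "sigma_sets (space ?R) ?G \<subseteq> sets ?R" by (rule sets.sigma_sets_subset[OF GR])
  finally show "sets (predictable_sigma (space M) F) \<subseteq> sets ?R" .
qed

text \<open>The predictable sets live on nonnegative times only; extension by 0 makes the process
  jointly measurable on the whole time axis carried by \<open>K\<close>.\<close>

lemma predictable_jointly_measurable:
  assumes "predictable (space M) F g"
  shows "(\<lambda>(s, \<omega>). indicator {0..} s * g s \<omega>) \<in> borel_measurable (lborel \<Otimes>\<^sub>M M)"
proof -
  let ?R = "restrict_space (lborel \<Otimes>\<^sub>M M) ({0..} \<times> space M)"
  have "(\<lambda>(s, \<omega>). g s \<omega>) \<in> borel_measurable ?R"
  proof (rule subsetD[OF measurable_mono])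
    show "sets (predictable_sigma (space M) F) \<subseteq> sets ?R" by (rule sets_predictable_sigma(1))
    show "space (predictable_sigma (space M) F) = space ?R"
      unfolding sets_predictable_sigma(2) by (auto simp: space_restrict_space space_pair_measure)
    show "(\<lambda>(s, \<omega>). g s \<omega>) \<in> borel_measurable (predictable_sigma (space M) F)"
      using assms unfolding predictable_def .
  qed auto
  then have "(\<lambda>p. indicator ({0..} \<times> space M) p *\<^sub>R (case p of (s, \<omega>) \<Rightarrow> g s \<omega>)) \<in> borel_measurable (lborel \<Otimes>\<^sub>M M)"
    by (subst (asm) borel_measurable_restrict_space_iff) auto
  then show ?thesis
    by (rule measurable_cong[THEN iffD1, rotated])
      (auto simp: space_pair_measure indicator_def)
qed

text \<open>At time \<open>s\<close> the section of a generating rectangle is empty, or a set of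
  \<open>F r\<close> with \<open>r < s\<close>, or a set of \<open>F 0\<close> when
  \<open>s = 0\<close>.\<close>

lemma predictable_adapted:
  assumes "predictable (space M) F g" "0 \<le> s"
  shows "g s \<in> borel_measurable (F s)"
proof -
  let ?G = "{{0} \<times> A | A. A \<in> sets (F 0)} \<union> {{s<..t} \<times> A | s t A. 0 \<le> s \<and> s \<le> t \<and> A \<in> sets (F s)}"
  have FM: "sets (F s) \<subseteq> sets M" for s
    using sets_bm_filtration_subset_past_except[of s "s + 1"] sets_past_except_subset by force
  have G: "?G \<subseteq> Pow ({0..} \<times> space M)"
    using sets.sets_into_space FM by fastforce
  have mono: "A \<in> sets (F r) \<Longrightarrow> r \<le> s \<Longrightarrow> A \<in> sets (F s)" for A r
    using filtration.sets_F_mono[OF filtration_bm_filtration] by blast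
  have "(\<lambda>\<omega>. (s, \<omega>)) \<in> measurable (F s) (predictable_sigma (space M) F)"
    unfolding predictable_sigma_def
  proof (rule measurable_measure_of[OF G])
    fix E assume "E \<in> ?G"
    then consider A where "E = {0} \<times> A" "A \<in> sets (F 0)"
      | r t A where "E = {r<..t} \<times> A" "0 \<le> r" "A \<in> sets (F r)" by blast
    then show "Pair s -` E \<inter> space (F s) \<in> sets (F s)"
    proof cases
      case (1 A)
      then have "Pair s -` E \<inter> space (F s) = (if s = 0 then A else {})"
        using sets.sets_into_space[OF 1(2)] by auto
      then show ?thesis using 1(2) by (cases "s = 0") auto
    next
      case (2 r t A)
      then have "Pair s -` E \<inter> space (F s) = (if r < s \<and> s \<le> t then A else {})"
        using sets.sets_into_space[OF 2(3)] by auto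
      then show ?thesis using mono[OF 2(3)] by (cases "r < s \<and> s \<le> t") auto
    qed
  qed (use assms in auto)
  from measurable_compose[OF this assms(1)[unfolded predictable_def]] show ?thesis by simp
qed

text \<open>Approximation by simple processes against one motion becomes approximation over
  \<open>K\<close>, the motion being selected by the indicator of its site.\<close>

lemma has_ito_integral_ito:
  assumes I: "has_ito_integral M F (B y) t f I" and t: "0 \<le> t"
  shows "ito (\<lambda>(z, r, \<omega>). indicator {y} z * (indicator {0..t} r * f r \<omega>)) I"
proof -
  let ?f = "\<lambda>(z, r, \<omega>). indicator {y} z * (indicator {0..t} r * f r \<omega>)"
  from I obtain n \<tau> \<xi> where Im: "I \<in> borel_measurable M"
    and pred: "predictable (space M) F (\<lambda>s \<omega>. indicator {0..t} s * f s \<omega>)"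
    and sd: "\<And>k. simple_data (space M) F (n k) (\<tau> k) (\<xi> k)"
    and lf: "(\<lambda>k. \<integral>\<^sup>+\<omega>. (\<integral>\<^sup>+s\<in>{0..t}. ennreal ((simple_process (n k) (\<tau> k) (\<xi> k) s \<omega> - f s \<omega>)\<^sup>2) \<partial>lborel) \<partial>M) \<longlonglongrightarrow> 0"
    and lI: "(\<lambda>k. \<integral>\<^sup>+\<omega>. ennreal ((simple_ito (B y) t (n k) (\<tau> k) (\<xi> k) \<omega> - I \<omega>)\<^sup>2) \<partial>M) \<longlonglongrightarrow> 0"
    unfolding has_ito_integral_def by blast
  have "(\<lambda>(s, \<omega>). indicator {0..} s * (indicator {0..t} s * f s \<omega>)) = (\<lambda>(s, \<omega>). indicator {0..t} s * f s \<omega>)"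
    by (auto simp: indicator_def fun_eq_iff)
  then have fm [measurable]: "(\<lambda>(s, \<omega>). indicator {0..t} s * f s \<omega>) \<in> borel_measurable (lborel \<Otimes>\<^sub>M M)"
    using predictable_jointly_measurable[OF pred] by simp
  have fK: "?f \<in> borel_measurable K"
    by (rule measurable_K) (use fm in \<open>auto simp: case_prod_beta'\<close>)
  \<comment> \<open>Pieces are clipped at \<open>t\<close>. Those not starting before
    \<open>t\<close> contribute nothing and are dropped, because clipping could move their left
    endpoint below the time at which the coefficient is measurable.\<close>
  define L where "L k = map (\<lambda>i. (y, min t (\<tau> k i), min t (\<tau> k (Suc i)), \<xi> k i)) (filter (\<lambda>i. \<tau> k i < t) [0..<n k])" for k
  have tau: "0 \<le> \<tau> k i" "\<tau> k i \<le> \<tau> k (Suc i)" for k i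
    using sd[of k] by (auto simp: simple_data_def mono_def intro: order_trans)
  have tau': "\<tau> k i < r \<Longrightarrow> 0 \<le> r" for k i r
    using tau(1)[of k i] by linarith
  have Lv: "list_all elem_valid (L k)" for k
    using sd[of k] t tau unfolding L_def list_all_iff simple_data_def
    by (auto simp: elem_valid_def min_def)
  have Lsum: "(\<Sum>e\<leftarrow>L k. h e) = (\<Sum>i<n k. if \<tau> k i < t then h (y, min t (\<tau> k i), min t (\<tau> k (Suc i)), \<xi> k i) else 0)"
    for h :: "'i \<times> real \<times> real \<times> ('w \<Rightarrow> real) \<Rightarrow> real" and k
    unfolding L_def by (simp add: sum_list_map_filter' comp_def interv_sum_list_conv_sum_set_nat atLeast0LessThan)
  have Lf: "step_fun (L k) (z, r, \<omega>) = indicator {y} z * (indicator {0..t} r * simple_process (n k) (\<tau> k) (\<xi> k) r \<omega>)" for k z r \<omega>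
    unfolding step_fun_def Lsum simple_process_def sum_distrib_left
    by (intro sum.cong refl) (use tau[of k] in \<open>auto simp: elem_fun_def indicator_def dest: tau'\<close>)
  have LI: "step_int (L k) \<omega> = simple_ito (B y) t (n k) (\<tau> k) (\<xi> k) \<omega>" for k \<omega>
    unfolding step_int_def Lsum simple_ito_def
  proof (intro sum.cong refl)
    fix i
    show "(if \<tau> k i < t then elem_int (y, min t (\<tau> k i), min t (\<tau> k (Suc i)), \<xi> k i) \<omega> else 0) =
      \<xi> k i \<omega> * (B y (min t (\<tau> k (Suc i))) \<omega> - B y (min t (\<tau> k i)) \<omega>)"
      using tau[of k i] by (cases "\<tau> k i < t") (auto simp: elem_int_def min_def)
  qed
  \<comment> \<open>Only site \<open>y\<close> contributes. Over \<open>K\<close> the sample point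
    is integrated inside and time outside, in the definition of the integral the other way
    round.\<close>
  have nn: "(\<integral>\<^sup>+p. ennreal ((step_fun (L k) p - ?f p)\<^sup>2) \<partial>K) =
      (\<integral>\<^sup>+\<omega>. (\<integral>\<^sup>+s\<in>{0..t}. ennreal ((simple_process (n k) (\<tau> k) (\<xi> k) s \<omega> - f s \<omega>)\<^sup>2) \<partial>lborel) \<partial>M)" for k
  proof -
    have sm: "step_fun (L k) \<in> borel_measurable K"
      by (rule sq_integrable_measurable[OF sq_integrable_step_fun[OF Lv]])
    let ?d = "\<lambda>r \<omega>. ennreal ((simple_process (n k) (\<tau> k) (\<xi> k) r \<omega> - f r \<omega>)\<^sup>2) * indicator {0..t} r"
    have m1: "(\<lambda>p. ennreal ((step_fun (L k) p - ?f p)\<^sup>2)) \<in> borel_measurable K"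
      using sm fK by measurable
    have eq: "ennreal ((step_fun (L k) (z, r, \<omega>) - ?f (z, r, \<omega>))\<^sup>2) = indicator {y} z * ?d r \<omega>" for z r \<omega>
      by (auto simp: Lf indicator_def)
    have "(\<lambda>q. ennreal ((step_fun (L k) (y, q) - ?f (y, q))\<^sup>2)) \<in> borel_measurable (lborel \<Otimes>\<^sub>M M)"
      by (rule measurable_compose[OF _ m1]) measurable
    also have "(\<lambda>q. ennreal ((step_fun (L k) (y, q) - ?f (y, q))\<^sup>2)) = (\<lambda>(r, \<omega>). ?d r \<omega>)"
      using eq[of y] by (auto simp: fun_eq_iff)
    finally have dm: "(\<lambda>(r, \<omega>). ?d r \<omega>) \<in> borel_measurable (lborel \<Otimes>\<^sub>M M)" .
    have dm1: "(\<lambda>\<omega>. ?d r \<omega>) \<in> borel_measurable M" for r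
      using measurable_compose[OF measurable_Pair1'[of r lborel M] dm] by simp
    have dm2: "(\<lambda>r. \<integral>\<^sup>+\<omega>. ?d r \<omega> \<partial>M) \<in> borel_measurable lborel"
      using dm by (rule borel_measurable_nn_integral)
    have "(\<integral>\<^sup>+p. ennreal ((step_fun (L k) p - ?f p)\<^sup>2) \<partial>K) =
      (\<integral>\<^sup>+z. \<integral>\<^sup>+r. \<integral>\<^sup>+\<omega>. indicator {y} z * ?d r \<omega> \<partial>M \<partial>lborel \<partial>count_space UNIV)"
      unfolding nn_integral_K[OF m1] eq ..
    also have "\<dots> = (\<integral>\<^sup>+z. indicator {y} z * (\<integral>\<^sup>+r. \<integral>\<^sup>+\<omega>. ?d r \<omega> \<partial>M \<partial>lborel) \<partial>count_space UNIV)"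
      using dm1 dm2 by (simp add: nn_integral_cmult)
    also have "\<dots> = (\<integral>\<^sup>+r. \<integral>\<^sup>+\<omega>. ?d r \<omega> \<partial>M \<partial>lborel)"
      by (simp add: nn_integral_multc)
    also have "\<dots> = (\<integral>\<^sup>+\<omega>. \<integral>\<^sup>+r. ?d r \<omega> \<partial>lborel \<partial>M)"
    proof -
      interpret pair_sigma_finite lborel M ..
      show ?thesis using dm by (intro Fubini'[symmetric])
    qed
    finally show ?thesis .
  qed
  have mK: "(\<lambda>p. step_fun (L k) p - ?f p) \<in> borel_measurable K" for k
    using sq_integrable_measurable[OF sq_integrable_step_fun[OF Lv]] fK by (rule borel_measurable_diff)
  have mM: "(\<lambda>\<omega>. step_int (L k) \<omega> - I \<omega>) \<in> borel_measurable M" for k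
    using sq_integrable_measurable[OF sq_integrable_step_int[OF Lv]] Im by (rule borel_measurable_diff)
  note tK = L2_norm_tendsto_0I[where f="\<lambda>k p. step_fun (L k) p - ?f p" and N=K, OF lf[folded nn] mK]
  note tM = L2_norm_tendsto_0I[where f="\<lambda>k \<omega>. step_int (L k) \<omega> - I \<omega>" and N=M, OF lI[folded LI] mM]
  have sK: "sq_integrable K ?f"
  proof -
    from eventually_happens'[OF sequentially_bot tK(2)]
    obtain k where "sq_integrable K (\<lambda>p. step_fun (L k) p - ?f p)" by blast
    from sq_integrable_diff[OF sq_integrable_step_fun[OF Lv[of k]] this] show ?thesis by simp
  qed
  have sM: "sq_integrable M I"
  proof -
    from eventually_happens'[OF sequentially_bot tM(2)]
    obtain k where "sq_integrable M (\<lambda>\<omega>. step_int (L k) \<omega> - I \<omega>)" by blast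
    from sq_integrable_diff[OF sq_integrable_step_int[OF Lv[of k]] this] show ?thesis by simp
  qed
  show ?thesis
    unfolding ito_def
  proof (intro conjI allI impI sK sM)
    fix \<epsilon> :: real assume "0 < \<epsilon>"
    from eventually_happens'[OF sequentially_bot eventually_conj[OF order_tendstoD(2)[OF tK(1) this] order_tendstoD(2)[OF tM(1) this]]]
    show "\<exists>L. list_all elem_valid L \<and> L2_norm K (\<lambda>p. step_fun L p - ?f p) < \<epsilon> \<and> L2_norm M (\<lambda>\<omega>. step_int L \<omega> - I \<omega>) < \<epsilon>"
      using Lv by blast
  qed
qed

lemma L2_norm_dominated_convergence:
  assumes f: "sq_integrable N f" and g: "\<And>n. g n \<in> borel_measurable N"
    and le: "\<And>n x. x \<in> space N \<Longrightarrow> \<bar>g n x\<bar> \<le> \<bar>f x\<bar>"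
    and lim: "\<And>x. x \<in> space N \<Longrightarrow> (\<lambda>n. g n x) \<longlonglongrightarrow> 0"
  shows "(\<lambda>n. L2_norm N (g n)) \<longlonglongrightarrow> 0"
proof -
  have "(\<lambda>n. \<integral>x. (g n x)\<^sup>2 \<partial>N) \<longlonglongrightarrow> (\<integral>x. 0 \<partial>N)"
  proof (rule integral_dominated_convergence)
    show "integrable N (\<lambda>x. (f x)\<^sup>2)" using f by (rule sq_integrable_square)
    show "AE x in N. (\<lambda>n. (g n x)\<^sup>2) \<longlonglongrightarrow> 0"
      using lim by (intro AE_I2) (auto intro: tendsto_eq_intros)
    show "AE x in N. norm ((g n x)\<^sup>2) \<le> (f x)\<^sup>2" for n
      using le by (intro AE_I2) (simp add: abs_le_square_iff)
  qed (use g in auto)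
  from tendsto_real_sqrt[OF this] show ?thesis by (simp add: L2_norm_def)
qed

text \<open>The sum over the first \<open>n\<close> sites integrates \<open>h\<close> restricted to
  these sites. The restrictions converge to \<open>h\<close> by dominated convergence, the integrals
  converge to \<open>S\<close> by assumption, and the graph is closed.\<close>

lemma ito_L2_sum:
  assumes I: "\<And>y. ito (\<lambda>(z, q). indicator {y} z * h (z, q)) (I y)"
    and S: "has_L2_sum M I S" and h: "sq_integrable K h"
  shows "ito h S"
proof -
  define A where "A n = {x::'i. to_nat x < n}" for n
  have fin: "finite (A n)" for n unfolding A_def by (rule finite_to_nat_lessThan)
  define hn where "hn n p = (\<Sum>y\<in>A n. indicator {y} (fst p) * h p)" for n p
  have hn: "hn n p = indicator (A n) (fst p) * h p" for n p
  proof -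
    have "(\<Sum>y\<in>A n. indicator {y} (fst p) * h p) = (\<Sum>y\<in>A n. if y = fst p then h p else 0)"
      by (intro sum.cong) (auto simp: indicator_def)
    then show ?thesis unfolding hn_def using fin by (simp add: sum.delta indicator_def)
  qed
  have ihn: "ito (hn n) (\<lambda>\<omega>. \<Sum>y\<in>A n. I y \<omega>)" for n
    unfolding hn_def using ito_sum[of "A n", OF I] by (simp add: case_prod_beta')
  have tK: "(\<lambda>n. L2_norm K (\<lambda>p. hn n p - h p)) \<longlonglongrightarrow> 0"
  proof (rule L2_norm_dominated_convergence[OF h])
    show "(\<lambda>p. hn n p - h p) \<in> borel_measurable K" for n
      using sq_integrable_measurable[OF ito_sq_integrable(1)[OF ihn]] sq_integrable_measurable[OF h]
      by (rule borel_measurable_diff)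
    show "\<bar>hn n p - h p\<bar> \<le> \<bar>h p\<bar>" for n p by (auto simp: hn indicator_def)
    fix p
    have "\<forall>\<^sub>F n in sequentially. hn n p - h p = 0"
      using eventually_gt_at_top[of "to_nat (fst p)"] by eventually_elim (auto simp: hn A_def)
    then show "(\<lambda>n. hn n p - h p) \<longlonglongrightarrow> 0" by (rule tendsto_eventually)
  qed
  have Sm: "S \<in> borel_measurable M" using S by (simp add: has_L2_sum_def)
  have "(\<lambda>n. \<integral>\<^sup>+\<omega>. ennreal (((\<Sum>y\<in>A n. I y \<omega>) - S \<omega>)\<^sup>2) \<partial>M) \<longlonglongrightarrow> 0"
    using filterlim_compose[OF conjunct2[OF S[unfolded has_L2_sum_def]] filterlim_to_nat_lessThan]
    by (simp add: A_def)
  note tM = L2_norm_tendsto_0I[OF this borel_measurable_diff[OF sq_integrable_measurable[OF ito_sq_integrable(2)[OF ihn]] Sm]]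
  have sM: "sq_integrable M S"
  proof -
    from eventually_happens'[OF sequentially_bot tM(2)]
    obtain k where "sq_integrable M (\<lambda>\<omega>. (\<Sum>y\<in>A k. I y \<omega>) - S \<omega>)" by blast
    from sq_integrable_diff[OF ito_sq_integrable(2)[OF ihn[of k]] this] show ?thesis by simp
  qed
  show ?thesis
  proof (rule ito_limit[OF h sM])
    fix \<epsilon> :: real assume "0 < \<epsilon>"
    from eventually_happens'[OF sequentially_bot eventually_conj[OF order_tendstoD(2)[OF tK this] order_tendstoD(2)[OF tM(1) this]]]
    show "\<exists>g J. ito g J \<and> L2_norm K (\<lambda>p. g p - h p) < \<epsilon> \<and> L2_norm M (\<lambda>\<omega>. J \<omega> - S \<omega>) < \<epsilon>"
      using ihn by blast
  qed
qed

end

section \<open>The random walk kernel\<close>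

definition conv_pmf :: "'a::plus pmf \<Rightarrow> 'a pmf \<Rightarrow> 'a pmf" where
  "conv_pmf P Q = bind_pmf P (\<lambda>x. map_pmf (\<lambda>y. x + y) Q)"

lemma conv_pmf_assoc:
  fixes P :: "'a::semigroup_add pmf"
  shows "conv_pmf (conv_pmf P Q) R = conv_pmf P (conv_pmf Q R)"
proof -
  have "(+) (x + y) = (\<lambda>z. x + (y + z))" for x y :: 'a
    by (simp add: fun_eq_iff add.assoc)
  then show ?thesis
    by (simp add: conv_pmf_def bind_assoc_pmf bind_map_pmf map_bind_pmf map_pmf_comp)
qed

lemma conv_pmf_zero [simp]:
  fixes P :: "'a::monoid_add pmf"
  shows "conv_pmf P (return_pmf 0) = P" "conv_pmf (return_pmf 0) P = P"
proof -
  have "(+) (0 :: 'a) = (\<lambda>x. x)" by (simp add: fun_eq_iff)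
  then show "conv_pmf P (return_pmf 0) = P" "conv_pmf (return_pmf 0) P = P"
    by (simp_all add: conv_pmf_def bind_return_pmf bind_return_pmf' pmf.map_ident)
qed

lemma pmf_conv:
  fixes P :: "'a::{countable, ab_group_add} pmf"
  shows "ennreal (pmf (conv_pmf P Q) x) = (\<integral>\<^sup>+y. ennreal (pmf P y) * ennreal (pmf Q (x - y)) \<partial>count_space UNIV)"
proof -
  have "pmf (map_pmf (\<lambda>z. y + z) Q) x = pmf Q (x - y)" for y
    using pmf_map_inj'[of "\<lambda>z. y + z" Q "x - y"] by (simp add: inj_on_def)
  then show ?thesis
    by (simp add: conv_pmf_def ennreal_pmf_bind nn_integral_measure_pmf)
qed

text \<open>The binomial theorem, once both sides are multiples of
  \<open>exp (- (s + t)) / fact n\<close>.\<close>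

lemma conv_poisson:
  assumes "0 < s" "0 < t"
  shows "conv_pmf (poisson_pmf s) (poisson_pmf t) = poisson_pmf (s + t)"
proof (rule pmf_eqI)
  fix n :: nat
  have mp: "pmf (map_pmf (\<lambda>z. k + z) (poisson_pmf t)) n = (if k \<le> n then pmf (poisson_pmf t) (n - k) else 0)" for k
  proof (cases "k \<le> n")
    case True
    then show ?thesis using pmf_map_inj'[of "\<lambda>z. k + z" "poisson_pmf t" "n - k"] by (simp add: inj_on_def)
  next
    case False
    then have "n \<notin> (\<lambda>z. k + z) ` set_pmf (poisson_pmf t)" by auto
    then show ?thesis using False by (simp add: pmf_map_outside)
  qed
  have "pmf (conv_pmf (poisson_pmf s) (poisson_pmf t)) n =
      (\<integral>k. (if k \<le> n then pmf (poisson_pmf t) (n - k) else 0) \<partial>measure_pmf (poisson_pmf s))"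
    by (simp add: conv_pmf_def pmf_bind mp)
  also have "\<dots> = (\<Sum>k\<le>n. pmf (poisson_pmf s) k * (if k \<le> n then pmf (poisson_pmf t) (n - k) else 0))"
    by (subst integral_measure_pmf[of "{..n}"]) (auto split: if_splits)
  also have "\<dots> = (\<Sum>k\<le>n. exp (- (s + t)) / fact n * (of_nat (n choose k) * s ^ k * t ^ (n - k)))"
  proof (rule sum.cong)
    fix k assume k: "k \<in> {..n}"
    then have "real (n choose k) = fact n / (fact k * fact (n - k))" by (simp add: binomial_fact)
    moreover have "exp (- (s + t)) = exp (- s) * exp (- t)" by (simp add: exp_add[symmetric])
    ultimately show "pmf (poisson_pmf s) k * (if k \<le> n then pmf (poisson_pmf t) (n - k) else 0) =
      exp (- (s + t)) / fact n * (of_nat (n choose k) * s ^ k * t ^ (n - k))"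
      using assms k by simp
  qed simp
  also have "\<dots> = exp (- (s + t)) / fact n * (s + t) ^ n"
    by (simp only: sum_distrib_left binomial_ring)
  also have "\<dots> = pmf (poisson_pmf (s + t)) n" using assms by simp
  finally show "pmf (conv_pmf (poisson_pmf s) (poisson_pmf t)) n = pmf (poisson_pmf (s + t)) n" .
qed

fun walk_step_pmf :: "'a::monoid_add pmf \<Rightarrow> nat \<Rightarrow> 'a pmf" where
  "walk_step_pmf \<mu> 0 = return_pmf 0"
| "walk_step_pmf \<mu> (Suc n) = conv_pmf (walk_step_pmf \<mu> n) \<mu>"

lemma walk_step_pmf_add: "walk_step_pmf \<mu> (n + m) = conv_pmf (walk_step_pmf \<mu> n) (walk_step_pmf \<mu> m)"
  by (induction m) (auto simp: conv_pmf_assoc)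

text \<open>The compound Poisson law. The Poisson law is used at positive rates only; all other
  times get the point mass at the origin, so that the family is defined on the whole line.\<close>

definition walk_pmf :: "'a::monoid_add pmf \<Rightarrow> real \<Rightarrow> 'a pmf" where
  "walk_pmf \<mu> t = (if 0 < t then bind_pmf (poisson_pmf t) (walk_step_pmf \<mu>) else return_pmf 0)"

text \<open>Both jump counts are drawn before any step. This exchange of independent draws leaves
  \<open>n + m\<close> steps, and the sum of the counts is again Poisson.\<close>

lemma walk_pmf_semigroup:
  assumes "0 \<le> s" "0 \<le> t"
  shows "walk_pmf \<mu> (s + t) = conv_pmf (walk_pmf \<mu> s) (walk_pmf \<mu> t)"
proof (cases "s = 0 \<or> t = 0")
  case True
  then show ?thesis by (auto simp: walk_pmf_def)
next
  case False
  then have st: "0 < s" "0 < t" using assms by auto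
  have "conv_pmf (walk_pmf \<mu> s) (walk_pmf \<mu> t) =
      bind_pmf (poisson_pmf s) (\<lambda>n. bind_pmf (walk_step_pmf \<mu> n) (\<lambda>x. bind_pmf (poisson_pmf t) (\<lambda>m. map_pmf (\<lambda>y. x + y) (walk_step_pmf \<mu> m))))"
    using st by (simp add: walk_pmf_def conv_pmf_def bind_assoc_pmf map_bind_pmf)
  also have "\<dots> = bind_pmf (poisson_pmf s) (\<lambda>n. bind_pmf (poisson_pmf t) (\<lambda>m. walk_step_pmf \<mu> (n + m)))"
    by (subst bind_commute_pmf) (simp add: walk_step_pmf_add conv_pmf_def)
  also have "\<dots> = bind_pmf (conv_pmf (poisson_pmf s) (poisson_pmf t)) (walk_step_pmf \<mu>)"
    by (simp add: conv_pmf_def bind_assoc_pmf bind_map_pmf)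
  finally show ?thesis using st by (simp add: walk_pmf_def conv_poisson)
qed

text \<open>A mixture formula explicit in \<open>t\<close>: measurability in time and the lower
  bound at the origin are read off from it.\<close>

lemma pmf_walk_sums:
  fixes \<mu> :: "'a::monoid_add pmf"
  assumes "0 \<le> t"
  shows "ennreal (pmf (walk_pmf \<mu> t) x) =
    (\<Sum>n. ennreal (t ^ n / fact n * exp (- t)) * ennreal (pmf (walk_step_pmf \<mu> n) x))"
proof (cases "t = 0")
  case True
  \<comment> \<open>At \<open>t = 0\<close> only the term without jumps is left, because
    \<open>0 ^ 0 = 1\<close>.\<close>
  then have "(\<lambda>n. ennreal (t ^ n / fact n * exp (- t)) * ennreal (pmf (walk_step_pmf \<mu> n) x)) =
    (\<lambda>n. if n = 0 then ennreal (pmf (return_pmf 0) x) else 0)"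
    by (auto simp: fun_eq_iff)
  moreover have "(\<Sum>n. if n = (0::nat) then c else 0) = c" for c :: ennreal
    by (subst suminf_finite[of "{0}"]) auto
  ultimately show ?thesis using True by (simp only: walk_pmf_def) simp
next
  case False
  then have "0 < t" using assms by simp
  then show ?thesis
    by (simp add: walk_pmf_def ennreal_pmf_bind nn_integral_measure_pmf nn_integral_count_space_nat)
qed

lemma pmf_walk_measurable:
  "(\<lambda>t. pmf (walk_pmf \<mu> t) x) \<in> borel_measurable borel"
proof -
  let ?h = "\<lambda>t. if 0 \<le> t then (\<Sum>n. ennreal (t ^ n / fact n * exp (- t)) * ennreal (pmf (walk_step_pmf \<mu> n) x)) else ennreal (pmf (return_pmf 0) x)"
  have "?h \<in> borel_measurable borel" by measurable
  also have "?h = (\<lambda>t. ennreal (pmf (walk_pmf \<mu> t) x))"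
  proof
    fix t
    show "?h t = ennreal (pmf (walk_pmf \<mu> t) x)"
      by (cases "0 \<le> t") (simp_all only: pmf_walk_sums if_True if_False, simp add: walk_pmf_def)
  qed
  finally have "(\<lambda>t. enn2real (ennreal (pmf (walk_pmf \<mu> t) x))) \<in> borel_measurable borel"
    by (rule borel_measurable_enn2real)
  then show ?thesis by simp
qed

text \<open>\<open>exp (- t)\<close> is the probability of no jump up to time \<open>t\<close>;
  returns to the origin can only add to it.\<close>

lemma pmf_walk_stay:
  assumes "0 \<le> t"
  shows "exp (- t) \<le> pmf (walk_pmf \<mu> t) 0"
proof -
  let ?f = "\<lambda>n. ennreal (t ^ n / fact n * exp (- t)) * ennreal (pmf (walk_step_pmf \<mu> n) 0)"
  have "?f 0 \<le> (\<Sum>n. ?f n)"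
    using sum_le_suminf[of ?f "{0}"] by simp
  then have "ennreal (exp (- t)) \<le> ennreal (pmf (walk_pmf \<mu> t) 0)"
    by (simp add: pmf_walk_sums[OF assms])
  then show ?thesis by (simp add: ennreal_le_iff)
qed

lemma pair_vimage_times: "(\<lambda>\<omega>. (f \<omega>, g \<omega>)) -` (A \<times> B) = f -` A \<inter> g -` B"
  by auto

section \<open>The law of the walk and the collision probability\<close>

context
  fixes W :: "'v measure" and N :: "real \<Rightarrow> 'v \<Rightarrow> nat" and Z :: "nat \<Rightarrow> 'v \<Rightarrow> int ^ 'd::finite"
    and X :: "real \<Rightarrow> 'v \<Rightarrow> int ^ 'd"
  assumes W: "prob_space W" and walk: "ct_random_walk W N Z X"
begin

interpretation prob_space W by (rule W)

lemma Z_measurable: "1 \<le> j \<Longrightarrow> Z j \<in> measurable W (count_space UNIV)"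
  using walk by (auto simp: ct_random_walk_def indep_vars_def)

lemma N_measurable: "0 \<le> t \<Longrightarrow> N t \<in> measurable W (count_space UNIV)"
  using walk by (auto simp: ct_random_walk_def rate_one_poisson_process_def)

lemma N_distribution:
  assumes "0 \<le> t"
  shows "measure W {\<omega>\<in>space W. N t \<omega> = n} = t ^ n / fact n * exp (- t)"
proof -
  have pp: "rate_one_poisson_process W N" using walk by (simp add: ct_random_walk_def)
  then have N0: "AE \<omega> in W. N 0 \<omega> = 0" by (simp add: rate_one_poisson_process_def)
  have [measurable]: "N t \<in> measurable W (count_space UNIV)" "N 0 \<in> measurable W (count_space UNIV)"
    using N_measurable assms by auto
  have "measure W {\<omega>\<in>space W. N t \<omega> = n} = measure W {\<omega>\<in>space W. N t \<omega> - N 0 \<omega> = n}"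
    using N0 by (intro measure_eq_AE) (auto elim: eventually_mono)
  also have "\<dots> = t ^ n / fact n * exp (- t)"
  proof (cases "t = 0")
    case True
    then show ?thesis by (cases n) (auto simp: prob_space)
  next
    case False
    then have t: "0 < t" using assms by simp
    have "\<forall>s t. 0 \<le> s \<and> s < t \<longrightarrow>
        distr W (count_space UNIV) (\<lambda>\<omega>. N t \<omega> - N s \<omega>) = measure_pmf (poisson_pmf (t - s))"
      using pp unfolding rate_one_poisson_process_def by (elim conjE)
    from this[rule_format, of 0 t] t
    have d: "distr W (count_space UNIV) (\<lambda>\<omega>. N t \<omega> - N 0 \<omega>) = measure_pmf (poisson_pmf t)"
      by simp
    have "measure W {\<omega>\<in>space W. N t \<omega> - N 0 \<omega> = n} = measure (distr W (count_space UNIV) (\<lambda>\<omega>. N t \<omega> - N 0 \<omega>)) {n}"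
      by (subst measure_distr) (auto intro!: arg_cong[where f="measure W"])
    also have "\<dots> = t ^ n / fact n * exp (- t)" unfolding d using t by (simp add: measure_pmf_single)
    finally show ?thesis .
  qed
  finally show ?thesis .
qed

text \<open>Point masses describe the law because the lattice is countable, and identical
  distribution lets one law serve all jumps.\<close>

lemma jump_pmf_exists: "\<exists>\<mu>. \<forall>z. \<forall>j\<ge>1. measure W {\<omega>\<in>space W. Z j \<omega> = z} = pmf \<mu> z"
proof -
  note [measurable] = Z_measurable[of 1, simplified]
  let ?f = "\<lambda>z. measure W {\<omega>\<in>space W. Z 1 \<omega> = z}"
  have "(\<integral>\<^sup>+z. ennreal (?f z) \<partial>count_space UNIV) = (\<integral>\<^sup>+z. emeasure W {\<omega>\<in>space W. Z 1 \<omega> = z} \<partial>count_space UNIV)"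
    by (simp add: emeasure_eq_measure)
  also have "\<dots> = emeasure W (\<Union>z. {\<omega>\<in>space W. Z 1 \<omega> = z})"
    by (subst emeasure_UN_countable) (auto simp: disjoint_family_on_def)
  also have "(\<Union>z. {\<omega>\<in>space W. Z 1 \<omega> = z}) = space W" by auto
  finally have "(\<integral>\<^sup>+z. ennreal (?f z) \<partial>count_space UNIV) = 1" by (simp add: emeasure_space_1)
  then have p: "pmf (embed_pmf ?f) z = ?f z" for z by (intro pmf_embed_pmf) auto
  have law: "measure (distr W (count_space UNIV) (Z j)) {z} = measure W {\<omega>\<in>space W. Z j \<omega> = z}"
    if "1 \<le> j" for j z
    by (subst measure_distr[OF Z_measurable[OF that]]) (auto intro!: arg_cong[where f="measure W"])
  have "measure W {\<omega>\<in>space W. Z j \<omega> = z} = ?f z" if "1 \<le> j" for j z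
  proof -
    have "\<forall>j\<ge>1. distr W (count_space UNIV) (Z j) = distr W (count_space UNIV) (Z 1)"
      using walk unfolding ct_random_walk_def by (elim conjE)
    from arg_cong[OF this[rule_format, OF that], of "\<lambda>D. measure D {z}"] show ?thesis
      unfolding law[OF that] law[OF order_refl] .
  qed
  then have "\<forall>z. \<forall>j\<ge>1. measure W {\<omega>\<in>space W. Z j \<omega> = z} = pmf (embed_pmf ?f) z"
    unfolding p by blast
  then show ?thesis by (rule exI)
qed

lemma partial_sum_event:
  fixes T :: "nat set"
  assumes "{1..n} \<subseteq> T"
  shows "{f\<in>space (PiM T (\<lambda>_. count_space UNIV)). (\<Sum>j=1..n. f j) = (x :: int ^ 'd)} \<in> sets (PiM T (\<lambda>_. count_space UNIV))"
  using assms
proof (induction n arbitrary: x)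
  case 0
  then show ?case by (cases "x = 0") auto
next
  case (Suc n)
  have eq: "{f\<in>space (PiM T (\<lambda>_. count_space UNIV)). (\<Sum>j=1..Suc n. f j) = x} =
    (\<Union>y. {f\<in>space (PiM T (\<lambda>_. count_space UNIV)). (\<Sum>j=1..n. f j) = y} \<inter>
      ((\<lambda>f. f (Suc n)) -` {x - y} \<inter> space (PiM T (\<lambda>_. count_space UNIV))))"
    by (auto simp: algebra_simps)
  have "(\<lambda>f. f (Suc n)) -` {x - y} \<inter> space (PiM T (\<lambda>_. count_space UNIV)) \<in> sets (PiM T (\<lambda>_. count_space UNIV))" for y
    using Suc.prems by (intro measurable_sets[OF measurable_component_singleton[of "Suc n" T "\<lambda>_. count_space UNIV"]]) auto
  moreover have "{f\<in>space (PiM T (\<lambda>_. count_space UNIV)). (\<Sum>j=1..n. f j) = y} \<in> sets (PiM T (\<lambda>_. count_space UNIV))" for y :: "int ^ 'd"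
    by (rule Suc.IH) (use Suc.prems in auto)
  ultimately show ?case unfolding eq by (intro sets.countable_UN' sets.Int) auto
qed

text \<open>Induction on the number of jumps: the last jump is independent of the earlier ones, so
  splitting by the value \<open>y\<close> of the previous partial sum produces a
  convolution.\<close>

lemma partial_sum_law:
  assumes \<mu>: "\<And>z j. 1 \<le> j \<Longrightarrow> measure W {\<omega>\<in>space W. Z j \<omega> = z} = pmf \<mu> z"
  shows "{\<omega>\<in>space W. (\<Sum>j=1..n. Z j \<omega>) = x} \<in> sets W"
    and "measure W {\<omega>\<in>space W. (\<Sum>j=1..n. Z j \<omega>) = x} = pmf (walk_step_pmf \<mu> n) x"
proof -
  have "{\<omega>\<in>space W. (\<Sum>j=1..n. Z j \<omega>) = x} \<in> sets W \<and>
    measure W {\<omega>\<in>space W. (\<Sum>j=1..n. Z j \<omega>) = x} = pmf (walk_step_pmf \<mu> n) x"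
  proof (induction n arbitrary: x)
    case 0
    have "{\<omega>\<in>space W. (\<Sum>j=1..0. Z j \<omega>) = x} = (if x = 0 then space W else {})" by auto
    then show ?case by (auto simp: prob_space indicator_def)
  next
    case (Suc n)
    let ?C = "\<lambda>_::nat. count_space (UNIV :: (int ^ 'd) set)"
    have "indep_vars ?C Z {1..}" using walk by (simp add: ct_random_walk_def)
    then have ind: "indep_var (PiM {1..n} ?C) (\<lambda>\<omega>. restrict (\<lambda>j. Z j \<omega>) {1..n})
        (PiM {Suc n} ?C) (\<lambda>\<omega>. restrict (\<lambda>j. Z j \<omega>) {Suc n})"
      by (rule indep_var_restrict) auto
    let ?E = "\<lambda>y. {\<omega>\<in>space W. (\<Sum>j=1..n. Z j \<omega>) = y}" and ?D = "\<lambda>z. {\<omega>\<in>space W. Z (Suc n) \<omega> = z}"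
    have Dm: "?D z \<in> sets W" for z
      using measurable_sets[OF Z_measurable[of "Suc n"], of "{z}"] by (simp add: vimage_def Int_def conj_commute)
    have prod: "prob (?E y \<inter> ?D z) = prob (?E y) * prob (?D z)" for y z
    proof -
      let ?S1 = "{f\<in>space (PiM {1..n} ?C). (\<Sum>j=1..n. f j) = y}"
      let ?S2 = "(\<lambda>f. f (Suc n)) -` {z} \<inter> space (PiM {Suc n} ?C)"
      have S1: "?S1 \<in> sets (PiM {1..n} ?C)" by (rule partial_sum_event) simp
      have S2: "?S2 \<in> sets (PiM {Suc n} ?C)"
        by (intro measurable_sets[OF measurable_component_singleton[of "Suc n" "{Suc n}" ?C]]) auto
      have e1: "(\<lambda>\<omega>. restrict (\<lambda>j. Z j \<omega>) {1..n}) -` ?S1 \<inter> space W = ?E y"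
        by (auto simp: space_PiM)
      have e2: "(\<lambda>\<omega>. restrict (\<lambda>j. Z j \<omega>) {Suc n}) -` ?S2 \<inter> space W = ?D z"
      proof -
        have "restrict (\<lambda>j. Z j \<omega>) {Suc n} \<in> space (PiM {Suc n} ?C)" for \<omega>
          unfolding space_PiM restrict_PiE_iff by simp
        moreover have "restrict (\<lambda>j. Z j \<omega>) {Suc n} (Suc n) = Z (Suc n) \<omega>" for \<omega> by simp
        ultimately show ?thesis
          by (simp only: set_eq_iff vimage_eq Int_iff mem_Collect_eq singleton_iff simp_thms) blast
      qed
      have "(\<lambda>\<omega>. (restrict (\<lambda>j. Z j \<omega>) {1..n}, restrict (\<lambda>j. Z j \<omega>) {Suc n})) -` (?S1 \<times> ?S2) \<inter> space W = ?E y \<inter> ?D z"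
        unfolding e1[symmetric] e2[symmetric] pair_vimage_times Int_assoc[symmetric]
        by (simp only: Int_ac Int_absorb Int_left_absorb)
      then show ?thesis using indep_varD[OF ind S1 S2] unfolding e1 e2 by simp
    qed
    have eq: "{\<omega>\<in>space W. (\<Sum>j=1..Suc n. Z j \<omega>) = x} = (\<Union>y. ?E y \<inter> ?D (x - y))"
      by (auto simp: algebra_simps)
    have ev: "?E y \<inter> ?D (x - y) \<in> sets W" for y using Suc.IH[of y] Dm by (intro sets.Int) auto
    have "emeasure W (\<Union>y. ?E y \<inter> ?D (x - y)) = (\<integral>\<^sup>+y. emeasure W (?E y \<inter> ?D (x - y)) \<partial>count_space UNIV)"
      using ev by (intro emeasure_UN_countable) (auto simp: disjoint_family_on_def)
    also have "\<dots> = (\<integral>\<^sup>+y. ennreal (pmf (walk_step_pmf \<mu> n) y) * ennreal (pmf \<mu> (x - y)) \<partial>count_space UNIV)"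
      using prod Suc.IH \<mu>[of "Suc n"] by (simp add: emeasure_eq_measure ennreal_mult)
    also have "\<dots> = ennreal (pmf (walk_step_pmf \<mu> (Suc n)) x)" by (simp add: pmf_conv)
    finally have "prob (\<Union>y. ?E y \<inter> ?D (x - y)) = pmf (walk_step_pmf \<mu> (Suc n)) x"
      by (simp add: emeasure_eq_measure)
    moreover have "(\<Union>y. ?E y \<inter> ?D (x - y)) \<in> sets W" using ev by (intro sets.countable_UN') auto
    ultimately show ?case unfolding eq by blast
  qed
  then show "{\<omega>\<in>space W. (\<Sum>j=1..n. Z j \<omega>) = x} \<in> sets W"
    "measure W {\<omega>\<in>space W. (\<Sum>j=1..n. Z j \<omega>) = x} = pmf (walk_step_pmf \<mu> n) x" by auto
qed

text \<open>Splitting by the number of jumps: on \<open>N t = n\<close> the position is the sum of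
  the first \<open>n\<close> jumps, which is independent of the clock \<open>N\<close>. The result
  is the mixture series of \<open>walk_pmf\<close>.\<close>

lemma walk_law:
  assumes \<mu>: "\<And>z j. 1 \<le> j \<Longrightarrow> measure W {\<omega>\<in>space W. Z j \<omega> = z} = pmf \<mu> z" and t: "0 \<le> t"
  shows "walk_prob W X t x = pmf (walk_pmf \<mu> t) x"
proof -
  have Xeq: "\<And>\<omega>. \<omega> \<in> space W \<Longrightarrow> X t \<omega> = (\<Sum>j = 1..N t \<omega>. Z j \<omega>)"
    and ie: "indep_elements W
       (PiM {0..} (\<lambda>_. count_space UNIV)) (\<lambda>\<omega>. \<lambda>t\<in>{0..}. N t \<omega>)
       (PiM {1..} (\<lambda>_. count_space UNIV)) (\<lambda>\<omega>. \<lambda>j\<in>{1..}. Z j \<omega>)"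
    using walk t by (auto simp: ct_random_walk_def)
  let ?PN = "PiM {0..} (\<lambda>_. count_space UNIV) :: (real \<Rightarrow> nat) measure"
  let ?PZ = "PiM {1..} (\<lambda>_. count_space UNIV) :: (nat \<Rightarrow> int ^ 'd) measure"
  let ?E = "\<lambda>n. {\<omega>\<in>space W. N t \<omega> = n}" and ?D = "\<lambda>n. {\<omega>\<in>space W. (\<Sum>j=1..n. Z j \<omega>) = x}"
  have Em: "?E n \<in> sets W" for n
    using measurable_sets[OF N_measurable[OF t], of "{n}"] by (simp add: vimage_def Int_def conj_commute)
  have Dm: "?D n \<in> sets W" for n by (rule partial_sum_law(1)) (rule \<mu>)
  have D: "prob (?D n) = pmf (walk_step_pmf \<mu> n) x" for n by (rule partial_sum_law(2)) (rule \<mu>)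
  have prod: "prob (?E n \<inter> ?D n) = prob (?E n) * prob (?D n)" for n
  proof (rule indep_setD[OF conjunct2[OF conjunct2[OF ie[unfolded indep_elements_def]]]])
    let ?S1 = "(\<lambda>f. f t) -` {n} \<inter> space ?PN"
    have "?S1 \<in> sets ?PN"
      using t by (intro measurable_sets[OF measurable_component_singleton[of t "{0..}" "\<lambda>_. count_space UNIV"]]) auto
    moreover have "?E n = (\<lambda>\<omega>. \<lambda>t\<in>{0..}. N t \<omega>) -` ?S1 \<inter> space W"
      using t by (auto simp: space_PiM)
    ultimately show "?E n \<in> {(\<lambda>\<omega>. \<lambda>t\<in>{0..}. N t \<omega>) -` A \<inter> space W | A. A \<in> sets ?PN}" by blast
    let ?S2 = "{f\<in>space ?PZ. (\<Sum>j=1..n. f j) = x}"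
    have "?S2 \<in> sets ?PZ" by (rule partial_sum_event) auto
    moreover have "?D n = (\<lambda>\<omega>. \<lambda>j\<in>{1..}. Z j \<omega>) -` ?S2 \<inter> space W"
      by (auto simp: space_PiM)
    ultimately show "?D n \<in> {(\<lambda>\<omega>. \<lambda>j\<in>{1..}. Z j \<omega>) -` A \<inter> space W | A. A \<in> sets ?PZ}" by blast
  qed
  have em: "emeasure W (?E n \<inter> ?D n) = ennreal (t ^ n / fact n * exp (- t)) * ennreal (pmf (walk_step_pmf \<mu> n) x)" for n
    unfolding emeasure_eq_measure prod N_distribution[OF t] D
    using t by (intro ennreal_mult) auto
  have eq: "{\<omega>\<in>space W. X t \<omega> = x} = (\<Union>n. ?E n \<inter> ?D n)" using Xeq by auto
  have "emeasure W (\<Union>n. ?E n \<inter> ?D n) = (\<integral>\<^sup>+n. emeasure W (?E n \<inter> ?D n) \<partial>count_space UNIV)"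
    using Em Dm by (intro emeasure_UN_countable) (auto simp: disjoint_family_on_def)
  also have "\<dots> = (\<integral>\<^sup>+n. ennreal (t ^ n / fact n * exp (- t)) * ennreal (pmf (walk_step_pmf \<mu> n) x) \<partial>count_space UNIV)"
    unfolding em ..
  also have "\<dots> = ennreal (pmf (walk_pmf \<mu> t) x)"
    by (simp only: pmf_walk_sums[OF t] nn_integral_count_space_nat)
  finally show ?thesis unfolding walk_prob_def eq by (simp add: emeasure_eq_measure)
qed

text \<open>Splitting by the meeting point, where independence and equal laws produce a square. This
  identifies the spatial mass of the squared kernel with the collision probability, hence its total
  mass with \<open>Upsilon0\<close>.\<close>

lemma collision_prob_sum:
  assumes copy: "independent_copy W X X'" and t: "0 \<le> t"
  shows "ennreal (collision_prob W X X' t) = (\<integral>\<^sup>+x. ennreal ((walk_prob W X t x)\<^sup>2) \<partial>count_space UNIV)"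
proof -
  let ?P = "PiM {0..} (\<lambda>_. count_space UNIV) :: (real \<Rightarrow> int ^ 'd) measure"
  let ?path = "\<lambda>Y \<omega>. \<lambda>t\<in>{0..}. (Y t \<omega> :: int ^ 'd)"
  have ie: "indep_elements W ?P (?path X) ?P (?path X')" and law: "distr W ?P (?path X') = distr W ?P (?path X)"
    using copy by (auto simp: independent_copy_def Let_def)
  note m = ie[unfolded indep_elements_def, THEN conjunct1] ie[unfolded indep_elements_def, THEN conjunct2, THEN conjunct1]
  let ?S = "\<lambda>x. (\<lambda>f. f t) -` {x} \<inter> space ?P"
  have S: "?S x \<in> sets ?P" for x
    using t by (intro measurable_sets[OF measurable_component_singleton[of t "{0..}" "\<lambda>_. count_space UNIV"]]) auto
  have eq: "{\<omega>\<in>space W. Y t \<omega> = x} = ?path Y -` ?S x \<inter> space W" for x Y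
    using t by (auto simp: space_PiM)
  have ev: "{\<omega>\<in>space W. X t \<omega> = x} \<in> sets W" "{\<omega>\<in>space W. X' t \<omega> = x} \<in> sets W" for x
    unfolding eq by (rule measurable_sets[OF m(1) S], rule measurable_sets[OF m(2) S])
  have same: "prob {\<omega>\<in>space W. X' t \<omega> = x} = prob {\<omega>\<in>space W. X t \<omega> = x}" for x
    using trans[OF measure_distr[OF m(2) S, symmetric] measure_distr[OF m(1) S, folded law]]
    unfolding eq .
  have prod: "prob ({\<omega>\<in>space W. X t \<omega> = x} \<inter> {\<omega>\<in>space W. X' t \<omega> = x}) = (walk_prob W X t x)\<^sup>2" for x
  proof -
    have "prob ({\<omega>\<in>space W. X t \<omega> = x} \<inter> {\<omega>\<in>space W. X' t \<omega> = x}) =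
        prob {\<omega>\<in>space W. X t \<omega> = x} * prob {\<omega>\<in>space W. X' t \<omega> = x}"
      by (rule indep_setD[OF conjunct2[OF conjunct2[OF ie[unfolded indep_elements_def]]]])
        (unfold eq, (rule CollectI, rule exI, rule conjI[OF refl S])+)
    then show ?thesis by (simp add: same walk_prob_def power2_eq_square)
  qed
  have "{\<omega>\<in>space W. X t \<omega> = X' t \<omega>} = (\<Union>x. {\<omega>\<in>space W. X t \<omega> = x} \<inter> {\<omega>\<in>space W. X' t \<omega> = x})" by auto
  moreover have "emeasure W (\<Union>x. {\<omega>\<in>space W. X t \<omega> = x} \<inter> {\<omega>\<in>space W. X' t \<omega> = x}) =
     (\<integral>\<^sup>+x. emeasure W ({\<omega>\<in>space W. X t \<omega> = x} \<inter> {\<omega>\<in>space W. X' t \<omega> = x}) \<partial>count_space UNIV)"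
    using ev by (intro emeasure_UN_countable) (auto simp: disjoint_family_on_def)
  ultimately show ?thesis
    by (simp add: collision_prob_def emeasure_eq_measure prod)
qed

end

section \<open>Sums over a countable type\<close>

lemma has_sum_imp_tendsto_to_nat:
  fixes f :: "'i::countable \<Rightarrow> 'b::{comm_monoid_add, topological_space}"
  shows "(f has_sum s) UNIV \<Longrightarrow> (\<lambda>n. \<Sum>x | to_nat x < n. f x) \<longlonglongrightarrow> s"
  unfolding has_sum_def by (rule filterlim_compose[OF _ filterlim_to_nat_lessThan])

text \<open>Expresses sums over a countable type as suprema of finite sums along the enumeration,
  which makes measurability in a parameter immediate.\<close>

lemma nn_integral_count_eq_SUP:
  fixes g :: "'i::countable \<Rightarrow> ennreal"
  shows "(\<integral>\<^sup>+x. g x \<partial>count_space UNIV) = (SUP n. \<Sum>x | to_nat x < n. g x)"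
    and "incseq (\<lambda>n. \<Sum>x | to_nat x < n. g x)"
proof -
  let ?A = "\<lambda>n. {x::'i. to_nat x < n}"
  have s: "(\<Sum>x\<in>?A n. g x) = (\<integral>\<^sup>+x. g x * indicator (?A n) x \<partial>count_space UNIV)" for n
    by (subst nn_integral_count_space'[of "?A n"])
      (auto simp: finite_to_nat_lessThan intro!: sum.cong)
  have inc: "incseq (\<lambda>n x. g x * indicator (?A n) x)"
    by (auto simp: incseq_def le_fun_def indicator_def)
  have "(SUP n. g x * indicator (?A n) x) = g x" for x
  proof (rule antisym)
    show "(SUP n. g x * indicator (?A n) x) \<le> g x"
      by (rule SUP_least) (auto simp: indicator_def)
    have "g x = g x * indicator (?A (Suc (to_nat x))) x" by simp
    also have "\<dots> \<le> (SUP n. g x * indicator (?A n) x)" by (rule SUP_upper) simp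
    finally show "g x \<le> (SUP n. g x * indicator (?A n) x)" .
  qed
  then have "(\<integral>\<^sup>+x. g x \<partial>count_space UNIV) = (\<integral>\<^sup>+x. (SUP n. g x * indicator (?A n) x) \<partial>count_space UNIV)"
    by simp
  also have "\<dots> = (SUP n. \<integral>\<^sup>+x. g x * indicator (?A n) x \<partial>count_space UNIV)"
    by (rule nn_integral_monotone_convergence_SUP[OF inc]) simp
  finally show "(\<integral>\<^sup>+x. g x \<partial>count_space UNIV) = (SUP n. \<Sum>x\<in>?A n. g x)" unfolding s .
  show "incseq (\<lambda>n. \<Sum>x\<in>?A n. g x)"
    by (intro incseq_SucI sum_mono2) (auto simp: finite_to_nat_lessThan)
qed

lemma sum_tendsto_nn_integral_count:
  fixes g :: "'i::countable \<Rightarrow> ennreal"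
  shows "(\<lambda>n. \<Sum>x | to_nat x < n. g x) \<longlonglongrightarrow> (\<integral>\<^sup>+x. g x \<partial>count_space UNIV)"
  unfolding nn_integral_count_eq_SUP(1) by (rule LIMSEQ_SUP[OF nn_integral_count_eq_SUP(2)])

lemma ennreal_infsum_eq_nn_integral:
  fixes f :: "'i::countable \<Rightarrow> real"
  assumes "f summable_on UNIV" "\<And>x. 0 \<le> f x"
  shows "ennreal (\<Sum>\<^sub>\<infinity>x. f x) = (\<integral>\<^sup>+x. ennreal (f x) \<partial>count_space UNIV)"
proof (rule LIMSEQ_unique)
  show "(\<lambda>n. \<Sum>x | to_nat x < n. ennreal (f x)) \<longlonglongrightarrow> (\<integral>\<^sup>+x. ennreal (f x) \<partial>count_space UNIV)"
    by (rule sum_tendsto_nn_integral_count)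
  have "(\<lambda>n. ennreal (\<Sum>x | to_nat x < n. f x)) \<longlonglongrightarrow> ennreal (\<Sum>\<^sub>\<infinity>x. f x)"
    by (intro tendsto_ennrealI has_sum_imp_tendsto_to_nat has_sum_infsum assms)
  then show "(\<lambda>n. \<Sum>x | to_nat x < n. ennreal (f x)) \<longlonglongrightarrow> ennreal (\<Sum>\<^sub>\<infinity>x. f x)"
    using assms by (simp add: sum_ennreal)
qed

lemma measurable_nn_integral_count:
  fixes \<phi> :: "'a \<Rightarrow> 'i::countable \<Rightarrow> ennreal"
  assumes "\<And>y. (\<lambda>t. \<phi> t y) \<in> borel_measurable N"
  shows "(\<lambda>t. \<integral>\<^sup>+y. \<phi> t y \<partial>count_space UNIV) \<in> borel_measurable N"
  unfolding nn_integral_count_eq_SUP(1) using assms by measurable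

lemma nn_integral_count_shift:
  fixes f :: "'i::ab_group_add \<Rightarrow> ennreal"
  shows "(\<integral>\<^sup>+x. f (x - y) \<partial>count_space UNIV) = (\<integral>\<^sup>+x. f x \<partial>count_space UNIV)"
    and "(\<integral>\<^sup>+x. f (y - x) \<partial>count_space UNIV) = (\<integral>\<^sup>+x. f x \<partial>count_space UNIV)"
    and "(\<integral>\<^sup>+x. f (x + y) \<partial>count_space UNIV) = (\<integral>\<^sup>+x. f x \<partial>count_space UNIV)"
proof -
  show "(\<integral>\<^sup>+x. f (x - y) \<partial>count_space UNIV) = (\<integral>\<^sup>+x. f x \<partial>count_space UNIV)"
    by (rule nn_integral_bij_count_space) (auto intro!: bij_betwI[where g="\<lambda>z. z + y"])
  show "(\<integral>\<^sup>+x. f (y - x) \<partial>count_space UNIV) = (\<integral>\<^sup>+x. f x \<partial>count_space UNIV)"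
    by (rule nn_integral_bij_count_space) (auto intro!: bij_betwI[where g="\<lambda>z. y - z"])
  show "(\<integral>\<^sup>+x. f (x + y) \<partial>count_space UNIV) = (\<integral>\<^sup>+x. f x \<partial>count_space UNIV)"
    by (rule nn_integral_bij_count_space) (auto intro!: bij_betwI[where g="\<lambda>z. z - y"])
qed

text \<open>Cauchy-Schwarz with weight \<open>w\<close>, without any finiteness: the square of the
  integral is written as a double integral, under which the product of two values of
  \<open>f\<close> is bounded by half the sum of their squares.\<close>

lemma nn_integral_weighted_square_le:
  assumes [measurable]: "f \<in> borel_measurable N" "w \<in> borel_measurable N" and f: "\<And>x. 0 \<le> f x"
  shows "(\<integral>\<^sup>+x. ennreal (f x) * w x \<partial>N)\<^sup>2 \<le> (\<integral>\<^sup>+x. w x \<partial>N) * (\<integral>\<^sup>+x. ennreal ((f x)\<^sup>2) * w x \<partial>N)"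
proof -
  let ?a = "\<integral>\<^sup>+x. ennreal (f x) * w x \<partial>N" and ?b = "\<integral>\<^sup>+x. w x \<partial>N" and ?c = "\<integral>\<^sup>+x. ennreal ((f x)\<^sup>2) * w x \<partial>N"
  have ineq: "2 * (ennreal (f y) * w y * (ennreal (f x) * w x)) \<le>
      w y * (ennreal ((f x)\<^sup>2) * w x) + ennreal ((f y)\<^sup>2) * w y * w x" for x y
  proof -
    have "2 * (ennreal (f y) * ennreal (f x)) = ennreal (2 * (f y * f x))"
      using f by (simp add: ennreal_mult)
    also have "\<dots> \<le> ennreal ((f x)\<^sup>2 + (f y)\<^sup>2)"
      using sum_squares_bound[of "f x" "f y"] by (intro ennreal_leI) (simp add: algebra_simps)
    also have "\<dots> = ennreal ((f x)\<^sup>2) + ennreal ((f y)\<^sup>2)" by simp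
    finally have "2 * (ennreal (f y) * ennreal (f x)) * (w y * w x) \<le> (ennreal ((f x)\<^sup>2) + ennreal ((f y)\<^sup>2)) * (w y * w x)"
      by (rule mult_right_mono) simp
    then show ?thesis by (simp add: algebra_simps)
  qed
  have "2 * (\<integral>\<^sup>+x. a x \<partial>N)\<^sup>2 = (\<integral>\<^sup>+y. \<integral>\<^sup>+x. 2 * (a y * a x) \<partial>N \<partial>N)"
    if [measurable]: "a \<in> borel_measurable N" for a :: "'a \<Rightarrow> ennreal"
    by (simp add: nn_integral_cmult nn_integral_multc power2_eq_square)
  from this[of "\<lambda>x. ennreal (f x) * w x"]
  have "2 * ?a\<^sup>2 = (\<integral>\<^sup>+y. \<integral>\<^sup>+x. 2 * (ennreal (f y) * w y * (ennreal (f x) * w x)) \<partial>N \<partial>N)"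
    by simp
  also have "\<dots> \<le> (\<integral>\<^sup>+y. \<integral>\<^sup>+x. w y * (ennreal ((f x)\<^sup>2) * w x) + ennreal ((f y)\<^sup>2) * w y * w x \<partial>N \<partial>N)"
    by (intro nn_integral_mono ineq)
  also have "\<dots> = 2 * (?b * ?c)"
    by (simp add: nn_integral_add nn_integral_cmult nn_integral_multc mult_2 mult.commute)
  finally show ?thesis by (simp add: ennreal_mult_le_mult_iff)
qed

section \<open>A renewal inequality\<close>

text \<open>\<open>\<kappa> t z\<close> will be the square of a transition probability. The strength
  of the kernel is measured by \<open>total_mass\<close>, which will be
  \<open>Upsilon0\<close>.\<close>

locale renewal =
  fixes \<kappa> :: "real \<Rightarrow> 'i::{countable, ab_group_add} \<Rightarrow> ennreal"
  assumes \<kappa>_measurable: "\<And>z. (\<lambda>t. \<kappa> t z) \<in> borel_measurable borel"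
begin

definition mass :: "real \<Rightarrow> ennreal" where
  "mass t = (\<integral>\<^sup>+z. \<kappa> t z \<partial>count_space UNIV)"

definition total_mass :: ennreal where
  "total_mass = (\<integral>\<^sup>+t. (if 0 \<le> t then mass t else 0) \<partial>lborel)"

definition T :: "('i \<times> real) measure" where
  "T = count_space UNIV \<Otimes>\<^sub>M lborel"

text \<open>A point \<open>(x, t)\<close> looks back to \<open>(y, r)\<close> with
  \<open>0 \<le> r \<le> t\<close>. The displacement is \<open>y - x\<close>, the orientation of the
  mild formula.\<close>

definition kernel :: "'i \<times> real \<Rightarrow> 'i \<times> real \<Rightarrow> ennreal" where
  "kernel p p' = (if 0 \<le> snd p' \<and> snd p' \<le> snd p then \<kappa> (snd p - snd p') (fst p' - fst p) else 0)"

definition Kop :: "('i \<times> real \<Rightarrow> ennreal) \<Rightarrow> 'i \<times> real \<Rightarrow> ennreal" where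
  "Kop h p = (\<integral>\<^sup>+p'. kernel p p' * h p' \<partial>T)"

lemma sets_T [measurable_cong]: "sets T = sets (count_space UNIV \<Otimes>\<^sub>M lborel)"
  by (simp add: T_def)

lemma sigma_finite_T: "sigma_finite_measure T"
  unfolding T_def
  by (intro sigma_finite_pair_measure lborel.sigma_finite_measure_axioms sigma_finite_measure_count_space_countable) simp

lemma measurable_T:
  assumes "\<And>x. (\<lambda>t. h (x, t)) \<in> borel_measurable borel"
  shows "h \<in> borel_measurable T"
  unfolding T_def using assms by (intro measurable_pair_measure_countable1) auto

lemma nn_integral_T:
  assumes "\<And>x. (\<lambda>t. h (x, t)) \<in> borel_measurable borel"
  shows "(\<integral>\<^sup>+p. h p \<partial>T) = (\<integral>\<^sup>+x. \<integral>\<^sup>+t. h (x, t) \<partial>lborel \<partial>count_space UNIV)"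
    and "(\<integral>\<^sup>+p. h p \<partial>T) = (\<integral>\<^sup>+t. \<integral>\<^sup>+x. h (x, t) \<partial>count_space UNIV \<partial>lborel)"
proof -
  show *: "(\<integral>\<^sup>+p. h p \<partial>T) = (\<integral>\<^sup>+x. \<integral>\<^sup>+t. h (x, t) \<partial>lborel \<partial>count_space UNIV)"
    using measurable_T[OF assms] unfolding T_def by (intro lborel.nn_integral_fst[symmetric])
  show "(\<integral>\<^sup>+p. h p \<partial>T) = (\<integral>\<^sup>+t. \<integral>\<^sup>+x. h (x, t) \<partial>count_space UNIV \<partial>lborel)"
    unfolding * using assms by (intro nn_integral_count_space_nn_integral[symmetric]) auto
qed

lemma kernel_measurable [measurable]: "(\<lambda>(p, p'). kernel p p') \<in> borel_measurable (T \<Otimes>\<^sub>M T)"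
proof -
  note [measurable] = \<kappa>_measurable
  have "(\<lambda>q. (\<lambda>z q. if 0 \<le> snd (snd q) \<and> snd (snd q) \<le> snd (fst q) then \<kappa> (snd (fst q) - snd (snd q)) z else 0)
      (fst (snd q) - fst (fst q)) q) \<in> borel_measurable (T \<Otimes>\<^sub>M T)"
  proof (rule measurable_compose_countable)
    show "(\<lambda>q. if 0 \<le> snd (snd q) \<and> snd (snd q) \<le> snd (fst q) then \<kappa> (snd (fst q) - snd (snd q)) z else 0)
      \<in> borel_measurable (T \<Otimes>\<^sub>M T)" for z
      by measurable
    have "(\<lambda>q. (\<lambda>a q. (\<lambda>b q. b - a) (fst (snd q)) q) (fst (fst q)) q) \<in> measurable (T \<Otimes>\<^sub>M T) (count_space UNIV)"
      by (rule measurable_compose_countable, rule measurable_compose_countable) measurable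
    then show "(\<lambda>q. fst (snd q) - fst (fst q)) \<in> measurable (T \<Otimes>\<^sub>M T) (count_space UNIV)" by simp
  qed
  then show ?thesis by (simp add: kernel_def case_prod_beta')
qed

lemma mass_measurable: "mass \<in> borel_measurable borel"
  unfolding mass_def[abs_def] by (rule measurable_nn_integral_count) (rule \<kappa>_measurable)

lemma kernel_section_measurable: "(\<lambda>t. kernel (x, t) p') \<in> borel_measurable borel"
  "(\<lambda>r. kernel p (y, r)) \<in> borel_measurable borel"
proof -
  note [measurable] = \<kappa>_measurable
  show "(\<lambda>t. kernel (x, t) p') \<in> borel_measurable borel" "(\<lambda>r. kernel p (y, r)) \<in> borel_measurable borel"
    unfolding kernel_def fst_conv snd_conv by measurable
qed

text \<open>With \<open>kernel_integral_snd\<close> this forms a Schur test: integration over the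
  later point controls \<open>Kop\<close> on integrable functions, integration over the earlier
  point controls it on constants.\<close>

lemma kernel_integral_fst: "(\<integral>\<^sup>+p. kernel p p' \<partial>T) \<le> total_mass"
proof (cases "0 \<le> snd p'")
  case True
  note [measurable] = mass_measurable
  have "(\<integral>\<^sup>+p. kernel p p' \<partial>T) = (\<integral>\<^sup>+t. \<integral>\<^sup>+x. kernel (x, t) p' \<partial>count_space UNIV \<partial>lborel)"
    by (rule nn_integral_T(2)) (rule kernel_section_measurable)
  also have "\<dots> = (\<integral>\<^sup>+t. (if 0 \<le> - snd p' + 1 * t then mass (- snd p' + 1 * t) else 0) \<partial>lborel)"
    by (intro nn_integral_cong) (simp add: kernel_def True mass_def nn_integral_count_shift)
  also have "\<dots> = total_mass"
    unfolding total_mass_def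
    by (subst (2) nn_integral_real_affine[where c=1 and t="- snd p'"]) simp_all
  finally show ?thesis by simp
qed (simp add: kernel_def)

lemma kernel_integral_snd: "(\<integral>\<^sup>+p'. kernel p p' \<partial>T) \<le> total_mass"
proof -
  note [measurable] = mass_measurable
  have "(\<integral>\<^sup>+p'. kernel p p' \<partial>T) = (\<integral>\<^sup>+r. \<integral>\<^sup>+y. kernel p (y, r) \<partial>count_space UNIV \<partial>lborel)"
    by (rule nn_integral_T(2)) (rule kernel_section_measurable)
  also have "\<dots> \<le> (\<integral>\<^sup>+r. (if 0 \<le> snd p + (-1) * r then mass (snd p + (-1) * r) else 0) \<partial>lborel)"
  proof (rule nn_integral_mono)
    fix r
    show "(\<integral>\<^sup>+y. kernel p (y, r) \<partial>count_space UNIV) \<le> (if 0 \<le> snd p + (-1) * r then mass (snd p + (-1) * r) else 0)"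
      by (cases "0 \<le> r"; cases "r \<le> snd p") (simp_all add: kernel_def mass_def nn_integral_count_shift)
  qed
  also have "\<dots> = total_mass"
    unfolding total_mass_def
    by (subst (2) nn_integral_real_affine[where c="-1" and t="snd p"]) simp_all
  finally show ?thesis .
qed

lemma Kop_measurable [measurable (raw)]: "h \<in> borel_measurable T \<Longrightarrow> Kop h \<in> borel_measurable T"
proof -
  assume [measurable]: "h \<in> borel_measurable T"
  interpret sigma_finite_measure T by (rule sigma_finite_T)
  show "Kop h \<in> borel_measurable T" unfolding Kop_def[abs_def] by measurable
qed

lemma Kop_integral_le:
  assumes [measurable]: "h \<in> borel_measurable T"
  shows "(\<integral>\<^sup>+p. Kop h p \<partial>T) \<le> total_mass * (\<integral>\<^sup>+p. h p \<partial>T)"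
proof -
  interpret sigma_finite_measure T by (rule sigma_finite_T)
  interpret pair_sigma_finite T T ..
  have "(\<integral>\<^sup>+p. Kop h p \<partial>T) = (\<integral>\<^sup>+p'. \<integral>\<^sup>+p. kernel p p' * h p' \<partial>T \<partial>T)"
    unfolding Kop_def by (rule Fubini'[symmetric]) measurable
  also have "\<dots> = (\<integral>\<^sup>+p'. (\<integral>\<^sup>+p. kernel p p' \<partial>T) * h p' \<partial>T)"
    by (intro nn_integral_cong nn_integral_multc) measurable
  also have "\<dots> \<le> (\<integral>\<^sup>+p'. total_mass * h p' \<partial>T)"
    by (intro nn_integral_mono mult_right_mono kernel_integral_fst) simp
  also have "\<dots> = total_mass * (\<integral>\<^sup>+p. h p \<partial>T)" by (rule nn_integral_cmult) measurable
  finally show ?thesis .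
qed

lemma Kop_mono:
  "(\<And>p'. 0 \<le> snd p' \<Longrightarrow> snd p' \<le> snd p \<Longrightarrow> h p' \<le> h' p') \<Longrightarrow> Kop h p \<le> Kop h' p"
  unfolding Kop_def by (intro nn_integral_mono) (auto simp: kernel_def intro: mult_left_mono)

lemma Kop_add_const_le:
  assumes [measurable]: "h \<in> borel_measurable T"
  shows "Kop (\<lambda>p. h p + C) p \<le> Kop h p + total_mass * C"
proof -
  have [measurable]: "kernel p \<in> borel_measurable T"
    by (rule measurable_T) (rule kernel_section_measurable)
  have "Kop (\<lambda>p. h p + C) p = Kop h p + (\<integral>\<^sup>+p'. kernel p p' \<partial>T) * C"
    unfolding Kop_def by (simp add: distrib_left nn_integral_add nn_integral_multc)
  also have "\<dots> \<le> Kop h p + total_mass * C"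
    by (intro add_left_mono mult_right_mono kernel_integral_snd) simp
  finally show ?thesis .
qed

text \<open>Partial sums of the Neumann series for \<open>m = f + c * Kop m\<close>, started at 0 so
  that they increase.\<close>

primrec iterate :: "ennreal \<Rightarrow> ('i \<times> real \<Rightarrow> ennreal) \<Rightarrow> nat \<Rightarrow> 'i \<times> real \<Rightarrow> ennreal" where
  "iterate c f 0 = (\<lambda>p. 0)"
| "iterate c f (Suc n) = (\<lambda>p. f p + c * Kop (iterate c f n) p)"

lemma iterate_measurable: "f \<in> borel_measurable T \<Longrightarrow> iterate c f n \<in> borel_measurable T"
  by (induction n) auto

lemma iterate_mono: "iterate c f n p \<le> iterate c f (Suc n) p"
proof (induction n arbitrary: p)
  case (Suc n)
  then have "Kop (iterate c f n) p \<le> Kop (iterate c f (Suc n)) p" by (intro Kop_mono)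
  then show ?case by (simp add: add_left_mono mult_left_mono)
qed simp

lemma iterate_integral_le:
  assumes f: "f \<in> borel_measurable T" and \<rho>: "0 \<le> \<rho>" "\<rho> < 1" "c * total_mass \<le> ennreal \<rho>"
  shows "(\<integral>\<^sup>+p. iterate c f n p \<partial>T) \<le> ennreal (1 / (1 - \<rho>)) * (\<integral>\<^sup>+p. f p \<partial>T)"
proof (induction n)
  case (Suc n)
  note [measurable] = f iterate_measurable[OF f]
  let ?J = "\<integral>\<^sup>+p. f p \<partial>T" and ?d = "ennreal (1 / (1 - \<rho>))"
  have "(\<integral>\<^sup>+p. iterate c f (Suc n) p \<partial>T) = ?J + c * (\<integral>\<^sup>+p. Kop (iterate c f n) p \<partial>T)"
    by (simp add: nn_integral_add nn_integral_cmult)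
  also have "\<dots> \<le> ?J + c * (total_mass * (\<integral>\<^sup>+p. iterate c f n p \<partial>T))"
    by (intro add_left_mono mult_left_mono Kop_integral_le) auto
  also have "\<dots> \<le> ?J + ennreal \<rho> * (?d * ?J)"
    unfolding mult.assoc[symmetric] using Suc \<rho>(3)
    by (intro add_left_mono) (metis mult.assoc mult_mono zero_le)
  \<comment> \<open>The sum of the geometric series is a fixed point:
    \<open>1 + \<rho> / (1 - \<rho>) = 1 / (1 - \<rho>)\<close>.\<close>
  also have "\<dots> = (ennreal 1 + ennreal (\<rho> * (1 / (1 - \<rho>)))) * ?J"
    using \<rho> by (simp add: distrib_right ennreal_mult[symmetric] mult.assoc[symmetric])
  also have "ennreal 1 + ennreal (\<rho> * (1 / (1 - \<rho>))) = ?d"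
    using \<rho> by (subst ennreal_plus[symmetric]) (auto simp: field_simps)
  finally show ?case .
qed simp

text \<open>Absorbing \<open>c * Kop m\<close> would presuppose that \<open>m\<close> has a finite
  integral, which is the goal. Instead \<open>m\<close> is compared with the iterates: the defect
  starts at the a priori bound \<open>C\<close> and shrinks by the factor \<open>\<rho>\<close> at
  each use of the inequality. Since \<open>Kop\<close> looks only backwards, information up to
  \<open>t0\<close> suffices, and \<open>C\<close> disappears from the result.\<close>

lemma renewal_bound:
  assumes f: "f \<in> borel_measurable T" and \<rho>: "0 \<le> \<rho>" "\<rho> < 1" "c * total_mass \<le> ennreal \<rho>"
    and bdd: "\<And>x t. 0 \<le> t \<Longrightarrow> t \<le> t0 \<Longrightarrow> m (x, t) \<le> ennreal C" and C: "0 \<le> C"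
    and ineq: "\<And>x t. 0 \<le> t \<Longrightarrow> t \<le> t0 \<Longrightarrow> m (x, t) \<le> f (x, t) + c * Kop m (x, t)"
  shows "(\<integral>\<^sup>+p. (if 0 \<le> snd p \<and> snd p \<le> t0 then m p else 0) \<partial>T) \<le> ennreal (1 / (1 - \<rho>)) * (\<integral>\<^sup>+p. f p \<partial>T)"
proof -
  note [measurable] = iterate_measurable[OF f]
  have step: "m (x, t) \<le> iterate c f n (x, t) + ennreal (C * \<rho> ^ n)" if "0 \<le> t" "t \<le> t0" for n x t
    using that
  proof (induction n arbitrary: x t)
    case 0
    then show ?case using bdd by simp
  next
    case (Suc n)
    have "Kop m (x, t) \<le> Kop (\<lambda>p. iterate c f n p + ennreal (C * \<rho> ^ n)) (x, t)"
      using Suc by (intro Kop_mono) auto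
    also have "\<dots> \<le> Kop (iterate c f n) (x, t) + total_mass * ennreal (C * \<rho> ^ n)"
      by (rule Kop_add_const_le) measurable
    finally have K: "c * Kop m (x, t) \<le> c * Kop (iterate c f n) (x, t) + c * total_mass * ennreal (C * \<rho> ^ n)"
      by (metis distrib_left mult.assoc mult_left_mono zero_le)
    have "c * total_mass * ennreal (C * \<rho> ^ n) \<le> ennreal \<rho> * ennreal (C * \<rho> ^ n)"
      by (intro mult_right_mono \<rho>) simp
    also have "\<dots> = ennreal (C * \<rho> ^ Suc n)"
      using \<rho> C by (simp add: ennreal_mult[symmetric] mult.left_commute)
    finally have "c * Kop m (x, t) \<le> c * Kop (iterate c f n) (x, t) + ennreal (C * \<rho> ^ Suc n)"
      using K by (meson add_left_mono order_trans)
    then have "f (x, t) + c * Kop m (x, t) \<le> iterate c f (Suc n) (x, t) + ennreal (C * \<rho> ^ Suc n)"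
      by (simp add: add.assoc add_left_mono)
    then show ?case using ineq[OF Suc.prems, of x] by (rule order_trans[rotated])
  qed
  have le: "m (x, t) \<le> (SUP n. iterate c f n (x, t))" if "0 \<le> t" "t \<le> t0" for x t
  proof (rule LIMSEQ_le_const)
    have "(\<lambda>n. C * \<rho> ^ n) \<longlonglongrightarrow> C * 0"
      using \<rho> by (intro tendsto_intros LIMSEQ_power_zero) auto
    then have "(\<lambda>n. ennreal (C * \<rho> ^ n)) \<longlonglongrightarrow> ennreal (C * 0)" by (rule tendsto_ennrealI)
    then have "(\<lambda>n. (SUP n. iterate c f n (x, t)) + ennreal (C * \<rho> ^ n)) \<longlonglongrightarrow> (SUP n. iterate c f n (x, t)) + ennreal (C * 0)"
      by (intro tendsto_add tendsto_const)
    then show "(\<lambda>n. (SUP n. iterate c f n (x, t)) + ennreal (C * \<rho> ^ n)) \<longlonglongrightarrow> (SUP n. iterate c f n (x, t))" by simp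
    have "iterate c f n (x, t) \<le> (SUP n. iterate c f n (x, t))" for n by (rule SUP_upper) simp
    then have "m (x, t) \<le> (SUP n. iterate c f n (x, t)) + ennreal (C * \<rho> ^ n)" for n
      using step[OF that, of x n] by (meson add_right_mono order_trans)
    then show "\<exists>N. \<forall>n\<ge>N. m (x, t) \<le> (SUP n. iterate c f n (x, t)) + ennreal (C * \<rho> ^ n)" by blast
  qed
  have "(\<integral>\<^sup>+p. (if 0 \<le> snd p \<and> snd p \<le> t0 then m p else 0) \<partial>T) \<le> (\<integral>\<^sup>+p. (SUP n. iterate c f n p) \<partial>T)"
    using le by (intro nn_integral_mono) (auto split: prod.splits)
  also have "\<dots> = (SUP n. \<integral>\<^sup>+p. iterate c f n p \<partial>T)"
    by (rule nn_integral_monotone_convergence_SUP)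
      (auto intro!: incseq_SucI le_funI iterate_mono simp del: iterate.simps)
  also have "\<dots> \<le> ennreal (1 / (1 - \<rho>)) * (\<integral>\<^sup>+p. f p \<partial>T)"
    by (intro SUP_least iterate_integral_le f \<rho>)
  finally show ?thesis .
qed

end

section \<open>Second moments of the solution\<close>

lemma (in bm_system) ito_cong_AE:
  assumes "ito f I" "AE \<omega> in M. J \<omega> = I \<omega>" "J \<in> borel_measurable M"
  shows "ito f J"
proof -
  have [measurable]: "I \<in> borel_measurable M" using assms(1) by (simp add: ito_def sq_integrable_def)
  note [measurable] = assms(3)
  have sJ: "sq_integrable M J"
  proof -
    have "integrable M (\<lambda>\<omega>. (J \<omega>)\<^sup>2) \<longleftrightarrow> integrable M (\<lambda>\<omega>. (I \<omega>)\<^sup>2)"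
      using assms(2) by (intro Bochner_Integration.integrable_cong_AE) auto
    then show ?thesis using ito_sq_integrable(2)[OF assms(1)] by (simp add: sq_integrable_def)
  qed
  show ?thesis
  proof (rule ito_limit[OF ito_sq_integrable(1)[OF assms(1)] sJ])
    fix \<epsilon> :: real assume "0 < \<epsilon>"
    moreover have "L2_norm M (\<lambda>\<omega>. I \<omega> - J \<omega>) = 0"
    proof -
      have "(\<integral>\<omega>. (I \<omega> - J \<omega>)\<^sup>2 \<partial>M) = (\<integral>\<omega>. 0 \<partial>M)"
        using assms(2) by (intro integral_cong_AE) auto
      then show ?thesis by (simp add: L2_norm_def)
    qed
    moreover have "L2_norm K (\<lambda>p. f p - f p) = 0" by (simp add: L2_norm_def)
    ultimately show "\<exists>g Ja. ito g Ja \<and> L2_norm K (\<lambda>p. g p - f p) < \<epsilon> \<and> L2_norm M (\<lambda>\<omega>. Ja \<omega> - J \<omega>) < \<epsilon>"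
      using assms(1) by (intro exI[of _ f] exI[of _ I]) auto
  qed
qed

text \<open>Isolates what the argument takes from the walk: a measurable semigroup of laws, the
  holding probability, and a squared kernel whose total mass is finite and, times
  \<open>lip\<^sup>2\<close>, below 1. The sites may form any countable abelian group.\<close>

locale she = bm_system M B
  for M :: "'w measure" and B :: "'i::{countable, ab_group_add} \<Rightarrow> real \<Rightarrow> 'w \<Rightarrow> real" +
  fixes P :: "real \<Rightarrow> 'i pmf" and p :: "real \<Rightarrow> 'i \<Rightarrow> real" and \<sigma> :: "real \<Rightarrow> real"
    and u0 :: "'i \<Rightarrow> real" and u :: "real \<Rightarrow> 'i \<Rightarrow> 'w \<Rightarrow> real" and lip :: real
  assumes p_eq: "\<And>t x. 0 \<le> t \<Longrightarrow> p t x = pmf (P t) x"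
    and semigroup: "\<And>s t. 0 \<le> s \<Longrightarrow> 0 \<le> t \<Longrightarrow> P (s + t) = conv_pmf (P s) (P t)"
    and P_measurable: "\<And>x. (\<lambda>t. pmf (P t) x) \<in> borel_measurable borel"
    and P_stay: "\<And>t. 0 \<le> t \<Longrightarrow> exp (- t) \<le> pmf (P t) 0"
    and \<sigma>_measurable: "\<sigma> \<in> borel_measurable borel"
    and lip_nonneg: "0 \<le> lip" and \<sigma>_le: "\<And>a. \<bar>\<sigma> a\<bar> \<le> lip * \<bar>a\<bar>"
    and u0_nonneg: "\<And>x. 0 \<le> u0 x" and u0_summable: "u0 summable_on UNIV"
    and sol: "SHE_solution M B p \<sigma> u0 u"
    and total_finite: "renewal.total_mass (\<lambda>t z. ennreal ((pmf (P t) z)\<^sup>2)) < \<infinity>"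
    and subcritical: "ennreal (lip\<^sup>2) * renewal.total_mass (\<lambda>t z. ennreal ((pmf (P t) z)\<^sup>2)) < 1"
begin

definition \<kappa> :: "real \<Rightarrow> 'i \<Rightarrow> ennreal" where
  "\<kappa> = (\<lambda>t z. ennreal ((pmf (P t) z)\<^sup>2))"

sublocale R: renewal \<kappa>
  by standard (use P_measurable in \<open>simp add: \<kappa>_def\<close>)

lemma R_finite: "R.total_mass < \<infinity>" and R_small: "ennreal (lip\<^sup>2) * R.total_mass < 1"
  using total_finite subcritical by (simp_all add: \<kappa>_def)

lemma u_predictable: "predictable (space M) F (\<lambda>t. u t x)"
  using sol by (simp add: SHE_solution_def)

lemma u_continuous: "AE \<omega> in M. continuous_on {0..} (\<lambda>t. u t x \<omega>)"
  using sol by (simp add: SHE_solution_def)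

lemma u_adapted: "0 \<le> t \<Longrightarrow> u t x \<in> borel_measurable (F t)"
  by (rule predictable_adapted[OF u_predictable])

lemma u_measurable: "0 \<le> t \<Longrightarrow> u t x \<in> borel_measurable M"
  by (rule bm_filtration_measurableD[OF u_adapted])

lemma u_joint: "(\<lambda>(s, \<omega>). indicator {0..} s * u s x \<omega>) \<in> borel_measurable (lborel \<Otimes>\<^sub>M M)"
  by (rule predictable_jointly_measurable[OF u_predictable])

text \<open>Extension by 0 to negative times makes \<open>m\<close> measurable for
  \<open>R.T\<close>, whose time axis is the whole line.\<close>

definition m :: "'i \<times> real \<Rightarrow> ennreal" where
  "m q = (\<integral>\<^sup>+\<omega>. ennreal ((indicator {0..} (snd q) * u (snd q) (fst q) \<omega>)\<^sup>2) \<partial>M)"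

lemma m_eq: "0 \<le> t \<Longrightarrow> m (x, t) = (\<integral>\<^sup>+\<omega>. ennreal ((u t x \<omega>)\<^sup>2) \<partial>M)"
  and m_neg: "t < 0 \<Longrightarrow> m (x, t) = 0"
  by (auto simp: m_def)

lemma m_section_measurable: "(\<lambda>t. m (x, t)) \<in> borel_measurable borel"
proof -
  have "(\<lambda>(t, \<omega>). ennreal ((indicator {0..} t * u t x \<omega>)\<^sup>2)) \<in> borel_measurable (lborel \<Otimes>\<^sub>M M)"
    using u_joint[of x] by (simp add: case_prod_beta')
  from borel_measurable_nn_integral[OF this] show ?thesis by (simp add: m_def)
qed

lemma m_measurable: "m \<in> borel_measurable R.T"
  by (rule R.measurable_T) (rule m_section_measurable)

lemma m_bounded:
  assumes "0 \<le> t0"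
  shows "\<exists>C\<ge>0. \<forall>x t. 0 \<le> t \<longrightarrow> t \<le> t0 \<longrightarrow> m (x, t) \<le> ennreal C"
proof -
  \<comment> \<open>A solution has bounded moments on intervals with positive right endpoint;
    \<open>t0 + 1\<close> also covers \<open>t0 = 0\<close>.\<close>
  let ?S = "SUP t\<in>{0..t0 + 1}. SUP x. \<integral>\<^sup>+\<omega>. ennreal (\<bar>u t x \<omega>\<bar>\<^sup>2) \<partial>M"
  have "\<forall>T>0. (SUP t\<in>{0..T}. SUP x. \<integral>\<^sup>+\<omega>. ennreal (\<bar>u t x \<omega>\<bar>\<^sup>2) \<partial>M) < \<infinity>"
    using sol by (simp add: SHE_solution_def)
  then have fin: "?S < \<infinity>" using assms by (metis add_nonneg_pos zero_less_one)
  have "m (x, t) \<le> ennreal (enn2real ?S)" if t: "0 \<le> t" "t \<le> t0" for x t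
  proof -
    have "m (x, t) = (\<integral>\<^sup>+\<omega>. ennreal (\<bar>u t x \<omega>\<bar>\<^sup>2) \<partial>M)" using t by (simp add: m_eq)
    also have "\<dots> \<le> (SUP x. \<integral>\<^sup>+\<omega>. ennreal (\<bar>u t x \<omega>\<bar>\<^sup>2) \<partial>M)" by (rule SUP_upper) simp
    also have "\<dots> \<le> ?S" by (rule SUP_upper) (use t in auto)
    also have "?S = ennreal (enn2real ?S)" using fin by simp
    finally show ?thesis .
  qed
  then show ?thesis by (intro exI[of _ "enn2real ?S"]) auto
qed

lemma sq_integrable_u:
  assumes "0 \<le> t"
  shows "sq_integrable M (u t x)"
proof -
  obtain C where "\<forall>x s. 0 \<le> s \<longrightarrow> s \<le> t \<longrightarrow> m (x, s) \<le> ennreal C"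
    using m_bounded[OF assms] by blast
  then have "m (x, t) \<le> ennreal C" using assms by simp
  then have "m (x, t) < \<infinity>" using ennreal_less_top order_le_less_trans by fastforce
  then show ?thesis using m_eq[OF assms] u_measurable[OF assms]
    by (simp add: sq_integrable_iff_nn_integral)
qed

section \<open>The mild formula as a single stochastic integral\<close>

text \<open>The integrand of \<open>u t x\<close> for all driving motions at once; the indicator
  keeps the time argument of the transition law nonnegative.\<close>

definition g :: "real \<Rightarrow> 'i \<Rightarrow> 'i \<times> real \<times> 'w \<Rightarrow> real" where
  "g t x = (\<lambda>(y, r, \<omega>). indicator {0..t} r * (pmf (P (t - r)) (y - x) * \<sigma> (u r y \<omega>)))"

lemma g_measurable: "g t x \<in> borel_measurable K"
proof (rule measurable_K)
  fix y
  note [measurable] = P_measurable \<sigma>_measurable u_joint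
  have "(\<lambda>q. indicator {0..t} (fst q) * (pmf (P (t - fst q)) (y - x) * \<sigma> (case q of (s, \<omega>) \<Rightarrow> indicator {0..} s * u s y \<omega>)))
     \<in> borel_measurable (lborel \<Otimes>\<^sub>M M)" by measurable
  also have "(\<lambda>q. indicator {0..t} (fst q) * (pmf (P (t - fst q)) (y - x) * \<sigma> (case q of (s, \<omega>) \<Rightarrow> indicator {0..} s * u s y \<omega>)))
     = (\<lambda>(r, \<omega>). g t x (y, r, \<omega>))"
    by (auto simp: g_def fun_eq_iff indicator_def)
  finally show "(\<lambda>(r, \<omega>). g t x (y, r, \<omega>)) \<in> borel_measurable (lborel \<Otimes>\<^sub>M M)" .
qed

text \<open>Linear growth of \<open>\<sigma>\<close> bounds the squared integrand by
  \<open>lip\<^sup>2\<close>, the squared kernel and the second moment, which together amount to one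
  application of \<open>R.Kop\<close>.\<close>

lemma g_square_le:
  assumes "0 \<le> t"
  shows "(\<integral>\<^sup>+q. ennreal ((g t x q)\<^sup>2) \<partial>K) \<le> ennreal (lip\<^sup>2) * R.Kop m (x, t)"
proof -
  have km: "(\<lambda>r. R.kernel (x, t) (y, r) * m (y, r)) \<in> borel_measurable borel" for y
  proof -
    note [measurable] = R.kernel_section_measurable(2) m_section_measurable
    show ?thesis by measurable
  qed
  have inner: "(\<integral>\<^sup>+\<omega>. ennreal ((g t x (y, r, \<omega>))\<^sup>2) \<partial>M) \<le> ennreal (lip\<^sup>2) * (R.kernel (x, t) (y, r) * m (y, r))" for y r
  proof (cases "0 \<le> r \<and> r \<le> t")
    case True
    have "(g t x (y, r, \<omega>))\<^sup>2 \<le> (pmf (P (t - r)) (y - x))\<^sup>2 * (lip\<^sup>2 * (u r y \<omega>)\<^sup>2)" for \<omega>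
    proof -
      have "(\<sigma> (u r y \<omega>))\<^sup>2 \<le> (lip * \<bar>u r y \<omega>\<bar>)\<^sup>2"
        using \<sigma>_le[of "u r y \<omega>"] lip_nonneg by (simp add: abs_le_square_iff[symmetric] abs_mult)
      then show ?thesis using True by (auto simp: g_def power_mult_distrib intro!: mult_left_mono)
    qed
    then have "(\<integral>\<^sup>+\<omega>. ennreal ((g t x (y, r, \<omega>))\<^sup>2) \<partial>M) \<le>
      (\<integral>\<^sup>+\<omega>. ennreal (lip\<^sup>2) * \<kappa> (t - r) (y - x) * ennreal ((u r y \<omega>)\<^sup>2) \<partial>M)"
      by (intro nn_integral_mono) (simp add: \<kappa>_def ennreal_mult[symmetric] mult_ac ennreal_leI)
    also have "\<dots> = ennreal (lip\<^sup>2) * \<kappa> (t - r) (y - x) * m (y, r)"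
      using True u_measurable[of r y] by (simp add: m_eq nn_integral_cmult)
    finally show ?thesis using True by (simp add: R.kernel_def mult.assoc)
  qed (auto simp: g_def)
  have "(\<integral>\<^sup>+q. ennreal ((g t x q)\<^sup>2) \<partial>K) = (\<integral>\<^sup>+y. \<integral>\<^sup>+r. \<integral>\<^sup>+\<omega>. ennreal ((g t x (y, r, \<omega>))\<^sup>2) \<partial>M \<partial>lborel \<partial>count_space UNIV)"
    by (rule nn_integral_K) (use g_measurable in simp)
  also have "\<dots> \<le> (\<integral>\<^sup>+y. \<integral>\<^sup>+r. ennreal (lip\<^sup>2) * (R.kernel (x, t) (y, r) * m (y, r)) \<partial>lborel \<partial>count_space UNIV)"
    by (intro nn_integral_mono inner)
  also have "\<dots> = ennreal (lip\<^sup>2) * (\<integral>\<^sup>+y. \<integral>\<^sup>+r. R.kernel (x, t) (y, r) * m (y, r) \<partial>lborel \<partial>count_space UNIV)"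
    using km by (simp add: nn_integral_cmult)
  also have "\<dots> = ennreal (lip\<^sup>2) * R.Kop m (x, t)"
    unfolding R.Kop_def using R.nn_integral_T(1)[OF km] by simp
  finally show ?thesis .
qed

text \<open>Second moments are bounded up to time \<open>t\<close>, and \<open>R.Kop\<close> maps a
  constant to a bounded function because the total mass is finite.\<close>

lemma g_sq_integrable:
  assumes "0 \<le> t"
  shows "sq_integrable K (g t x)"
proof -
  obtain C where C: "\<forall>x s. 0 \<le> s \<longrightarrow> s \<le> t \<longrightarrow> m (x, s) \<le> ennreal C"
    using m_bounded[OF assms] by blast
  have "R.Kop m (x, t) \<le> R.Kop (\<lambda>q. 0 + ennreal C) (x, t)"
    using C by (intro R.Kop_mono) (auto split: prod.splits)
  also have "\<dots> \<le> R.Kop (\<lambda>q. 0) (x, t) + R.total_mass * ennreal C"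
    by (rule R.Kop_add_const_le) simp
  also have "\<dots> < \<infinity>" using R_finite by (simp add: R.Kop_def ennreal_mult_less_top)
  finally have "ennreal (lip\<^sup>2) * R.Kop m (x, t) < \<infinity>" by (simp add: ennreal_mult_less_top)
  with g_square_le[OF assms, of x] show ?thesis
    using g_measurable by (simp add: sq_integrable_iff_nn_integral order_le_less_trans)
qed

definition a :: "real \<Rightarrow> 'i \<Rightarrow> real" where
  "a t x = (\<Sum>\<^sub>\<infinity>y. pmf (P t) (y - x) * u0 y)"

text \<open>The sitewise integrals are restrictions of the one integrand \<open>g t x\<close>, whose
  square integrability over \<open>K\<close> allows them to be glued.\<close>

lemma ito_mild:
  assumes t: "0 \<le> t"
  shows "ito (g t x) (\<lambda>\<omega>. u t x \<omega> - a t x)"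
proof -
  have "SHE_mild M B p \<sigma> u0 u" using sol by (simp add: SHE_solution_def)
  from this[unfolded SHE_mild_def, rule_format, OF t, of x] obtain I S where
    I: "\<forall>y. has_ito_integral M F (B y) t (\<lambda>s \<omega>. p (t - s) (y - x) * \<sigma> (u s y \<omega>)) (I y)"
    and S: "has_L2_sum M I S" and ae: "AE \<omega> in M. u t x \<omega> = (\<Sum>\<^sub>\<infinity>y. p t (y - x) * u0 y) + S \<omega>"
    by (elim exE conjE)
  have "ito (\<lambda>(z, q). indicator {y} z * g t x (z, q)) (I y)" for y
  proof -
    have "(\<lambda>(z, r, \<omega>). indicator {y} z * (indicator {0..t} r * (p (t - r) (y - x) * \<sigma> (u r y \<omega>)))) =
      (\<lambda>(z, q). indicator {y} z * g t x (z, q))"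
      by (auto simp: g_def fun_eq_iff indicator_def p_eq)
    then show ?thesis using has_ito_integral_ito[OF I[rule_format] t, of y] by simp
  qed
  from ito_L2_sum[OF this S g_sq_integrable[OF t]] have "ito (g t x) S" .
  moreover have "AE \<omega> in M. u t x \<omega> - a t x = S \<omega>"
    using ae by eventually_elim (simp add: a_def p_eq[OF t])
  ultimately show ?thesis
    by (rule ito_cong_AE) (use u_measurable[OF t] in simp)
qed

text \<open>Testing against the constant 1 at time 0: the truncated integrand lives on the single
  time 0, a null set.\<close>

lemma expectation_mild:
  assumes t: "0 \<le> t"
  shows "expectation (\<lambda>\<omega>. u t x \<omega> - a t x) = 0"
proof -
  have "\<bar>expectation (\<lambda>\<omega>. 1 * (u t x \<omega> - a t x))\<bar> \<le> L2_norm M (\<lambda>\<omega>. 1) * L2_norm K (trunc 0 (g t x))"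
    by (rule ito_past_bound[OF _ _ order_refl ito_mild[OF t]]) (auto simp: sq_integrable_def)
  moreover have "L2_norm K (trunc 0 (g t x)) = 0"
  proof -
    have tm: "trunc 0 (g t x) \<in> borel_measurable K"
      by (rule sq_integrable_measurable[OF sq_integrable_trunc[OF g_sq_integrable[OF t]]])
    have "(\<integral>\<^sup>+q. ennreal ((trunc 0 (g t x) q)\<^sup>2) \<partial>K) =
      (\<integral>\<^sup>+y. \<integral>\<^sup>+r. \<integral>\<^sup>+\<omega>. ennreal ((trunc 0 (g t x) (y, r, \<omega>))\<^sup>2) \<partial>M \<partial>lborel \<partial>count_space UNIV)"
      by (rule nn_integral_K) (use tm in simp)
    also have "\<dots> = (\<integral>\<^sup>+y. \<integral>\<^sup>+(r::real). 0 \<partial>lborel \<partial>count_space (UNIV :: 'i set))"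
    proof (rule nn_integral_cong, rule nn_integral_cong_AE)
      fix y
      show "AE r in lborel. (\<integral>\<^sup>+\<omega>. ennreal ((trunc 0 (g t x) (y, r, \<omega>))\<^sup>2) \<partial>M) = 0"
        using AE_lborel_singleton[of 0] by eventually_elim (auto simp: trunc_def g_def indicator_def)
    qed
    finally have "(\<integral>\<^sup>+q. ennreal ((trunc 0 (g t x) q)\<^sup>2) \<partial>K) = 0" by simp
    then have "ennreal ((L2_norm K (trunc 0 (g t x)))\<^sup>2) = 0"
      using L2_norm_nn_integral[OF sq_integrable_trunc[OF g_sq_integrable[OF t]]] by simp
    then show ?thesis by (simp add: ennreal_eq_0_iff)
  qed
  ultimately show ?thesis by simp
qed

text \<open>Mean plus centred fluctuation: the cross term vanishes and the isometry turns the
  variance into the squared norm of \<open>g t x\<close>.\<close>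

lemma m_le:
  assumes t: "0 \<le> t"
  shows "m (x, t) \<le> ennreal ((a t x)\<^sup>2) + ennreal (lip\<^sup>2) * R.Kop m (x, t)"
proof -
  let ?S = "\<lambda>\<omega>. u t x \<omega> - a t x"
  have S: "sq_integrable M ?S" by (rule ito_sq_integrable(2)[OF ito_mild[OF t]])
  have "(\<integral>\<omega>. (u t x \<omega>)\<^sup>2 \<partial>M) = (\<integral>\<omega>. (a t x)\<^sup>2 + 2 * a t x * ?S \<omega> + (?S \<omega>)\<^sup>2 \<partial>M)"
    by (rule Bochner_Integration.integral_cong) (auto simp: power2_eq_square algebra_simps)
  also have "\<dots> = (a t x)\<^sup>2 + 2 * a t x * expectation ?S + expectation (\<lambda>\<omega>. (?S \<omega>)\<^sup>2)"
    using sq_integrable_square[OF S] sq_integrable_integrable[OF S] by (simp add: prob_space del: right_diff_distrib)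
  also have "\<dots> = (a t x)\<^sup>2 + (L2_norm K (g t x))\<^sup>2"
    using expectation_mild[OF t, of x] ito_isometry[OF ito_mild[OF t, of x]]
    by (simp add: L2_norm_sq[symmetric])
  finally have "m (x, t) = ennreal ((a t x)\<^sup>2 + (L2_norm K (g t x))\<^sup>2)"
    using sq_integrable_square[OF sq_integrable_u[OF t, of x]]
    by (simp add: m_eq[OF t] nn_integral_eq_integral)
  also have "\<dots> = ennreal ((a t x)\<^sup>2) + (\<integral>\<^sup>+q. ennreal ((g t x q)\<^sup>2) \<partial>K)"
    by (simp add: L2_norm_nn_integral[OF g_sq_integrable[OF t]])
  also have "\<dots> \<le> ennreal ((a t x)\<^sup>2) + ennreal (lip\<^sup>2) * R.Kop m (x, t)"
    by (intro add_left_mono g_square_le t)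
  finally show ?thesis .
qed

section \<open>Integrability of the total second moment\<close>

text \<open>The square of \<open>a t x\<close> at nonnegative times, written with an extended
  nonnegative sum so that measurability in \<open>t\<close> is direct.\<close>

definition f0 :: "'i \<times> real \<Rightarrow> ennreal" where
  "f0 q = (if 0 \<le> snd q then (\<integral>\<^sup>+y. ennreal (pmf (P (snd q)) (y - fst q)) * ennreal (u0 y) \<partial>count_space UNIV)\<^sup>2 else 0)"

lemma ennreal_a:
  "ennreal (a t x) = (\<integral>\<^sup>+y. ennreal (pmf (P t) (y - x)) * ennreal (u0 y) \<partial>count_space UNIV)"
  and a_nonneg: "0 \<le> a t x"
proof -
  have "(\<lambda>y. pmf (P t) (y - x) * u0 y) summable_on UNIV"
    by (rule summable_on_comparison_test[OF u0_summable])
      (auto simp: u0_nonneg pmf_le_1 intro!: mult_left_le_one_le)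
  then show "ennreal (a t x) = (\<integral>\<^sup>+y. ennreal (pmf (P t) (y - x)) * ennreal (u0 y) \<partial>count_space UNIV)"
    unfolding a_def by (subst ennreal_infsum_eq_nn_integral) (auto simp: u0_nonneg ennreal_mult)
  show "0 \<le> a t x" unfolding a_def by (rule infsum_nonneg) (simp add: u0_nonneg)
qed

lemma f0_eq: "0 \<le> t \<Longrightarrow> f0 (x, t) = ennreal ((a t x)\<^sup>2)"
  by (simp add: f0_def ennreal_a[symmetric] a_nonneg ennreal_power)

lemma f0_section_measurable: "(\<lambda>t. f0 (x, t)) \<in> borel_measurable borel"
proof -
  note [measurable] = P_measurable
  have [measurable]: "(\<lambda>t. \<integral>\<^sup>+y. ennreal (pmf (P t) (y - x)) * ennreal (u0 y) \<partial>count_space UNIV) \<in> borel_measurable borel"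
    by (rule measurable_nn_integral_count) measurable
  show ?thesis unfolding f0_def fst_conv snd_conv by measurable
qed

definition u0_mass :: ennreal where
  "u0_mass = (\<integral>\<^sup>+y. ennreal (u0 y) \<partial>count_space UNIV)"

lemma u0_mass_finite: "u0_mass < \<infinity>"
  unfolding u0_mass_def using ennreal_infsum_eq_nn_integral[OF u0_summable u0_nonneg]
  by (metis ennreal_less_top infinity_ennreal_def)

lemma mass_le_1: "R.mass t \<le> 1"
proof -
  have "\<kappa> t z \<le> ennreal (pmf (P t) z)" for z
    unfolding \<kappa>_def by (intro ennreal_leI) (auto simp: power2_eq_square pmf_le_1 intro: mult_left_le_one_le)
  then have "R.mass t \<le> (\<integral>\<^sup>+z. ennreal (pmf (P t) z) \<partial>count_space UNIV)"
    unfolding R.mass_def by (intro nn_integral_mono)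
  also have "\<dots> = 1" by (simp add: nn_integral_pmf)
  finally show ?thesis .
qed

text \<open>Cauchy-Schwarz with weight \<open>u0\<close> moves the square from the average to the
  kernel at the cost of one factor \<open>u0_mass\<close>; summing over \<open>x\<close> brings the
  second. Summability of \<open>u0\<close> makes the bound finite.\<close>

lemma f0_sum_le: "0 \<le> t \<Longrightarrow> (\<integral>\<^sup>+x. f0 (x, t) \<partial>count_space UNIV) \<le> u0_mass\<^sup>2 * R.mass t"
proof -
  assume t: "0 \<le> t"
  have "(\<integral>\<^sup>+x. f0 (x, t) \<partial>count_space UNIV) \<le>
    (\<integral>\<^sup>+x. u0_mass * (\<integral>\<^sup>+y. \<kappa> t (y - x) * ennreal (u0 y) \<partial>count_space UNIV) \<partial>count_space UNIV)"
    unfolding f0_def u0_mass_def \<kappa>_def using t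
    by (intro nn_integral_mono) (simp add: nn_integral_weighted_square_le)
  also have "\<dots> = u0_mass * (\<integral>\<^sup>+x. \<integral>\<^sup>+y. \<kappa> t (y - x) * ennreal (u0 y) \<partial>count_space UNIV \<partial>count_space UNIV)"
    by (simp add: nn_integral_cmult)
  also have "(\<integral>\<^sup>+x. \<integral>\<^sup>+y. \<kappa> t (y - x) * ennreal (u0 y) \<partial>count_space UNIV \<partial>count_space UNIV) =
    (\<integral>\<^sup>+y. \<integral>\<^sup>+x. \<kappa> t (y - x) * ennreal (u0 y) \<partial>count_space UNIV \<partial>count_space UNIV)"
    by (rule nn_integral_count_space_nn_integral) auto
  also have "\<dots> = R.mass t * u0_mass"
    by (simp add: nn_integral_multc nn_integral_cmult nn_integral_count_shift R.mass_def u0_mass_def)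
  finally show ?thesis by (simp add: power2_eq_square mult_ac)
qed

lemma f0_integral_le: "(\<integral>\<^sup>+q. f0 q \<partial>R.T) \<le> u0_mass\<^sup>2 * R.total_mass"
proof -
  have "(\<integral>\<^sup>+q. f0 q \<partial>R.T) = (\<integral>\<^sup>+t. \<integral>\<^sup>+x. f0 (x, t) \<partial>count_space UNIV \<partial>lborel)"
    by (rule R.nn_integral_T(2)) (rule f0_section_measurable)
  also have "\<dots> \<le> (\<integral>\<^sup>+t. u0_mass\<^sup>2 * (if 0 \<le> t then R.mass t else 0) \<partial>lborel)"
  proof (rule nn_integral_mono)
    fix t
    show "(\<integral>\<^sup>+x. f0 (x, t) \<partial>count_space UNIV) \<le> u0_mass\<^sup>2 * (if 0 \<le> t then R.mass t else 0)"
      using f0_sum_le[of t] by (cases "0 \<le> t") (simp_all add: f0_def)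
  qed
  also have "\<dots> = u0_mass\<^sup>2 * R.total_mass"
    using R.mass_measurable by (simp add: R.total_mass_def nn_integral_cmult)
  finally show ?thesis .
qed

text \<open>The renewal bound, with \<open>\<rho>\<close> equal to \<open>lip\<^sup>2\<close> times
  \<open>R.total_mass\<close>, is the same for every horizon \<open>n\<close>, although the a priori
  constant \<open>C\<close> depends on \<open>n\<close>. Monotone convergence then removes the
  horizon.\<close>

lemma m_integral_finite: "(\<integral>\<^sup>+q. m q \<partial>R.T) < \<infinity>"
proof -
  define \<rho> where "\<rho> = enn2real (ennreal (lip\<^sup>2) * R.total_mass)"
  have fin: "ennreal (lip\<^sup>2) * R.total_mass < \<infinity>" using R_small by (rule less_trans) simp
  then have \<rho>_eq: "ennreal \<rho> = ennreal (lip\<^sup>2) * R.total_mass" by (simp add: \<rho>_def)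
  have \<rho>: "0 \<le> \<rho>" "\<rho> < 1"
    using R_small \<rho>_eq ennreal_less_iff[of \<rho> 1] by (simp_all add: \<rho>_def)
  have f0m: "f0 \<in> borel_measurable R.T" by (rule R.measurable_T) (rule f0_section_measurable)
  let ?D = "ennreal (1 / (1 - \<rho>)) * (\<integral>\<^sup>+q. f0 q \<partial>R.T)"
  let ?m = "\<lambda>n q. if 0 \<le> snd q \<and> snd q \<le> real n then m q else 0"
  have le: "(\<integral>\<^sup>+q. ?m n q \<partial>R.T) \<le> ?D" for n :: nat
  proof -
    obtain C where C: "0 \<le> C" and C': "\<forall>x s. 0 \<le> s \<longrightarrow> s \<le> real n \<longrightarrow> m (x, s) \<le> ennreal C"
      using m_bounded[OF of_nat_0_le_iff[of n]] by blast
    show ?thesis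
    proof (rule R.renewal_bound[where c="ennreal (lip\<^sup>2)" and C=C, OF f0m \<rho> eq_refl[OF \<rho>_eq[symmetric]] _ C])
      show "m (x, t) \<le> f0 (x, t) + ennreal (lip\<^sup>2) * R.Kop m (x, t)" if "0 \<le> t" for x t
        using m_le[OF that] f0_eq[OF that] by simp
    qed (use C' in blast)
  qed
  have "m q = (SUP n. ?m n q)" for q
  proof (rule antisym)
    obtain n :: nat where "snd q \<le> real n" using real_arch_simple by blast
    then have "m q = ?m n q" using m_neg[of "snd q" "fst q"] by auto
    also have "\<dots> \<le> (SUP n. ?m n q)" by (rule SUP_upper) simp
    finally show "m q \<le> (SUP n. ?m n q)" .
    show "(SUP n. ?m n q) \<le> m q" by (rule SUP_least) simp
  qed
  then have "(\<integral>\<^sup>+q. m q \<partial>R.T) = (\<integral>\<^sup>+q. (SUP n. ?m n q) \<partial>R.T)" by simp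
  also have "\<dots> = (SUP n. \<integral>\<^sup>+q. ?m n q \<partial>R.T)"
  proof (rule nn_integral_monotone_convergence_SUP)
    show "incseq ?m" by (intro incseq_SucI le_funI) auto
    note [measurable] = m_measurable
    show "?m n \<in> borel_measurable R.T" for n by measurable
  qed
  also have "\<dots> \<le> ?D" by (rule SUP_least) (rule le)
  also have "\<dots> \<le> ennreal (1 / (1 - \<rho>)) * (u0_mass\<^sup>2 * R.total_mass)"
    by (intro mult_left_mono f0_integral_le) simp
  also have "\<dots> < \<infinity>"
    using R_finite u0_mass_finite by (auto simp: ennreal_mult_less_top power2_eq_square)
  finally show ?thesis .
qed

definition U :: "real \<Rightarrow> ennreal" where
  "U t = (\<integral>\<^sup>+x. m (x, t) \<partial>count_space UNIV)"

lemma U_measurable: "U \<in> borel_measurable borel"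
  unfolding U_def[abs_def] by (rule measurable_nn_integral_count) (rule m_section_measurable)

lemma U_integral_finite: "(\<integral>\<^sup>+t. U t \<partial>lborel) < \<infinity>"
  using m_integral_finite R.nn_integral_T(2)[OF m_section_measurable] by (simp add: U_def)

text \<open>Integrability in time yields finiteness only for almost every \<open>t\<close>. For a
  given \<open>t\<close> the inequality for \<open>m\<close> is used once more, now with the spatial
  mass of the kernel, which is at most 1.\<close>

lemma U_finite:
  assumes t: "0 \<le> t"
  shows "U t < \<infinity>"
proof -
  note [measurable] = R.kernel_section_measurable m_section_measurable
  have km: "(\<lambda>q. R.kernel (x, t) q * m q) \<in> borel_measurable R.T" for x
    by (rule R.measurable_T) measurable
  have "(\<integral>\<^sup>+x. R.kernel (x, t) q \<partial>count_space UNIV) \<le> 1" for q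
    using mass_le_1[of "t - snd q"]
    by (cases "0 \<le> snd q \<and> snd q \<le> t") (auto simp: R.kernel_def nn_integral_count_shift R.mass_def)
  then have "(\<integral>\<^sup>+q. (\<integral>\<^sup>+x. R.kernel (x, t) q \<partial>count_space UNIV) * m q \<partial>R.T) \<le> (\<integral>\<^sup>+q. 1 * m q \<partial>R.T)"
    by (intro nn_integral_mono mult_right_mono) auto
  moreover have "(\<integral>\<^sup>+x. R.Kop m (x, t) \<partial>count_space UNIV) = (\<integral>\<^sup>+q. (\<integral>\<^sup>+x. R.kernel (x, t) q \<partial>count_space UNIV) * m q \<partial>R.T)"
    unfolding R.Kop_def using km
    by (subst nn_integral_count_space_nn_integral[symmetric]) (auto simp: nn_integral_multc)
  ultimately have K: "(\<integral>\<^sup>+x. R.Kop m (x, t) \<partial>count_space UNIV) < \<infinity>"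
    using m_integral_finite by (simp add: order_le_less_trans)
  have "U t \<le> (\<integral>\<^sup>+x. f0 (x, t) + ennreal (lip\<^sup>2) * R.Kop m (x, t) \<partial>count_space UNIV)"
    unfolding U_def using m_le[OF t] f0_eq[OF t] by (intro nn_integral_mono) simp
  also have "\<dots> = (\<integral>\<^sup>+x. f0 (x, t) \<partial>count_space UNIV) + ennreal (lip\<^sup>2) * (\<integral>\<^sup>+x. R.Kop m (x, t) \<partial>count_space UNIV)"
    by (simp add: nn_integral_add nn_integral_cmult)
  also have "\<dots> \<le> u0_mass\<^sup>2 * 1 + ennreal (lip\<^sup>2) * (\<integral>\<^sup>+x. R.Kop m (x, t) \<partial>count_space UNIV)"
    using f0_sum_le[OF t] mass_le_1[of t]
    by (intro add_right_mono) (meson mult_left_mono order_trans zero_le)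
  also have "\<dots> < \<infinity>" using K u0_mass_finite by (auto simp: ennreal_mult_less_top power2_eq_square)
  finally show ?thesis .
qed

end

section \<open>Contraction estimates for the averaging operator\<close>

lemma sum_le_nn_integral_count:
  fixes h :: "'i::countable \<Rightarrow> ennreal"
  assumes "finite X"
  shows "(\<Sum>x\<in>X. h x) \<le> (\<integral>\<^sup>+x. h x \<partial>count_space UNIV)"
proof -
  have "\<forall>\<^sub>F n in sequentially. X \<subseteq> {x. to_nat x < n}"
    using filterlim_to_nat_lessThan[unfolded filterlim_finite_subsets_at_top, rule_format, of X] assms
    by (auto elim: eventually_mono)
  from eventually_happens'[OF sequentially_bot this] obtain n where n: "X \<subseteq> {x. to_nat x < n}" by blast
  have "(\<Sum>x\<in>X. h x) \<le> (\<Sum>x | to_nat x < n. h x)"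
    by (rule sum_mono2[OF finite_to_nat_lessThan n]) simp
  also have "\<dots> \<le> (\<integral>\<^sup>+x. h x \<partial>count_space UNIV)"
    unfolding nn_integral_count_eq_SUP(1) by (rule SUP_upper) simp
  finally show ?thesis .
qed

lemma nonneg_sum_to_nat:
  fixes f :: "'i::countable \<Rightarrow> real"
  assumes f: "\<And>x. 0 \<le> f x" and c: "0 \<le> c" and int: "(\<integral>\<^sup>+x. ennreal (f x) \<partial>count_space UNIV) = ennreal c"
  shows "(\<lambda>n. \<Sum>x | to_nat x < n. f x) \<longlonglongrightarrow> c" and "finite X \<Longrightarrow> (\<Sum>x\<in>X. f x) \<le> c"
proof -
  have "(\<lambda>n. ennreal (\<Sum>x | to_nat x < n. f x)) \<longlonglongrightarrow> ennreal c"
    using sum_tendsto_nn_integral_count[of "\<lambda>x. ennreal (f x)"] f by (simp add: int)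
  then show "(\<lambda>n. \<Sum>x | to_nat x < n. f x) \<longlonglongrightarrow> c"
    using f c by (subst (asm) tendsto_ennreal_iff) (simp_all add: sum_nonneg)
  assume "finite X"
  then have "ennreal (\<Sum>x\<in>X. f x) \<le> ennreal c"
    using sum_le_nn_integral_count[of X "\<lambda>x. ennreal (f x)"] f by (simp add: int)
  then show "(\<Sum>x\<in>X. f x) \<le> c" using c by (simp add: ennreal_le_iff)
qed

text \<open>Averaging over a walk that stays put with probability at least \<open>3/4\<close> cannot shrink \<open>\<ell>\<^sup>2\<close> norms by
  much, since the part that moves has norm at most \<open>1/4\<close> on \<open>\<ell>\<^sup>2\<close>.\<close>

lemma averaging_lower_bound:
  fixes Q :: "'i::{countable, ab_group_add} pmf"
  assumes Q0: "3 / 4 \<le> pmf Q 0" and fin: "(\<integral>\<^sup>+z. ennreal ((v z)\<^sup>2) \<partial>count_space UNIV) < \<infinity>"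
    and v0: "\<And>z. 0 \<le> v z" and b0: "\<And>z. 0 \<le> b z"
    and pt: "\<And>x. ennreal (pmf Q 0 * v x) \<le> ennreal (b x) +
      (\<integral>\<^sup>+z. ennreal (v z) * ennreal (if z = x then 0 else pmf Q (z - x)) \<partial>count_space UNIV)"
  shows "(\<integral>\<^sup>+x. ennreal ((v x)\<^sup>2) \<partial>count_space UNIV) \<le> 5 * (\<integral>\<^sup>+x. ennreal ((b x)\<^sup>2) \<partial>count_space UNIV)"
proof -
  let ?V = "\<integral>\<^sup>+x. ennreal ((v x)\<^sup>2) \<partial>count_space UNIV"
  let ?A = "\<integral>\<^sup>+x. ennreal ((b x)\<^sup>2) \<partial>count_space UNIV"
  \<comment> \<open>The moving part of the walk, of mass at most 1/4.\<close>
  define w where "w z = (if z = 0 then 0 else pmf Q z)" for z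
  define R where "R x = (\<integral>\<^sup>+z. ennreal (v z) * ennreal (w (z - x)) \<partial>count_space UNIV)" for x
  have wmass: "(\<integral>\<^sup>+z. ennreal (w z) \<partial>count_space UNIV) \<le> ennreal (1 / 4)"
  proof -
    have "ennreal (pmf Q 0) + (\<integral>\<^sup>+z. ennreal (w z) \<partial>count_space UNIV) =
      (\<integral>\<^sup>+z. ennreal (pmf Q 0) * indicator {0::'i} z \<partial>count_space UNIV) + (\<integral>\<^sup>+z. ennreal (w z) \<partial>count_space UNIV)"
      by (simp add: nn_integral_cmult_indicator)
    also have "\<dots> = (\<integral>\<^sup>+z. ennreal (pmf Q 0) * indicator {0::'i} z + ennreal (w z) \<partial>count_space UNIV)"
      by (simp add: nn_integral_add)
    also have "\<dots> = (\<integral>\<^sup>+z. ennreal (pmf Q z) \<partial>count_space UNIV)"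
      by (intro nn_integral_cong) (auto simp: w_def indicator_def)
    also have "\<dots> = 1" by (simp add: nn_integral_pmf)
    finally have e: "ennreal (pmf Q 0) + (\<integral>\<^sup>+z. ennreal (w z) \<partial>count_space UNIV) = 1" .
    then have "(\<integral>\<^sup>+z. ennreal (w z) \<partial>count_space UNIV) < \<infinity>"
      by (metis add.commute ennreal_one_less_top infinity_ennreal_def le_add_same_cancel1 order_le_less_trans zero_le le_iff_add)
    then obtain r where r: "0 \<le> r" "(\<integral>\<^sup>+z. ennreal (w z) \<partial>count_space UNIV) = ennreal r"
      by (cases "\<integral>\<^sup>+z. ennreal (w z) \<partial>count_space UNIV") auto
    with e have "ennreal (pmf Q 0 + r) = ennreal 1" by simp
    then have "pmf Q 0 + r = 1" using r by (subst (asm) ennreal_inj) auto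
    then show ?thesis using r Q0 by (simp add: ennreal_leI)
  qed
  have pt': "ennreal (pmf Q 0 * v x) \<le> ennreal (b x) + R x" for x
    using pt[of x] unfolding R_def w_def by (simp cong: if_cong)
  have sq2: "(r + s)\<^sup>2 \<le> 2 * r\<^sup>2 + 2 * s\<^sup>2" for r s :: ennreal
  proof (cases "r = \<infinity> \<or> s = \<infinity>")
    case True
    then show ?thesis by (auto simp: power2_eq_square ennreal_mult_top)
  next
    case False
    then obtain r' s' where rs: "r = ennreal r'" "0 \<le> r'" "s = ennreal s'" "0 \<le> s'"
      by (metis ennreal_cases infinity_ennreal_def)
    have "(r' + s')\<^sup>2 \<le> 2 * r'\<^sup>2 + 2 * s'\<^sup>2"
      using sum_squares_bound[of r' s'] by (simp add: power2_sum)
    then have "ennreal ((r' + s')\<^sup>2) \<le> ennreal (2 * r'\<^sup>2 + 2 * s'\<^sup>2)" by (rule ennreal_leI)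
    then show ?thesis using rs by (simp add: ennreal_power[symmetric] ennreal_mult)
  qed
  \<comment> \<open>The factor 1/16 is the square of the mass bound for \<open>w\<close>: one 1/4
    comes from Cauchy-Schwarz, the other from summing over \<open>x\<close>.\<close>
  have R2: "(\<integral>\<^sup>+x. (R x)\<^sup>2 \<partial>count_space UNIV) \<le> ennreal (1 / 16) * ?V"
  proof -
    have "(R x)\<^sup>2 \<le> ennreal (1 / 4) * (\<integral>\<^sup>+z. ennreal ((v z)\<^sup>2) * ennreal (w (z - x)) \<partial>count_space UNIV)" for x
    proof -
      have "(R x)\<^sup>2 \<le> (\<integral>\<^sup>+z. ennreal (w (z - x)) \<partial>count_space UNIV) * (\<integral>\<^sup>+z. ennreal ((v z)\<^sup>2) * ennreal (w (z - x)) \<partial>count_space UNIV)"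
        unfolding R_def by (rule nn_integral_weighted_square_le) (auto simp: v0)
      also have "(\<integral>\<^sup>+z. ennreal (w (z - x)) \<partial>count_space UNIV) \<le> ennreal (1 / 4)"
        using wmass nn_integral_count_shift(1)[of "\<lambda>z. ennreal (w z)" x] by simp
      finally show ?thesis by (simp add: mult_right_mono)
    qed
    then have "(\<integral>\<^sup>+x. (R x)\<^sup>2 \<partial>count_space UNIV) \<le>
      (\<integral>\<^sup>+x. ennreal (1 / 4) * (\<integral>\<^sup>+z. ennreal ((v z)\<^sup>2) * ennreal (w (z - x)) \<partial>count_space UNIV) \<partial>count_space UNIV)"
      by (intro nn_integral_mono)
    also have "\<dots> = ennreal (1 / 4) * (\<integral>\<^sup>+x. \<integral>\<^sup>+z. ennreal ((v z)\<^sup>2) * ennreal (w (z - x)) \<partial>count_space UNIV \<partial>count_space UNIV)"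
      by (rule nn_integral_cmult) simp
    also have "\<dots> \<le> ennreal (1 / 4) * (?V * ennreal (1 / 4))"
    proof (rule mult_left_mono)
      have "(\<integral>\<^sup>+x. \<integral>\<^sup>+z. ennreal ((v z)\<^sup>2) * ennreal (w (z - x)) \<partial>count_space UNIV \<partial>count_space UNIV) =
        (\<integral>\<^sup>+z. \<integral>\<^sup>+x. ennreal ((v z)\<^sup>2) * ennreal (w (z - x)) \<partial>count_space UNIV \<partial>count_space UNIV)"
        by (rule nn_integral_count_space_nn_integral) auto
      also have "\<dots> = (\<integral>\<^sup>+z. ennreal ((v z)\<^sup>2) * (\<integral>\<^sup>+x. ennreal (w x) \<partial>count_space UNIV) \<partial>count_space UNIV)"
        using nn_integral_count_shift(2)[of "\<lambda>z. ennreal (w z)"] by (simp add: nn_integral_cmult)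
      also have "\<dots> \<le> (\<integral>\<^sup>+z. ennreal ((v z)\<^sup>2) * ennreal (1 / 4) \<partial>count_space UNIV)"
        by (intro nn_integral_mono mult_left_mono wmass) simp
      also have "\<dots> = ?V * ennreal (1 / 4)" by (rule nn_integral_multc) simp
      finally show "(\<integral>\<^sup>+x. \<integral>\<^sup>+z. ennreal ((v z)\<^sup>2) * ennreal (w (z - x)) \<partial>count_space UNIV \<partial>count_space UNIV) \<le> ?V * ennreal (1 / 4)" .
    qed simp
    also have "\<dots> = (ennreal (1 / 4) * ennreal (1 / 4)) * ?V" by (simp only: mult_ac)
    also have "ennreal (1 / 4) * ennreal (1 / 4) = ennreal (1 / 16)" by (subst ennreal_mult[symmetric]) auto
    finally show ?thesis .
  qed
  \<comment> \<open>The pointwise bound is squared: 9/16 is the square of 3/4, and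
    \<open>sq2\<close> puts a factor 2 on each square on the right.\<close>
  have "ennreal (9 / 16) * ?V = (\<integral>\<^sup>+x. ennreal (9 / 16) * ennreal ((v x)\<^sup>2) \<partial>count_space UNIV)"
    by (rule nn_integral_cmult[symmetric]) simp
  also have "\<dots> \<le> (\<integral>\<^sup>+x. 2 * ennreal ((b x)\<^sup>2) + 2 * (R x)\<^sup>2 \<partial>count_space UNIV)"
  proof (rule nn_integral_mono)
    fix x
    have "(3 / 4)\<^sup>2 \<le> (pmf Q 0)\<^sup>2" using Q0 by (intro power_mono) auto
    from mult_right_mono[OF this zero_le_power2[of "v x"]]
    have "9 / 16 * (v x)\<^sup>2 \<le> (pmf Q 0 * v x)\<^sup>2"
      by (simp add: power_mult_distrib power_divide)
    then have "ennreal (9 / 16) * ennreal ((v x)\<^sup>2) \<le> (ennreal (pmf Q 0 * v x))\<^sup>2"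
      by (simp add: ennreal_mult[symmetric] ennreal_power ennreal_leI v0)
    also have "\<dots> \<le> (ennreal (b x) + R x)\<^sup>2" by (intro power_mono pt') simp
    also have "\<dots> \<le> 2 * (ennreal (b x))\<^sup>2 + 2 * (R x)\<^sup>2" by (rule sq2)
    finally show "ennreal (9 / 16) * ennreal ((v x)\<^sup>2) \<le> 2 * ennreal ((b x)\<^sup>2) + 2 * (R x)\<^sup>2"
      by (simp add: ennreal_power b0)
  qed
  also have "\<dots> = 2 * ?A + 2 * (\<integral>\<^sup>+x. (R x)\<^sup>2 \<partial>count_space UNIV)"
    by (simp add: nn_integral_add nn_integral_cmult)
  also have "\<dots> \<le> 2 * ?A + 2 * (ennreal (1 / 16) * ?V)" by (intro add_left_mono mult_left_mono R2) simp
  finally have main: "ennreal (9 / 16) * ?V \<le> 2 * ?A + 2 * (ennreal (1 / 16) * ?V)" .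
  show ?thesis
  proof (cases "?A = \<infinity>")
    case True
    then show ?thesis by (simp add: ennreal_mult_top)
  next
    case False
    from fin obtain V where V: "?V = ennreal V" "0 \<le> V" by (cases ?V) auto
    from False obtain A where A: "?A = ennreal A" "0 \<le> A" by (cases ?A) auto
    have "ennreal (9 / 16 * V) \<le> ennreal (2 * A + 2 * (1 / 16 * V))"
    proof -
      have dbl: "ennreal (2 * r) = 2 * ennreal r" if "0 \<le> r" for r
        using ennreal_mult[of 2 r] that by simp
      have "ennreal (2 * A + 2 * (1 / 16 * V)) = ennreal (2 * A) + ennreal (2 * (1 / 16 * V))"
        using A(2) V(2) by (intro ennreal_plus) auto
      also have "\<dots> = 2 * ennreal A + 2 * (ennreal (1 / 16) * ennreal V)"
        using A(2) V(2) ennreal_mult[of "1 / 16" V] by (simp only: dbl)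
      finally show ?thesis
        using main V(2) ennreal_mult[of "9 / 16" V] unfolding V(1) A(1) by simp
    qed
    then have "9 / 16 * V \<le> 2 * A + 2 * (1 / 16 * V)" using A V by (subst (asm) ennreal_le_iff) auto
    \<comment> \<open>As \<open>V\<close> is finite, the last term can be absorbed:
      \<open>7 / 16 * V \<le> 2 * A\<close>, and 32/7 is below 5.\<close>
    then have "V \<le> 5 * A" using A(2) by linarith
    then have "ennreal V \<le> ennreal (5 * A)" by (rule ennreal_leI)
    then show ?thesis unfolding V(1) A(1) using A(2) by (simp add: ennreal_mult)
  qed
qed

section \<open>A maximal inequality for the total mass of the square\<close>

context she
begin

section \<open>Conditional expectation of the solution at a later time\<close>

text \<open>Chapman-Kolmogorov for sums over the first \<open>n\<close> sites. The inequality later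
  provides a dominating function.\<close>

lemma chapman:
  assumes "0 \<le> h" "0 \<le> s"
  shows "(\<lambda>n. \<Sum>z | to_nat z < n. pmf (P h) (z - x) * pmf (P s) (y - z)) \<longlonglongrightarrow> pmf (P (h + s)) (y - x)"
    and "(\<Sum>z | to_nat z < n. pmf (P h) (z - x) * pmf (P s) (y - z)) \<le> pmf (P (h + s)) (y - x)"
proof -
  have "(\<integral>\<^sup>+z. ennreal (pmf (P h) (z - x) * pmf (P s) (y - z)) \<partial>count_space UNIV) =
    (\<integral>\<^sup>+w. ennreal (pmf (P h) w) * ennreal (pmf (P s) (y - x - w)) \<partial>count_space UNIV)"
    using nn_integral_count_shift(1)[of "\<lambda>w. ennreal (pmf (P h) w) * ennreal (pmf (P s) (y - x - w))" x]
    by (simp add: ennreal_mult algebra_simps)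
  also have "\<dots> = ennreal (pmf (P (h + s)) (y - x))"
    by (simp add: semigroup[OF assms] pmf_conv)
  finally have e: "(\<integral>\<^sup>+z. ennreal (pmf (P h) (z - x) * pmf (P s) (y - z)) \<partial>count_space UNIV) = ennreal (pmf (P (h + s)) (y - x))" .
  show "(\<lambda>n. \<Sum>z | to_nat z < n. pmf (P h) (z - x) * pmf (P s) (y - z)) \<longlonglongrightarrow> pmf (P (h + s)) (y - x)"
    by (rule nonneg_sum_to_nat(1)[OF _ _ e]) auto
  show "(\<Sum>z | to_nat z < n. pmf (P h) (z - x) * pmf (P s) (y - z)) \<le> pmf (P (h + s)) (y - x)"
    by (rule nonneg_sum_to_nat(2)[OF _ _ e]) (auto simp: finite_to_nat_lessThan)
qed

lemma a_semigroup:
  assumes "0 \<le> h" "0 \<le> s"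
  shows "(\<lambda>n. \<Sum>z | to_nat z < n. pmf (P h) (z - x) * a s z) \<longlonglongrightarrow> a (h + s) x"
proof (rule nonneg_sum_to_nat(1)[OF _ a_nonneg])
  show "0 \<le> pmf (P h) (z - x) * a s z" for z by (simp add: a_nonneg)
  have ch: "(\<integral>\<^sup>+z. ennreal (pmf (P h) (z - x)) * ennreal (pmf (P s) (y - z)) \<partial>count_space UNIV) = ennreal (pmf (P (h + s)) (y - x))" for y
    using nn_integral_count_shift(1)[of "\<lambda>w. ennreal (pmf (P h) w) * ennreal (pmf (P s) (y - x - w))" x]
    by (simp add: semigroup[OF assms] pmf_conv algebra_simps)
  have "(\<integral>\<^sup>+z. ennreal (pmf (P h) (z - x) * a s z) \<partial>count_space UNIV) =
    (\<integral>\<^sup>+z. \<integral>\<^sup>+y. ennreal (pmf (P h) (z - x)) * ennreal (pmf (P s) (y - z)) * ennreal (u0 y) \<partial>count_space UNIV \<partial>count_space UNIV)"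
    by (intro nn_integral_cong) (simp add: ennreal_mult a_nonneg ennreal_a nn_integral_cmult[symmetric] mult.assoc)
  also have "\<dots> = (\<integral>\<^sup>+y. \<integral>\<^sup>+z. ennreal (pmf (P h) (z - x)) * ennreal (pmf (P s) (y - z)) * ennreal (u0 y) \<partial>count_space UNIV \<partial>count_space UNIV)"
    by (rule nn_integral_count_space_nn_integral) auto
  also have "\<dots> = (\<integral>\<^sup>+y. ennreal (pmf (P (h + s)) (y - x)) * ennreal (u0 y) \<partial>count_space UNIV)"
    by (intro nn_integral_cong) (simp add: nn_integral_multc ch)
  also have "\<dots> = ennreal (a (h + s) x)" by (rule ennreal_a[symmetric])
  finally show "(\<integral>\<^sup>+z. ennreal (pmf (P h) (z - x) * a s z) \<partial>count_space UNIV) = ennreal (a (h + s) x)" .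
qed

text \<open>The integrand of \<open>u (h + s) x\<close> minus a finite average of the integrands of
  \<open>u s z\<close>. Up to time \<open>s\<close> it tends to 0 with \<open>n\<close>, and what it
  does after \<open>s\<close> is orthogonal to \<open>F s\<close>; this encodes the conditional
  expectation of \<open>u (h + s) x\<close> given \<open>F s\<close>.\<close>

definition gap :: "real \<Rightarrow> real \<Rightarrow> 'i \<Rightarrow> nat \<Rightarrow> 'i \<times> real \<times> 'w \<Rightarrow> real" where
  "gap h s x n q = g (h + s) x q - (\<Sum>z | to_nat z < n. pmf (P h) (z - x) * g s z q)"

lemma ito_gap:
  assumes "0 \<le> h" "0 \<le> s"
  shows "ito (gap h s x n) (\<lambda>\<omega>. (u (h + s) x \<omega> - a (h + s) x) -
    (\<Sum>z | to_nat z < n. pmf (P h) (z - x) * (u s z \<omega> - a s z)))"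
proof -
  have "ito (\<lambda>q. g (h + s) x q - (\<Sum>z | to_nat z < n. pmf (P h) (z - x) * g s z q))
    (\<lambda>\<omega>. (u (h + s) x \<omega> - a (h + s) x) - (\<Sum>z | to_nat z < n. pmf (P h) (z - x) * (u s z \<omega> - a s z)))"
    using assms by (intro ito_diff ito_sum ito_cmult ito_mild) auto
  then show ?thesis unfolding gap_def[abs_def] .
qed

text \<open>For times \<open>r \<le> s\<close> the gap is a Chapman-Kolmogorov remainder times
  \<open>\<sigma> (u r y \<omega>)\<close>. The remainder lies between 0 and the kernel of
  \<open>g (h + s) x\<close>, so dominated convergence applies.\<close>

lemma gap_tendsto:
  assumes hs: "0 \<le> h" "0 \<le> s"
  shows "(\<lambda>n. L2_norm K (trunc s (gap h s x n))) \<longlonglongrightarrow> 0"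
proof (rule L2_norm_dominated_convergence[OF g_sq_integrable])
  show "0 \<le> h + s" using hs by simp
  show "trunc s (gap h s x n) \<in> borel_measurable K" for n
    by (rule sq_integrable_measurable[OF sq_integrable_trunc[OF ito_sq_integrable(1)[OF ito_gap[OF hs]]]])
  let ?d = "\<lambda>n r y. pmf (P (h + (s - r))) (y - x) - (\<Sum>z | to_nat z < n. pmf (P h) (z - x) * pmf (P (s - r)) (y - z))"
  have eq: "trunc s (gap h s x n) (y, r, \<omega>) = (if 0 \<le> r \<and> r \<le> s then ?d n r y * \<sigma> (u r y \<omega>) else 0)" for n y r \<omega>
  proof -
    have "h + s - r = h + (s - r)" by simp
    then show ?thesis using hs
      by (auto simp: trunc_def gap_def g_def sum_distrib_right left_diff_distrib mult.assoc add_diff_eq)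
  qed
  show "\<bar>trunc s (gap h s x n) q\<bar> \<le> \<bar>g (h + s) x q\<bar>" for n q
  proof -
    obtain y r \<omega> where q: "q = (y, r, \<omega>)" by (metis prod_cases3)
    show ?thesis
    proof (cases "0 \<le> r \<and> r \<le> s")
      case True
      have "0 \<le> ?d n r y" using chapman(2)[where h=h and s="s - r" and n=n and x=x and y=y] hs True by simp
      moreover have "?d n r y \<le> pmf (P (h + (s - r))) (y - x)"
        by (simp add: sum_nonneg)
      ultimately show ?thesis using True hs
        unfolding q eq by (simp add: g_def abs_mult mult_right_mono add_diff_eq)
    qed (auto simp: q eq)
  qed
  show "(\<lambda>n. trunc s (gap h s x n) q) \<longlonglongrightarrow> 0" for q
  proof -
    obtain y r \<omega> where q: "q = (y, r, \<omega>)" by (metis prod_cases3)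
    show ?thesis
    proof (cases "0 \<le> r \<and> r \<le> s")
      case True
      have "(\<lambda>n. ?d n r y * \<sigma> (u r y \<omega>)) \<longlonglongrightarrow> (pmf (P (h + (s - r))) (y - x) - pmf (P (h + (s - r))) (y - x)) * \<sigma> (u r y \<omega>)"
        using hs True by (intro tendsto_intros chapman(1)) auto
      then show ?thesis using True by (simp add: q eq)
    qed (auto simp: q eq)
  qed
qed

definition energy :: "real \<Rightarrow> 'w \<Rightarrow> ennreal" where
  "energy t \<omega> = (\<integral>\<^sup>+x. ennreal ((u t x \<omega>)\<^sup>2) \<partial>count_space UNIV)"

lemma energy_adapted: "0 \<le> t \<Longrightarrow> energy t \<in> borel_measurable (F t)"
  unfolding energy_def[abs_def] using u_adapted
  by (intro measurable_nn_integral_count measurable_compose[OF _ measurable_ennreal] borel_measurable_power) auto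

lemma energy_measurable: "0 \<le> t \<Longrightarrow> energy t \<in> borel_measurable M"
  by (rule bm_filtration_measurableD[OF energy_adapted])

lemma energy_integral: "0 \<le> t \<Longrightarrow> (\<integral>\<^sup>+\<omega>. energy t \<omega> \<partial>M) = U t"
proof -
  assume t: "0 \<le> t"
  note [measurable] = u_measurable[OF t]
  show ?thesis unfolding energy_def U_def m_eq[OF t]
    by (rule nn_integral_count_space_nn_integral) auto
qed

lemma sets_F_subset: "sets (F s) \<subseteq> sets M"
  using sets_bm_filtration_subset_past_except[of s "s + 1"] sets_past_except_subset by (meson less_add_one subset_trans)

text \<open>Testing \<open>u\<^sub>h\<^sub>+\<^sub>s(x)\<close> against \<open>1\<^sub>A u\<^sub>s(x)\<close> replaces it by its conditional expectation, the average of \<open>u\<^sub>s\<close> over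
  the walk at time \<open>h\<close> started at \<open>x\<close>, whose contribution from \<open>x\<close> itself dominates.\<close>

lemma restricted_norm_le:
  assumes hs: "0 \<le> h" "0 \<le> s" and A: "A \<in> sets (F s)"
  defines "\<mu> \<equiv> \<lambda>z. L2_norm M (\<lambda>\<omega>. indicator A \<omega> * u s z \<omega>)"
    and "\<nu> \<equiv> \<lambda>z. L2_norm M (\<lambda>\<omega>. indicator A \<omega> * u (h + s) z \<omega>)"
  shows "ennreal (pmf (P h) 0 * \<mu> x) \<le> ennreal (\<nu> x) +
    (\<integral>\<^sup>+z. ennreal (\<mu> z) * ennreal (if z = x then 0 else pmf (P h) (z - x)) \<partial>count_space UNIV)"
proof (cases "\<mu> x = 0")
  case False
  then have \<mu>x: "0 < \<mu> x" using L2_norm_nonneg[of M] by (simp add: \<mu>_def less_le)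
  have AM: "A \<in> sets M" using A sets_F_subset by blast
  define Y where "Y z \<omega> = indicator A \<omega> * u s z \<omega>" for z \<omega>
  have us: "sq_integrable M (u s z)" for z by (rule sq_integrable_u[OF hs(2)])
  have uc: "sq_integrable M (u (h + s) x)" using hs by (intro sq_integrable_u) simp
  have Y: "sq_integrable M (Y z)" for z
    unfolding Y_def[abs_def] by (rule sq_integrable_indicator[OF us AM])
  have YF: "Y x \<in> borel_measurable (F s)"
    unfolding Y_def[abs_def] using A u_adapted[OF hs(2)] by measurable
  have \<mu>Y: "\<mu> z = L2_norm M (Y z)" for z unfolding \<mu>_def Y_def[abs_def] ..
  have \<mu>0: "0 \<le> \<mu> z" for z by (simp add: \<mu>_def)
  have YY: "expectation (\<lambda>\<omega>. Y x \<omega> * u s z \<omega>) = expectation (\<lambda>\<omega>. Y x \<omega> * Y z \<omega>)" for z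
    by (rule Bochner_Integration.integral_cong) (auto simp: Y_def indicator_def)
  define d where "d n = a (h + s) x - (\<Sum>z | to_nat z < n. pmf (P h) (z - x) * a s z)" for n
  \<comment> \<open>The error of truncating to \<open>n\<close> sites: \<open>d n\<close> stems from
    the initial profile, the other term from the stochastic integrals.\<close>
  define e where "e n = \<bar>d n\<bar> + L2_norm K (trunc s (gap h s x n))" for n
  have "e \<longlonglongrightarrow> \<bar>a (h + s) x - a (h + s) x\<bar> + 0"
    unfolding e_def[abs_def] d_def by (intro tendsto_intros a_semigroup gap_tendsto hs)
  then have e0: "e \<longlonglongrightarrow> 0" by simp
  \<comment> \<open>A finite version; the limit in the extended nonnegative reals at the end avoids
    any question of summability for \<open>\<mu>\<close>.\<close>
  have le: "pmf (P h) 0 * \<mu> x \<le> \<nu> x + e n + (\<Sum>z\<in>{z. to_nat z < n} - {x}. pmf (P h) (z - x) * \<mu> z)"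
    if n: "to_nat x < n" for n
  proof -
    let ?X = "{z::'i. to_nat z < n}"
    let ?I = "\<lambda>\<omega>. (u (h + s) x \<omega> - a (h + s) x) - (\<Sum>z\<in>?X. pmf (P h) (z - x) * (u s z \<omega> - a s z))"
    note I = ito_gap[OF hs, of x n]
    have int: "integrable M (\<lambda>\<omega>. Y x \<omega> * u s z \<omega>)" for z by (rule sq_integrable_mult[OF Y us])
    have one: "sq_integrable M (\<lambda>\<omega>. 1)" by (simp add: sq_integrable_def)
    have "L2_norm M (\<lambda>\<omega>. 1) = 1" by (simp add: L2_norm_def prob_space)
    then have EY: "\<bar>expectation (Y x)\<bar> \<le> \<mu> x"
      using Cauchy_Schwarz_integral[OF Y[of x] one] by (simp add: \<mu>Y)
    have b1: "\<bar>d n * expectation (Y x)\<bar> \<le> \<mu> x * \<bar>d n\<bar>"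
      using mult_left_mono[OF EY, of "\<bar>d n\<bar>"] by (simp add: abs_mult mult.commute)
    have b2: "\<bar>expectation (\<lambda>\<omega>. Y x \<omega> * ?I \<omega>)\<bar> \<le> \<mu> x * L2_norm K (trunc s (gap h s x n))"
      unfolding \<mu>Y by (rule ito_past_bound[OF YF Y hs(2) I])
    have b3: "expectation (\<lambda>\<omega>. Y x \<omega> * u (h + s) x \<omega>) \<le> \<mu> x * \<nu> x"
    proof -
      have "expectation (\<lambda>\<omega>. Y x \<omega> * u (h + s) x \<omega>) = expectation (\<lambda>\<omega>. Y x \<omega> * (indicator A \<omega> * u (h + s) x \<omega>))"
        by (rule Bochner_Integration.integral_cong) (auto simp: Y_def indicator_def)
      then show ?thesis
        using Cauchy_Schwarz_integral[OF Y[of x] sq_integrable_indicator[OF uc AM]] by (simp add: \<mu>Y \<nu>_def)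
    qed
    \<comment> \<open>Terms with \<open>z \<noteq> x\<close> may have either sign; after a second
      indicator is inserted, Cauchy-Schwarz bounds them from below.\<close>
    have b4: "- (\<mu> x * \<mu> z) \<le> expectation (\<lambda>\<omega>. Y x \<omega> * u s z \<omega>)" for z
      using Cauchy_Schwarz_integral[OF Y[of x] Y[of z]] unfolding YY \<mu>Y by linarith
    have "expectation (\<lambda>\<omega>. Y x \<omega> * u (h + s) x \<omega>) =
      expectation (\<lambda>\<omega>. (\<Sum>z\<in>?X. pmf (P h) (z - x) * (Y x \<omega> * u s z \<omega>)) + d n * Y x \<omega> + Y x \<omega> * ?I \<omega>)"
    proof (rule Bochner_Integration.integral_cong)
      fix \<omega>
      have eq1: "u (h + s) x \<omega> = (\<Sum>z\<in>?X. pmf (P h) (z - x) * u s z \<omega>) + d n + ?I \<omega>"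
        by (simp add: d_def sum_subtractf right_diff_distrib)
      have eq2: "Y x \<omega> * ((\<Sum>z\<in>?X. pmf (P h) (z - x) * u s z \<omega>) + d n + c) =
        (\<Sum>z\<in>?X. pmf (P h) (z - x) * (Y x \<omega> * u s z \<omega>)) + d n * Y x \<omega> + Y x \<omega> * c" for c
        by (simp add: distrib_left sum_distrib_left mult.left_commute mult.commute[of "d n"])
      show "Y x \<omega> * u (h + s) x \<omega> =
        (\<Sum>z\<in>?X. pmf (P h) (z - x) * (Y x \<omega> * u s z \<omega>)) + d n * Y x \<omega> + Y x \<omega> * ?I \<omega>"
        by (rule trans[OF arg_cong[OF eq1, of "\<lambda>v. Y x \<omega> * v"] eq2])
    qed simp
    also have "\<dots> = (\<Sum>z\<in>?X. pmf (P h) (z - x) * expectation (\<lambda>\<omega>. Y x \<omega> * u s z \<omega>)) + d n * expectation (Y x) +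
      expectation (\<lambda>\<omega>. Y x \<omega> * ?I \<omega>)"
      using int sq_integrable_mult[OF Y ito_sq_integrable(2)[OF I]] sq_integrable_integrable[OF Y]
      by (subst Bochner_Integration.integral_add) (auto simp del: distrib_left right_diff_distrib)
    also have "(\<Sum>z\<in>?X. pmf (P h) (z - x) * expectation (\<lambda>\<omega>. Y x \<omega> * u s z \<omega>)) =
      pmf (P h) 0 * (\<mu> x)\<^sup>2 + (\<Sum>z\<in>?X - {x}. pmf (P h) (z - x) * expectation (\<lambda>\<omega>. Y x \<omega> * u s z \<omega>))"
      using n by (subst sum.remove[of _ x]) (auto simp: finite_to_nat_lessThan YY \<mu>Y L2_norm_sq power2_eq_square[of "Y x _"])
    finally have eq: "expectation (\<lambda>\<omega>. Y x \<omega> * u (h + s) x \<omega>) = pmf (P h) 0 * (\<mu> x)\<^sup>2 +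
      (\<Sum>z\<in>?X - {x}. pmf (P h) (z - x) * expectation (\<lambda>\<omega>. Y x \<omega> * u s z \<omega>)) +
      d n * expectation (Y x) + expectation (\<lambda>\<omega>. Y x \<omega> * ?I \<omega>)" .
    have "(\<Sum>z\<in>?X - {x}. pmf (P h) (z - x) * - (\<mu> x * \<mu> z)) \<le>
      (\<Sum>z\<in>?X - {x}. pmf (P h) (z - x) * expectation (\<lambda>\<omega>. Y x \<omega> * u s z \<omega>))"
      by (intro sum_mono mult_left_mono b4) simp
    then have "pmf (P h) 0 * (\<mu> x)\<^sup>2 + (\<Sum>z\<in>?X - {x}. pmf (P h) (z - x) * - (\<mu> x * \<mu> z)) \<le> \<mu> x * \<nu> x + \<mu> x * e n"
      using abs_le_D2[OF b1] abs_le_D2[OF b2] b3 unfolding eq e_def distrib_left by linarith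
    then have "\<mu> x * (pmf (P h) 0 * \<mu> x) \<le> \<mu> x * (\<nu> x + e n + (\<Sum>z\<in>?X - {x}. pmf (P h) (z - x) * \<mu> z))"
      by (simp add: sum_negf sum_distrib_left power2_eq_square algebra_simps)
    \<comment> \<open>Every term carries a factor \<open>\<mu> x\<close>, positive in this case,
      which is divided out.\<close>
    then show ?thesis using \<mu>x by simp
  qed
  show ?thesis
  proof (rule LIMSEQ_le_const)
    let ?R = "\<integral>\<^sup>+z. ennreal (\<mu> z) * ennreal (if z = x then 0 else pmf (P h) (z - x)) \<partial>count_space UNIV"
    have "(\<lambda>n. ennreal (\<nu> x + e n) + ?R) \<longlonglongrightarrow> ennreal (\<nu> x + 0) + ?R"
      by (intro tendsto_intros e0)
    then show "(\<lambda>n. ennreal (\<nu> x + e n) + ?R) \<longlonglongrightarrow> ennreal (\<nu> x) + ?R" by simp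
    have "ennreal (pmf (P h) 0 * \<mu> x) \<le> ennreal (\<nu> x + e n) + ?R" if n: "to_nat x < n" for n
    proof -
      let ?X = "{z::'i. to_nat z < n} - {x}"
      have "ennreal (pmf (P h) 0 * \<mu> x) \<le> ennreal (\<nu> x + e n + (\<Sum>z\<in>?X. pmf (P h) (z - x) * \<mu> z))"
        by (rule ennreal_leI[OF le[OF n]])
      also have "\<dots> = ennreal (\<nu> x + e n) + (\<Sum>z\<in>?X. ennreal (\<mu> z) * ennreal (if z = x then 0 else pmf (P h) (z - x)))"
        by (subst ennreal_plus)
          (auto simp: \<nu>_def e_def \<mu>0 sum_nonneg sum_ennreal[symmetric] ennreal_mult mult.commute intro!: sum.cong)
      also have "\<dots> \<le> ennreal (\<nu> x + e n) + ?R"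
        by (intro add_left_mono sum_le_nn_integral_count) (simp add: finite_to_nat_lessThan)
      finally show ?thesis .
    qed
    then show "\<exists>n0. \<forall>n\<ge>n0. ennreal (pmf (P h) 0 * \<mu> x) \<le> ennreal (\<nu> x + e n) + ?R"
      by (intro exI[of _ "Suc (to_nat x)"]) auto
  qed
qed simp

section \<open>Comparison with a later time and a bound of Doob type\<close>

text \<open>The norms of \<open>u\<close> restricted to \<open>A\<close> at the two times satisfy
  the hypothesis of \<open>averaging_lower_bound\<close>. Having an arbitrary event \<open>A\<close>
  of \<open>F s\<close> makes this a submartingale inequality up to the factor 5.\<close>

lemma energy_conditional:
  assumes s: "0 \<le> s" "s \<le> c" "c \<le> s + 1 / 4" and A: "A \<in> sets (F s)"
  shows "(\<integral>\<^sup>+\<omega>. indicator A \<omega> * energy s \<omega> \<partial>M) \<le> 5 * (\<integral>\<^sup>+\<omega>. indicator A \<omega> * energy c \<omega> \<partial>M)"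
proof -
  define h where "h = c - s"
  have h: "0 \<le> h" "h \<le> 1 / 4" "h + s = c" using s by (auto simp: h_def)
  have AM [measurable]: "A \<in> sets M" using A sets_F_subset by blast
  \<comment> \<open>\<open>exp (- h) \<ge> 1 - h\<close> and \<open>h \<le> 1 / 4\<close>.\<close>
  have stay: "3 / 4 \<le> pmf (P h) 0"
    using P_stay[OF h(1)] exp_ge_add_one_self[of "- h"] h(2) by linarith
  have e: "(\<integral>\<^sup>+\<omega>. indicator A \<omega> * energy t \<omega> \<partial>M) =
    (\<integral>\<^sup>+x. ennreal ((L2_norm M (\<lambda>\<omega>. indicator A \<omega> * u t x \<omega>))\<^sup>2) \<partial>count_space UNIV)" if t: "0 \<le> t" for t
  proof -
    note [measurable] = u_measurable[OF t]
    have "(\<integral>\<^sup>+\<omega>. indicator A \<omega> * energy t \<omega> \<partial>M) = (\<integral>\<^sup>+\<omega>. \<integral>\<^sup>+x. ennreal ((indicator A \<omega> * u t x \<omega>)\<^sup>2) \<partial>count_space UNIV \<partial>M)"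
      by (intro nn_integral_cong) (auto simp: energy_def indicator_def)
    also have "\<dots> = (\<integral>\<^sup>+x. \<integral>\<^sup>+\<omega>. ennreal ((indicator A \<omega> * u t x \<omega>)\<^sup>2) \<partial>M \<partial>count_space UNIV)"
      by (rule nn_integral_count_space_nn_integral) auto
    finally show ?thesis
      by (simp add: L2_norm_nn_integral[OF sq_integrable_indicator[OF sq_integrable_u[OF t] AM]])
  qed
  have "(\<integral>\<^sup>+\<omega>. indicator A \<omega> * energy s \<omega> \<partial>M) \<le> (\<integral>\<^sup>+\<omega>. energy s \<omega> \<partial>M)"
    by (intro nn_integral_mono) (auto simp: indicator_def)
  also have "\<dots> < \<infinity>" using energy_integral U_finite s(1) by simp
  finally show ?thesis
    using s restricted_norm_le[OF h(1) s(1) A] unfolding h(3)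
    by (subst (1 2) e) (auto simp: e intro!: averaging_lower_bound[OF stay])
qed

text \<open>The event is split by the first time in \<open>T\<close> at which the level is reached.
  Each piece is known at its time, so its energy can be compared with that at the common time
  \<open>c\<close>, where the disjoint pieces together carry at most \<open>U c\<close>.\<close>

lemma energy_maximal_finite:
  assumes T: "finite T" "\<And>t. t \<in> T \<Longrightarrow> 0 \<le> t \<and> t \<le> c \<and> c \<le> t + 1 / 4" and c: "0 \<le> c"
  shows "ennreal \<epsilon> * emeasure M {\<omega>\<in>space M. \<exists>t\<in>T. ennreal \<epsilon> \<le> energy t \<omega>} \<le> 5 * U c"
proof -
  let ?D = "\<lambda>t. {\<omega>\<in>space M. ennreal \<epsilon> \<le> energy t \<omega>}"
  let ?E = "\<lambda>t. ?D t - (\<Union>s\<in>{s\<in>T. s < t}. ?D s)"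
  have D: "?D s \<in> sets (F t)" if "0 \<le> s" "s \<le> t" for s t
  proof -
    have "energy s \<in> borel_measurable (F t)" by (rule bm_filtration_mono[OF energy_adapted[OF that(1)] that(2)])
    then have "{\<omega>\<in>space (F t). ennreal \<epsilon> \<le> energy s \<omega>} \<in> sets (F t)" by measurable
    then show ?thesis by simp
  qed
  have E: "?E t \<in> sets (F t)" if "t \<in> T" for t
    using T that by (intro sets.Diff sets.finite_UN D) auto
  then have EM: "?E t \<in> sets M" if "t \<in> T" for t using that sets_F_subset by blast
  have dj: "disjoint_family_on ?E T"
    unfolding disjoint_family_on_def by (auto simp: not_less) (metis order.antisym)
  have un: "{\<omega>\<in>space M. \<exists>t\<in>T. ennreal \<epsilon> \<le> energy t \<omega>} = (\<Union>t\<in>T. ?E t)"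
  proof (intro equalityI subsetI)
    fix \<omega> assume \<omega>: "\<omega> \<in> {\<omega>\<in>space M. \<exists>t\<in>T. ennreal \<epsilon> \<le> energy t \<omega>}"
    let ?T = "{t\<in>T. ennreal \<epsilon> \<le> energy t \<omega>}"
    have ne: "?T \<noteq> {}" "finite ?T" using \<omega> T by auto
    then have "Min ?T \<in> ?T" by (intro Min_in)
    moreover have "\<not> ennreal \<epsilon> \<le> energy s \<omega>" if "s \<in> T" "s < Min ?T" for s
      using that ne Min_le[of ?T s] by auto
    ultimately show "\<omega> \<in> (\<Union>t\<in>T. ?E t)" using \<omega> by (intro UN_I[of "Min ?T"]) auto
  qed auto
  have "ennreal \<epsilon> * emeasure M {\<omega>\<in>space M. \<exists>t\<in>T. ennreal \<epsilon> \<le> energy t \<omega>} = (\<Sum>t\<in>T. ennreal \<epsilon> * emeasure M (?E t))"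
    unfolding un sum_distrib_left[symmetric] using EM dj T(1) by (subst sum_emeasure[symmetric]) auto
  also have "\<dots> \<le> (\<Sum>t\<in>T. 5 * (\<integral>\<^sup>+\<omega>. indicator (?E t) \<omega> * energy c \<omega> \<partial>M))"
  proof (rule sum_mono)
    fix t assume t: "t \<in> T"
    have "ennreal \<epsilon> * emeasure M (?E t) = (\<integral>\<^sup>+\<omega>. ennreal \<epsilon> * indicator (?E t) \<omega> \<partial>M)"
      using EM[OF t] by (simp add: nn_integral_cmult_indicator)
    also have "\<dots> \<le> (\<integral>\<^sup>+\<omega>. indicator (?E t) \<omega> * energy t \<omega> \<partial>M)"
      by (intro nn_integral_mono) (auto simp: indicator_def)
    also have "\<dots> \<le> 5 * (\<integral>\<^sup>+\<omega>. indicator (?E t) \<omega> * energy c \<omega> \<partial>M)"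
      using T(2)[OF t] E[OF t] by (intro energy_conditional) auto
    finally show "ennreal \<epsilon> * emeasure M (?E t) \<le> 5 * (\<integral>\<^sup>+\<omega>. indicator (?E t) \<omega> * energy c \<omega> \<partial>M)" .
  qed
  also have "\<dots> = 5 * (\<integral>\<^sup>+\<omega>. (\<Sum>t\<in>T. indicator (?E t) \<omega> * energy c \<omega>) \<partial>M)"
    using EM energy_measurable[OF c] by (subst nn_integral_sum) (auto simp: sum_distrib_left)
  also have "\<dots> \<le> 5 * (\<integral>\<^sup>+\<omega>. energy c \<omega> \<partial>M)"
  proof (intro mult_left_mono nn_integral_mono)
    fix \<omega>
    have "(\<Sum>t\<in>T. indicator (?E t) \<omega> :: ennreal) = indicator (\<Union>t\<in>T. ?E t) \<omega>"
      using dj T(1) by (rule indicator_UN_disjoint[symmetric, rotated])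
    then show "(\<Sum>t\<in>T. indicator (?E t) \<omega> * energy c \<omega>) \<le> energy c \<omega>"
      unfolding sum_distrib_right[symmetric] by (auto simp: indicator_def)
  qed simp
  finally show ?thesis using energy_integral[OF c] by simp
qed

end

section \<open>Almost sure dissipation\<close>

context she
begin

lemma energy_maximal_countable:
  assumes Q: "countable Q" "Q \<noteq> {}" "\<And>t. t \<in> Q \<Longrightarrow> 0 \<le> t \<and> t \<le> c \<and> c \<le> t + 1 / 4" and c: "0 \<le> c"
  shows "{\<omega>\<in>space M. \<exists>t\<in>Q. ennreal \<epsilon> \<le> energy t \<omega>} \<in> sets M"
    and "ennreal \<epsilon> * emeasure M {\<omega>\<in>space M. \<exists>t\<in>Q. ennreal \<epsilon> \<le> energy t \<omega>} \<le> 5 * U c"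
proof -
  let ?T = "\<lambda>n::nat. from_nat_into Q ` {..n}"
  let ?D = "\<lambda>n. {\<omega>\<in>space M. \<exists>t\<in>?T n. ennreal \<epsilon> \<le> energy t \<omega>}"
  have T: "?T n \<subseteq> Q" for n using from_nat_into[OF Q(2)] by auto
  have Dm: "?D n \<in> sets M" for n
  proof (rule sets.sets_Collect_finite_Ex)
    fix t assume "t \<in> ?T n"
    then have "0 \<le> t" using T Q(3) by blast
    note [measurable] = energy_measurable[OF this]
    show "{\<omega>\<in>space M. ennreal \<epsilon> \<le> energy t \<omega>} \<in> sets M" by measurable
  qed simp
  have inc: "incseq ?D" by (rule incseq_SucI) auto
  have un: "{\<omega>\<in>space M. \<exists>t\<in>Q. ennreal \<epsilon> \<le> energy t \<omega>} = (\<Union>n. ?D n)"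
  proof (intro equalityI subsetI)
    fix \<omega> assume "\<omega> \<in> {\<omega>\<in>space M. \<exists>t\<in>Q. ennreal \<epsilon> \<le> energy t \<omega>}"
    then obtain t where t: "\<omega> \<in> space M" "t \<in> Q" "ennreal \<epsilon> \<le> energy t \<omega>" by blast
    from from_nat_into_surj[OF Q(1) t(2)] obtain n where "from_nat_into Q n = t" by blast
    then show "\<omega> \<in> (\<Union>n. ?D n)" using t by (intro UN_I[of n]) auto
  next
    fix \<omega> assume "\<omega> \<in> (\<Union>n. ?D n)"
    then show "\<omega> \<in> {\<omega>\<in>space M. \<exists>t\<in>Q. ennreal \<epsilon> \<le> energy t \<omega>}" using T by blast
  qed
  show "{\<omega>\<in>space M. \<exists>t\<in>Q. ennreal \<epsilon> \<le> energy t \<omega>} \<in> sets M"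
    unfolding un using Dm by (intro sets.countable_UN) auto
  have "emeasure M (\<Union>n. ?D n) = (SUP n. emeasure M (?D n))"
    using Dm inc by (intro SUP_emeasure_incseq[symmetric]) auto
  then have "ennreal \<epsilon> * emeasure M {\<omega>\<in>space M. \<exists>t\<in>Q. ennreal \<epsilon> \<le> energy t \<omega>} = (SUP n. ennreal \<epsilon> * emeasure M (?D n))"
    unfolding un by (simp add: SUP_mult_left_ennreal)
  also have "\<dots> \<le> 5 * U c"
  proof (rule SUP_least)
    fix n
    show "ennreal \<epsilon> * emeasure M (?D n) \<le> 5 * U c"
      by (rule energy_maximal_finite[OF _ _ c]) (use T Q(3) in blast)+
  qed
  finally show "ennreal \<epsilon> * emeasure M {\<omega>\<in>space M. \<exists>t\<in>Q. ennreal \<epsilon> \<le> energy t \<omega>} \<le> 5 * U c" .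
qed

text \<open>Rational times make the block countable. Its length 1/8 leaves room for a following
  window of length 1/8 whose times are within 1/4 of every point of the block.\<close>

definition grid :: "nat \<Rightarrow> real set" where
  "grid k = \<rat> \<inter> {real k / 8..(real k + 1) / 8}"

definition exceed :: "real \<Rightarrow> nat \<Rightarrow> 'w set" where
  "exceed \<epsilon> k = {\<omega>\<in>space M. \<exists>t\<in>grid k. ennreal \<epsilon> \<le> energy t \<omega>}"

lemma grid_countable: "countable (grid k)"
  unfolding grid_def by (intro countable_Int1 countable_rat)

lemma grid_nonempty: "grid k \<noteq> {}"
proof -
  have "real k / 8 \<in> grid k" by (simp add: grid_def)
  then show ?thesis by blast
qed

lemma exceed_measurable: "exceed \<epsilon> k \<in> sets M"
  unfolding exceed_def
  by (rule energy_maximal_countable(1)[of _ "(real k + 1) / 8", OF grid_countable grid_nonempty])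
    (auto simp: grid_def field_simps)

lemma exceed_le:
  assumes "(real k + 1) / 8 \<le> c" "c < (real k + 2) / 8"
  shows "ennreal \<epsilon> * emeasure M (exceed \<epsilon> k) \<le> 5 * U c"
  unfolding exceed_def
proof (rule energy_maximal_countable(2)[OF grid_countable grid_nonempty])
  show "0 \<le> c" using assms(1) by (rule order_trans[rotated]) simp
  fix t assume "t \<in> grid k"
  then have t: "real k / 8 \<le> t" "t \<le> (real k + 1) / 8" by (auto simp: grid_def)
  have "0 \<le> real k / 8" by simp
  then have "0 \<le> t" "t \<le> c" using t assms(1) by linarith+
  moreover have "c \<le> t + 1 / 4" using t(1) assms(2) by (simp add: add_divide_distrib)
  ultimately show "0 \<le> t \<and> t \<le> c \<and> c \<le> t + 1 / 4" by simp
qed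

text \<open>The bound at a single later time is averaged over a window of times, so that the
  integrability of the total second moment gives summability.\<close>

lemma exceed_summable:
  assumes "0 < \<epsilon>"
  shows "summable (\<lambda>k. measure M (exceed \<epsilon> k))"
proof -
  let ?J = "\<lambda>k::nat. {(real k + 1) / 8..<(real k + 2) / 8}"
  have k: "ennreal (\<epsilon> / 8) * emeasure M (exceed \<epsilon> k) \<le> 5 * (\<integral>\<^sup>+c. U c * indicator (?J k) c \<partial>lborel)" for k
  proof -
    have len: "emeasure lborel (?J k) = ennreal (1 / 8)"
      by (subst emeasure_lborel_Ico) (simp_all add: diff_divide_distrib[symmetric])
    have "ennreal (\<epsilon> / 8) = ennreal \<epsilon> * ennreal (1 / 8)"
      using assms ennreal_mult[of \<epsilon> "1 / 8"] by simp
    then have "ennreal (\<epsilon> / 8) * emeasure M (exceed \<epsilon> k) = (ennreal \<epsilon> * emeasure M (exceed \<epsilon> k)) * emeasure lborel (?J k)"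
      unfolding len by (simp only: mult_ac)
    also have "\<dots> = (\<integral>\<^sup>+c. (ennreal \<epsilon> * emeasure M (exceed \<epsilon> k)) * indicator (?J k) c \<partial>lborel)"
      by (simp add: nn_integral_cmult_indicator)
    also have "\<dots> \<le> (\<integral>\<^sup>+c. 5 * (U c * indicator (?J k) c) \<partial>lborel)"
      by (intro nn_integral_mono) (auto simp: indicator_def intro: exceed_le)
    also have "\<dots> = 5 * (\<integral>\<^sup>+c. U c * indicator (?J k) c \<partial>lborel)"
      using U_measurable by (intro nn_integral_cmult) auto
    finally show ?thesis .
  qed
  have dj: "disjoint_family ?J"
    unfolding disjoint_family_on_def
  proof (intro ballI impI)
    have less: "?J i \<inter> ?J j = {}" if "i < j" for i j :: nat
    proof -
      have "(real i + 2) / 8 \<le> (real j + 1) / 8" using that by simp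
      then show ?thesis by auto
    qed
    fix i j :: nat assume "i \<noteq> j"
    then show "?J i \<inter> ?J j = {}" using less[of i j] less[of j i] by (cases "i < j") auto
  qed
  have "(\<Sum>k. ennreal (\<epsilon> / 8) * emeasure M (exceed \<epsilon> k)) \<le> (\<Sum>k. 5 * (\<integral>\<^sup>+c. U c * indicator (?J k) c \<partial>lborel))"
    by (intro suminf_le k) auto
  also have "\<dots> = 5 * (\<integral>\<^sup>+c. (\<Sum>k. U c * indicator (?J k) c) \<partial>lborel)"
  proof -
    have "(\<integral>\<^sup>+c. (\<Sum>k. U c * indicator (?J k) c) \<partial>lborel) = (\<Sum>k. \<integral>\<^sup>+c. U c * indicator (?J k) c \<partial>lborel)"
      using U_measurable by (intro nn_integral_suminf) auto
    then show ?thesis by (simp only: ennreal_suminf_cmult)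
  qed
  also have "\<dots> \<le> 5 * (\<integral>\<^sup>+c. U c \<partial>lborel)"
  proof (intro mult_left_mono nn_integral_mono)
    fix c
    have "(\<Sum>k. indicator (?J k) c :: ennreal) = indicator (\<Union>k. ?J k) c"
      by (rule suminf_indicator[OF dj])
    then show "(\<Sum>k. U c * indicator (?J k) c) \<le> U c" by (auto simp: indicator_def)
  qed simp
  also have "\<dots> < \<infinity>" using U_integral_finite by (simp add: ennreal_mult_less_top)
  finally have "(\<Sum>k. ennreal (\<epsilon> / 8) * emeasure M (exceed \<epsilon> k)) < \<infinity>" .
  moreover have "ennreal (\<epsilon> / 8) * emeasure M (exceed \<epsilon> k) = ennreal (\<epsilon> / 8 * measure M (exceed \<epsilon> k))" for k
    unfolding emeasure_eq_measure using assms by (intro ennreal_mult[symmetric]) auto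
  ultimately have "(\<Sum>k. ennreal (\<epsilon> / 8 * measure M (exceed \<epsilon> k))) < \<infinity>"
    by (simp only:)
  then have "summable (\<lambda>k. \<epsilon> / 8 * measure M (exceed \<epsilon> k))"
    using assms by (intro summable_suminf_not_top) auto
  then have "summable (\<lambda>k. 8 / \<epsilon> * (\<epsilon> / 8 * measure M (exceed \<epsilon> k)))" by (rule summable_mult)
  then show ?thesis using assms by simp
qed

lemma rational_energy_small:
  assumes "0 < \<epsilon>"
  shows "AE \<omega> in M. \<exists>k0. \<forall>k\<ge>k0. \<forall>t\<in>grid k. energy t \<omega> < ennreal \<epsilon>"
proof -
  have "AE \<omega> in M. eventually (\<lambda>k. \<omega> \<in> space M - exceed \<epsilon> k) sequentially"
    by (rule borel_cantelli_AE1[OF exceed_measurable _ exceed_summable[OF assms]]) (simp add: less_top[symmetric])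
  then show ?thesis
    by eventually_elim (auto simp: eventually_sequentially exceed_def not_le)
qed

text \<open>A rational time slightly after \<open>t\<close> in the same block has small energy.
  Finite sums of squares are continuous in \<open>t\<close>, so the bound is transferred for one
  finite set \<open>X\<close> at a time.\<close>

lemma finite_sums_small:
  assumes cont: "\<forall>x. continuous_on {0..} (\<lambda>t. u t x \<omega>)"
    and small: "\<forall>k\<ge>k0. \<forall>t\<in>grid k. energy t \<omega> < ennreal \<epsilon>" and \<epsilon>: "0 < \<epsilon>"
    and t: "real k0 / 8 \<le> t" and X: "finite X"
  shows "(\<Sum>x\<in>X. (u t x \<omega>)\<^sup>2) \<le> \<epsilon>"
proof (rule ccontr)
  assume "\<not> ?thesis"
  then have gt: "\<epsilon> < (\<Sum>x\<in>X. (u t x \<omega>)\<^sup>2)" by simp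
  let ?\<phi> = "\<lambda>t. \<Sum>x\<in>X. (u t x \<omega>)\<^sup>2"
  have t0: "0 \<le> t" using t by (rule order_trans[rotated]) simp
  have cphi: "continuous_on {0..} ?\<phi>" using cont by (intro continuous_intros) auto
  \<comment> \<open>The block with \<open>real k / 8 \<le> t\<close> and
    \<open>t < (real k + 1) / 8\<close>; the strict inequality leaves space for a rational
    \<open>r\<close> to the right of \<open>t\<close>.\<close>
  define k where "k = nat \<lfloor>8 * t\<rfloor>"
  have k: "real k \<le> 8 * t" "8 * t < real k + 1" using t0 by (auto simp: k_def)
  have "real k0 \<le> 8 * t" using t by simp
  then have kk: "k0 \<le> k" using k by linarith
  have "t \<in> {0..}" "0 < ?\<phi> t - \<epsilon>" using t0 gt by auto
  from cphi[unfolded continuous_on_iff, rule_format, OF this]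
  obtain \<delta> where \<delta>: "0 < \<delta>" "\<And>t'. t' \<in> {0..} \<Longrightarrow> dist t' t < \<delta> \<Longrightarrow> dist (?\<phi> t') (?\<phi> t) < ?\<phi> t - \<epsilon>"
    by blast
  have "t < min ((real k + 1) / 8) (t + \<delta>)" using k \<delta>(1) by simp
  from Rats_dense_in_real[OF this] obtain r where r: "r \<in> \<rat>" "t < r" "r < (real k + 1) / 8" "r < t + \<delta>" by auto
  have "r \<in> grid k" using r k by (simp add: grid_def)
  then have "energy r \<omega> < ennreal \<epsilon>" using small kk by blast
  moreover have "ennreal (?\<phi> r) \<le> energy r \<omega>"
    unfolding energy_def using sum_le_nn_integral_count[OF X, of "\<lambda>x. ennreal ((u r x \<omega>)\<^sup>2)"] by simp
  ultimately have "ennreal (?\<phi> r) < ennreal \<epsilon>" by (rule order_le_less_trans[rotated])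
  then have "?\<phi> r < \<epsilon>" by (simp add: ennreal_less_iff sum_nonneg)
  moreover have "dist (?\<phi> r) (?\<phi> t) < ?\<phi> t - \<epsilon>"
    using r t0 by (intro \<delta>(2)) (auto simp: dist_real_def)
  ultimately show False by (simp add: dist_real_def)
qed

lemma ennreal_dense_real:
  assumes "0 < (l :: ennreal)"
  obtains d :: real where "0 < d" "ennreal d < l"
proof -
  from dense[OF assms] obtain e where e: "0 < e" "e < l" by blast
  then obtain d where "e = ennreal d" "0 \<le> d" by (cases e) auto
  with e show ?thesis by (intro that[of d]) auto
qed

theorem dissipation:
  "AE \<omega> in M. ((\<lambda>t. SUP x. ennreal \<bar>u t x \<omega>\<bar>) \<longlongrightarrow> 0) at_top \<and>
     ((\<lambda>t. \<Sum>\<^sub>\<infinity>x. ennreal (\<bar>u t x \<omega>\<bar>\<^sup>2)) \<longlongrightarrow> 0) at_top"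
proof -
  \<comment> \<open>Countably many levels suffice for the limit and keep the exceptional set
    null.\<close>
  have "AE \<omega> in M. \<forall>j::nat. \<exists>k0. \<forall>k\<ge>k0. \<forall>t\<in>grid k. energy t \<omega> < ennreal (inverse (real (Suc j)))"
    unfolding AE_all_countable by (intro allI rational_energy_small) simp
  moreover have "AE \<omega> in M. \<forall>x. continuous_on {0..} (\<lambda>t. u t x \<omega>)"
    unfolding AE_all_countable by (intro allI u_continuous)
  ultimately show ?thesis
  proof eventually_elim
    fix \<omega>
    assume small: "\<forall>j::nat. \<exists>k0. \<forall>k\<ge>k0. \<forall>t\<in>grid k. energy t \<omega> < ennreal (inverse (real (Suc j)))"
      and cont: "\<forall>x. continuous_on {0..} (\<lambda>t. u t x \<omega>)"
    have fin: "\<forall>\<^sub>F t in at_top. \<forall>X. finite X \<longrightarrow> (\<Sum>x\<in>X. (u t x \<omega>)\<^sup>2) \<le> \<epsilon>" if \<epsilon>: "0 < \<epsilon>" for \<epsilon> :: real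
    proof -
      from reals_Archimedean[OF \<epsilon>] obtain j where j: "inverse (real (Suc j)) < \<epsilon>" by blast
      from small obtain k0 where k0: "\<forall>k\<ge>k0. \<forall>t\<in>grid k. energy t \<omega> < ennreal (inverse (real (Suc j)))" by blast
      have "\<forall>X. finite X \<longrightarrow> (\<Sum>x\<in>X. (u t x \<omega>)\<^sup>2) \<le> \<epsilon>" if "real k0 / 8 \<le> t" for t
        using finite_sums_small[OF cont k0 _ that] j by fastforce
      then show ?thesis by (intro eventually_at_top_linorderI[of "real k0 / 8"])
    qed
    have "((\<lambda>t. SUP x. ennreal \<bar>u t x \<omega>\<bar>) \<longlongrightarrow> 0) at_top"
    proof (rule order_tendstoI)
      fix l :: ennreal assume "0 < l"
      then obtain d where d: "0 < d" "ennreal d < l" by (rule ennreal_dense_real)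
      \<comment> \<open>The level is \<open>d\<^sup>2\<close> because a singleton
        \<open>X = {x}\<close> then gives \<open>\<bar>u t x \<omega>\<bar> \<le> d\<close>.\<close>
      from fin[of "d\<^sup>2"] d(1) have "\<forall>\<^sub>F t in at_top. \<forall>X. finite X \<longrightarrow> (\<Sum>x\<in>X. (u t x \<omega>)\<^sup>2) \<le> d\<^sup>2" by simp
      then show "\<forall>\<^sub>F t in at_top. (SUP x. ennreal \<bar>u t x \<omega>\<bar>) < l"
      proof eventually_elim
        fix t assume *: "\<forall>X. finite X \<longrightarrow> (\<Sum>x\<in>X. (u t x \<omega>)\<^sup>2) \<le> d\<^sup>2"
        have "\<bar>u t x \<omega>\<bar> \<le> d" for x
          using *[rule_format, of "{x}"] d(1) by (simp add: abs_le_square_iff[symmetric])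
        then have "(SUP x. ennreal \<bar>u t x \<omega>\<bar>) \<le> ennreal d" by (intro SUP_least ennreal_leI)
        then show "(SUP x. ennreal \<bar>u t x \<omega>\<bar>) < l" using d(2) by (rule order_le_less_trans)
      qed
    qed simp
    moreover have "((\<lambda>t. \<Sum>\<^sub>\<infinity>x. ennreal (\<bar>u t x \<omega>\<bar>\<^sup>2)) \<longlongrightarrow> 0) at_top"
    proof (rule order_tendstoI)
      fix l :: ennreal assume "0 < l"
      then obtain d where d: "0 < d" "ennreal d < l" by (rule ennreal_dense_real)
      from fin[OF d(1)] show "\<forall>\<^sub>F t in at_top. (\<Sum>\<^sub>\<infinity>x. ennreal (\<bar>u t x \<omega>\<bar>\<^sup>2)) < l"
      proof eventually_elim
        fix t assume *: "\<forall>X. finite X \<longrightarrow> (\<Sum>x\<in>X. (u t x \<omega>)\<^sup>2) \<le> d"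
        have "(\<Sum>\<^sub>\<infinity>x. ennreal (\<bar>u t x \<omega>\<bar>\<^sup>2)) \<le> ennreal d"
          using * by (subst nonneg_infsum_complete) (auto intro!: SUP_least ennreal_leI)
        then show "(\<Sum>\<^sub>\<infinity>x. ennreal (\<bar>u t x \<omega>\<bar>\<^sup>2)) < l" using d(2) by (rule order_le_less_trans)
      qed
    qed simp
    ultimately show "((\<lambda>t. SUP x. ennreal \<bar>u t x \<omega>\<bar>) \<longlongrightarrow> 0) at_top \<and>
     ((\<lambda>t. \<Sum>\<^sub>\<infinity>x. ennreal (\<bar>u t x \<omega>\<bar>\<^sup>2)) \<longlongrightarrow> 0) at_top" ..
  qed
qed

end

section \<open>The Lipschitz constant, and the lattice walk as an instance of the abstract
  setting\<close>

text \<open>Any Lipschitz bound makes the set of difference quotients bounded above, so the supremum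
  is genuine; the quotient against 0 gives linear growth.\<close>

lemma Lip_const_bound:
  assumes "L-lipschitz_on UNIV \<sigma>" "\<sigma> 0 = 0"
  shows "0 \<le> Lip_const \<sigma>" "\<bar>\<sigma> a\<bar> \<le> Lip_const \<sigma> * \<bar>a\<bar>"
proof -
  let ?S = "(\<lambda>(a, b). \<bar>\<sigma> a - \<sigma> b\<bar> / \<bar>a - b\<bar>) ` {(a, b). a \<noteq> b}"
  have bdd: "bdd_above ?S"
  proof (rule bdd_aboveI)
    fix q assume "q \<in> ?S"
    then obtain a b where "a \<noteq> b" "q = \<bar>\<sigma> a - \<sigma> b\<bar> / \<bar>a - b\<bar>" by auto
    then show "q \<le> L"
      using lipschitz_onD[OF assms(1), of a b] by (simp add: dist_real_def divide_le_eq)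
  qed
  have le: "\<bar>\<sigma> a - \<sigma> b\<bar> / \<bar>a - b\<bar> \<le> Lip_const \<sigma>" if "a \<noteq> b" for a b
    unfolding Lip_const_def using cSUP_upper[OF _ bdd, of "(a, b)"] that by simp
  have "0 \<le> \<bar>\<sigma> 1 - \<sigma> 0\<bar> / \<bar>1 - (0::real)\<bar>" by simp
  then show "0 \<le> Lip_const \<sigma>" using le[of 1 0] by linarith
  show "\<bar>\<sigma> a\<bar> \<le> Lip_const \<sigma> * \<bar>a\<bar>"
    using le[of a 0] assms(2) by (cases "a = 0") (auto simp: divide_le_eq)
qed

theorem theorem2p7:
  fixes M :: "'w measure" and W :: "'v measure"
    and B :: "int ^ 'd::finite \<Rightarrow> real \<Rightarrow> 'w \<Rightarrow> real"
    and N :: "real \<Rightarrow> 'v \<Rightarrow> nat"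
    and Z :: "nat \<Rightarrow> 'v \<Rightarrow> int ^ 'd"
    and X X' :: "real \<Rightarrow> 'v \<Rightarrow> int ^ 'd"
    and \<sigma> :: "real \<Rightarrow> real"
    and u0 :: "int ^ 'd \<Rightarrow> real"
    and u :: "real \<Rightarrow> int ^ 'd \<Rightarrow> 'w \<Rightarrow> real"
  assumes "prob_space M" and "prob_space W"
    and "indep_brownian_motions M B"
    and "ct_random_walk W N Z X"
    and "independent_copy W X X'"
    and "\<exists>L. L-lipschitz_on UNIV \<sigma>" and "\<sigma> 0 = 0"
    and "\<forall>x. u0 x \<ge> 0" and "bdd_above (range u0)" and "0 < (SUP x. u0 x)"
    and "SHE_solution M B (walk_prob W X) \<sigma> u0 u"
    and "Lip_const \<sigma> < enn2real (Upsilon0 W X X') powr (- 1 / 2)"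
    and "\<exists>\<alpha>>1. collision_prob W X X' \<in> O[at_top](\<lambda>t. t powr (- \<alpha>))"
    and "(\<lambda>x. \<bar>u0 x\<bar>) summable_on UNIV"
    and "complete_measure M"
  shows "AE \<omega> in M.
           ((\<lambda>t. SUP x. ennreal \<bar>u t x \<omega>\<bar>) \<longlongrightarrow> 0) at_top \<and>
           ((\<lambda>t. \<Sum>\<^sub>\<infinity>x. ennreal (\<bar>u t x \<omega>\<bar>\<^sup>2)) \<longlongrightarrow> 0) at_top"
proof -
  obtain L where L: "L-lipschitz_on UNIV \<sigma>" using assms(6) by blast
  note lip = Lip_const_bound[OF L assms(7)]
  obtain \<mu> where \<mu>: "\<forall>z. \<forall>j\<ge>1. measure W {\<omega>\<in>space W. Z j \<omega> = z} = pmf \<mu> z"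
    using jump_pmf_exists[OF assms(2,4)] by blast
  have p_eq: "walk_prob W X t x = pmf (walk_pmf \<mu> t) x" if "0 \<le> t" for t x
    by (rule walk_law[OF assms(2,4) _ that]) (use \<mu> in blast)
  interpret bm_system M B
    by (intro bm_system.intro bm_family.intro bm_family_axioms.intro assms(1,3))
  interpret R: renewal "\<lambda>t z. ennreal ((pmf (walk_pmf \<mu> t) z)\<^sup>2)"
    by standard (use pmf_walk_measurable[of \<mu>] in simp)
  have mass: "R.mass t = ennreal (collision_prob W X X' t)" if "0 \<le> t" for t
    unfolding R.mass_def collision_prob_sum[OF assms(2,4,5) that] p_eq[OF that] ..
  have total: "R.total_mass = Upsilon0 W X X'"
    unfolding R.total_mass_def Upsilon0_def
    by (intro nn_integral_cong) (simp add: mass indicator_def)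
  let ?Y = "Upsilon0 W X X'"
  \<comment> \<open>\<open>enn2real\<close> sends infinity to 0 and \<open>0 powr (- 1 / 2)\<close>
    is 0, so an infinite value would force \<open>Lip_const \<sigma>\<close> to be negative.\<close>
  have Y_finite: "?Y < \<infinity>"
  proof (rule ccontr)
    assume "\<not> ?Y < \<infinity>"
    then have "?Y = \<infinity>" using less_top[of ?Y] by auto
    then show False using assms(12) lip(1) by simp
  qed
  have small: "ennreal ((Lip_const \<sigma>)\<^sup>2) * ?Y < 1"
  proof -
    define y where "y = enn2real ?Y"
    have y: "?Y = ennreal y" "0 \<le> y" using Y_finite by (simp_all add: y_def)
    \<comment> \<open>The value 0 is excluded by the same convention for
      \<open>powr\<close>.\<close>
    have y0: "0 < y" using assms(12) lip(1) y(2) unfolding y_def[symmetric] by (cases "y = 0") auto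
    have "(Lip_const \<sigma>)\<^sup>2 < (y powr (- 1 / 2))\<^sup>2"
      using assms(12) lip(1) unfolding y_def[symmetric] by (intro power_strict_mono) auto
    also have "(y powr (- 1 / 2))\<^sup>2 = y powr (- 1)"
      by (simp add: power2_eq_square powr_add[symmetric])
    also have "\<dots> = 1 / y" using y0 by (simp add: powr_minus_divide)
    finally have "(Lip_const \<sigma>)\<^sup>2 * y < 1" using y0 by (simp add: less_divide_eq)
    then show ?thesis using y by (simp add: ennreal_mult[symmetric] ennreal_less_one_iff)
  qed
  have u0: "u0 summable_on UNIV"
    using assms(8,14) by (simp add: abs_of_nonneg)
  interpret S: she M B "walk_pmf \<mu>" "walk_prob W X" \<sigma> u0 u "Lip_const \<sigma>"
  proof unfold_locales
    show "\<sigma> \<in> borel_measurable borel"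
      by (rule borel_measurable_continuous_onI[OF lipschitz_on_continuous_on[OF L]])
  qed (use p_eq walk_pmf_semigroup pmf_walk_measurable pmf_walk_stay lip assms(8,11) u0 total Y_finite small in auto)
  show ?thesis by (rule S.dissipation)
qed

end
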